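(* Let $A\in\mathscr{R}$ be a fixed set. In the risk model described in the context, suppose that the claim vectors $\{\mathbf{X}^{(i)}, i\in\mathbb{N}\}$ are identically distributed with common distribution $F$ supported on the nonnegative quadrant; that $\{\mathbf{X}^{(i)}, i\in\mathbb{N}\}$, $\{N(t), t\ge 0\}$ and $\{\xi(t), t\ge 0\}$ are mutually independent; that $\{\mathbf{X}^{(i)}, i\in\mathbb{N}\}$ are quasi-asymptotically independent on $A$ ($QAI_A$); that $F\in(\mathcal{C}\cap\mathcal{P_D})_A$; and that there exist $p_1,p_2$ with $0<p_1<J_{F_A}^-\le J_{F_A}^+<p_2<\infty$ such that $$\sum_{i=1}^{\infty}\left(\mathbf{E}\left[e^{-p_1\xi(\tau_i)}\right]\vee\mathbf{E}\left[e^{-p_2\xi(\tau_i)}\right]\right)^{1/\rho}<\infty,$$ where $\rho=1$ if $0<J_{F_A}^+<1$ and $\rho=p_2$ if $J_{F_A}^+\ge1$. If $F\in MRV_{-\alpha}(\mu,G)$ (with $\alpha\in(0,\infty)$), then, as $x\to\infty$, $$\mathbf{P}\left[\mathbf{D}(\infty)\in xA\right]\sim\mu(A)\,\overline{G}(x)\int_0^\infty\mathbf{E}\left[e^{-\alpha\,\xi(s)}\right]\lambda(ds).$$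
   Context: Risk model. Fix $d\in\mathbb{N}$. The claim vectors $\mathbf{X}^{(i)}=(X^{(i)}_1,\dots,X^{(i)}_d)^\top$, $i\in\mathbb{N}$, are identically distributed copies of a random vector $\mathbf{X}$ with distribution $F$ supported on $[0,\infty)^d$; a claim vector may have zero components but is not the zero vector. They are not assumed independent of each other, and the components of each vector may be arbitrarily dependent. Claims arrive at random times $\{\tau_i, i\in\mathbb{N}\}$ forming a renewal counting process $N(t)=\sup\{i\in\mathbb{N}:\tau_i\le t\}$, $t\ge 0$ (with $\sup\emptyset=0$), i.e. $\tau_i$ are the partial sums of i.i.d. nonnegative inter-arrival times (not a.s. zero). Its renewal function $\lambda(t)=\mathbf{E}[N(t)]=\sum_{i\ge1}\mathbf{P}[\tau_i\le t]$ is finite for finite $t$, and $\lambda(ds)=\sum_{i\ge 1}\mathbf{P}[\tau_i\in ds]$ is the renewal measure. $\{\xi(t),t\ge0\}$ is a real-valued càdlàg stochastic process with $\xi(0)=0$. The discounted aggregate claim vector over the infinite horizon is $\mathbf{D}(\infty)=\sum_{i=1}^{\infty}\mathbf{X}^{(i)}e^{-\xi(\tau_i)}$. Sets. A set $B\subset\mathbb{R}^d$ is increasing if $\mathbf{x}+\mathbf{y}\in B$ for all $\mathbf{x}\in B$ and $\mathbf{y}\in[0,\infty)^d$. $\mathscr{R}$ is the family of all $A\subset\mathbb{R}^d$ that are open, increasing, with convex complement $A^c$, and with $\mathbf{0}\notin\overline{A}$. Reduction to one dimension. For a random vector $\mathbf{Z}$ supported on $[0,\infty)^d$ with distribution $V$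 and $A\in\mathscr{R}$, put $Z_A=\sup\{u:\mathbf{Z}\in uA\}$ (with $\sup\emptyset=0$); its distribution $V_A$ satisfies $\overline{V_A}(x)=\mathbf{P}[Z_A>x]=\mathbf{P}[\mathbf{Z}\in xA]$ for $x>0$. Here $\overline{G}=1-G$ denotes the tail of a distribution $G$. In particular $F_A$ is the distribution of $\sup\{u:\mathbf{X}\in uA\}$. Classes and indices. Let $G$ be a distribution on $[0,\infty)$ with $\overline G(x)>0$ for all $x\ge0$. For $y>1$ put $\overline{G}_*(y)=\liminf_{x\to\infty}\overline{G}(yx)/\overline{G}(x)$ and $\overline{G}^*(y)=\limsup_{x\to\infty}\overline{G}(yx)/\overline{G}(x)$. $G\in\mathcal{C}$ (consistently varying) if $\lim_{b\uparrow1}\limsup_{x\to\infty}\overline{G}(bx)/\overline{G}(x)=1$. $G\in\mathcal{P_D}$ (positively decreasing) if $\overline{G}^*(y)<1$ for any (equivalently, some) $y>1$. The upper and lower Matuszewska indices are $J_G^+=-\lim_{y\to\infty}\log\overline{G}_*(y)/\log y$ and $J_G^-=-\lim_{y\to\infty}\log\overline{G}^*(y)/\log y$. $V\in(\mathcal{C}\cap\mathcal{P_D})_A$ means $V_A\in\mathcal{C}\cap\mathcal{P_D}$. Multivariate regular variation. A distribution $G$ on $[0,\infty)$ with everywhere positive tail is in $\mathcal{R}_{-\alpha}$, $\alpha\in(0,\infty)$, if $\overline{G}(yx)\sim y^{-\alpha}\overline{G}(x)$ as $x\to\infty$ for every $y>0$. The distribution $V$ of a random vector $\mathbf{Z}$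 on $[0,\infty)^d$ is in $MRV_{-\alpha}(\mu,G)$ if $G\in\mathcal{R}_{-\alpha}$ and $\mu$ is a Radon measure, not identically zero, with $\lim_{x\to\infty}\mathbf{P}[\mathbf{Z}\in xB]/\overline{G}(x)=\mu(B)$ for every Borel set $B\subsetneq[0,\infty]^d$ bounded away from $\mathbf{0}$ with $\mu(\partial B)=0$. Since $\mu$ lives on the nonnegative quadrant, $\mu(A)$ means $\mu(A\cap[0,\infty)^d)$. Dependence. Nonnegative random variables $\{Z_i,i\ge1\}$ with distributions $V_1,V_2,\dots$ are quasi-asymptotically independent (QAI) if $\lim_{x\to\infty}\mathbf{P}[Z_i>x,\,Z_j>x]/(\overline{V_i}(x)+\overline{V_j}(x))=0$ for all $i\ne j$. Nonnegative random vectors $\{\mathbf{Z}^{(i)},i\in\mathbb{N}\}$ are $QAI_A$ if the random variables $Z_A^{(i)}=\sup\{u:\mathbf{Z}^{(i)}\in uA\}$, $i\in\mathbb{N}$, are QAI.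
   Formalization: When μ(A)=0, which the hypotheses allow, the right-hand side is 0 while the probability is positive, so "∼" fails literally; the formal theorem proves the stated equivalence for μ(A)>0 and, for μ(A)=0, that P[D(∞)∈xA] is o of the tail of G. *)

theory Defs
  imports "HOL-Probability.Probability" "HOL-Library.Landau_Symbols"
begin

definition quadrant :: "(real ^ 'd) set" where
  "quadrant = {z. \<forall>j. 0 \<le> z $ j}"

definition increasing_set :: "(real ^ 'd) set \<Rightarrow> bool" where
  "increasing_set B \<longleftrightarrow> (\<forall>x\<in>B. \<forall>y\<in>quadrant. x + y \<in> B)"

definition risk_sets :: "(real ^ 'd) set set" where
  "risk_sets = {A. open A \<and> increasing_set A \<and> convex (- A) \<and> 0 \<notin> closure A}"

definition scale_set :: "real \<Rightarrow> (real ^ 'd) set \<Rightarrow> (real ^ 'd) set" where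
  "scale_set u A = (\<lambda>a. u *\<^sub>R a) ` A"

text \<open>The supremum of the empty set is 0 by convention; on \<^typ>\<open>real\<close> it is unspecified.\<close>
definition reduce :: "(real ^ 'd) set \<Rightarrow> real ^ 'd \<Rightarrow> real" where
  "reduce A z = (let U = {u. z \<in> scale_set u A} in if U = {} then 0 else Sup U)"

definition reduced_distr :: "(real ^ 'd) set \<Rightarrow> (real ^ 'd) measure \<Rightarrow> real measure" where
  "reduced_distr A V = distr V borel (reduce A)"

definition quadrant_distribution :: "(real ^ 'd) measure \<Rightarrow> bool" where
  "quadrant_distribution V \<longleftrightarrow> prob_space V \<and> sets V = sets borel \<and> (AE z in V. z \<in> quadrant)"

definition tail :: "real measure \<Rightarrow> real \<Rightarrow> real" where
  "tail G x = measure G {x<..}"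

definition pos_tail_distribution :: "real measure \<Rightarrow> bool" where
  "pos_tail_distribution G \<longleftrightarrow>
     real_distribution G \<and> (AE x in G. 0 \<le> x) \<and> (\<forall>x\<ge>0. 0 < tail G x)"

definition lower_tail_ratio :: "real measure \<Rightarrow> real \<Rightarrow> ereal" where
  "lower_tail_ratio G y = Liminf at_top (\<lambda>x. ereal (tail G (y * x) / tail G x))"

definition upper_tail_ratio :: "real measure \<Rightarrow> real \<Rightarrow> ereal" where
  "upper_tail_ratio G y = Limsup at_top (\<lambda>x. ereal (tail G (y * x) / tail G x))"

definition consistently_varying :: "real measure \<Rightarrow> bool" where
  "consistently_varying G \<longleftrightarrow>
     pos_tail_distribution G \<and> ((\<lambda>b. upper_tail_ratio G b) \<longlongrightarrow> 1) (at_left 1)"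

definition positively_decreasing :: "real measure \<Rightarrow> bool" where
  "positively_decreasing G \<longleftrightarrow>
     pos_tail_distribution G \<and> (\<forall>y>1. upper_tail_ratio G y < 1)"

text \<open>The logarithm on \<open>[0,\<infinity>]\<close>; the lower tail ratio may be 0, which makes the upper index infinite.\<close>
definition log_ext :: "ereal \<Rightarrow> ereal" where
  "log_ext z = (if z \<le> 0 then - \<infinity> else if z = \<infinity> then \<infinity> else ereal (ln (real_of_ereal z)))"

definition upper_Matuszewska :: "real measure \<Rightarrow> ereal" where
  "upper_Matuszewska G = - Lim at_top (\<lambda>y. log_ext (lower_tail_ratio G y) / ereal (ln y))"

definition lower_Matuszewska :: "real measure \<Rightarrow> ereal" where
  "lower_Matuszewska G = - Lim at_top (\<lambda>y. log_ext (upper_tail_ratio G y) / ereal (ln y))"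

definition regularly_varying :: "real \<Rightarrow> real measure \<Rightarrow> bool" where
  "regularly_varying \<alpha> G \<longleftrightarrow> 0 < \<alpha> \<and> pos_tail_distribution G \<and>
     (\<forall>y>0. (\<lambda>x. tail G (y * x)) \<sim>[at_top] (\<lambda>x. y powr (- \<alpha>) * tail G x))"

text \<open>
  The compactified quadrant \<open>[0,\<infinity>]\<^sup>d\<close> is the type \<^typ>\<open>ennreal ^ 'd\<close>, so that closures,
  frontiers and compactness below are those of \<open>[0,\<infinity>]\<^sup>d\<close>.
\<close>
definition embed :: "real ^ 'd \<Rightarrow> ennreal ^ 'd" where
  "embed z = (\<chi> j. ennreal (z $ j))"

definition scale_ext :: "real \<Rightarrow> (ennreal ^ 'd) set \<Rightarrow> (ennreal ^ 'd) set" where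
  "scale_ext x B = (\<lambda>b. \<chi> j. ennreal x * b $ j) ` B"

text \<open>
  Radon measures on the punctured space \<open>[0,\<infinity>]\<^sup>d - {0}\<close>. This space is locally compact with a
  countable base, so every Borel measure finite on compact sets is regular.
\<close>
definition radon_punctured :: "(ennreal ^ 'd) measure \<Rightarrow> bool" where
  "radon_punctured \<mu> \<longleftrightarrow> sets \<mu> = sets (restrict_space borel (- {0})) \<and>
     (\<forall>K. compact K \<and> 0 \<notin> K \<longrightarrow> emeasure \<mu> K < \<infinity>)"

text \<open>
  A set is bounded away from the origin if the origin is not in its closure; such a set is
  automatically a proper subset of \<open>[0,\<infinity>]\<^sup>d\<close>.
\<close>
definition MRV :: "real \<Rightarrow> (ennreal ^ 'd) measure \<Rightarrow> real measure \<Rightarrow> (real ^ 'd) measure \<Rightarrow> bool" where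
  "MRV \<alpha> \<mu> G V \<longleftrightarrow>
     quadrant_distribution V \<and> regularly_varying \<alpha> G \<and>
     radon_punctured \<mu> \<and> emeasure \<mu> (space \<mu>) \<noteq> 0 \<and>
     (\<forall>B\<in>sets borel. 0 \<notin> closure B \<and> emeasure \<mu> (frontier B) = 0 \<longrightarrow>
        ((\<lambda>x. measure V {z. embed z \<in> scale_ext x B} / tail G x) \<longlongrightarrow> measure \<mu> B) at_top)"

text \<open>
  A set \<open>A\<close> in \<open>\<real>\<^sup>d\<close> is not confined to the quadrant; its \<open>\<mu>\<close>-mass is that of its part in \<open>[0,\<infinity>)\<^sup>d\<close>.
\<close>
definition limit_mass :: "(ennreal ^ 'd) measure \<Rightarrow> (real ^ 'd) set \<Rightarrow> real" where
  "limit_mass \<mu> A = measure \<mu> (embed ` (A \<inter> quadrant))"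

definition QAI :: "'w measure \<Rightarrow> (nat \<Rightarrow> 'w \<Rightarrow> real) \<Rightarrow> bool" where
  "QAI M Z \<longleftrightarrow> (\<forall>i j. i \<noteq> j \<longrightarrow>
     ((\<lambda>x. measure M {\<omega>\<in>space M. Z i \<omega> > x \<and> Z j \<omega> > x} /
           (measure M {\<omega>\<in>space M. Z i \<omega> > x} + measure M {\<omega>\<in>space M. Z j \<omega> > x})) \<longlongrightarrow> 0) at_top)"

definition QAI_on :: "(real ^ 'd) set \<Rightarrow> 'w measure \<Rightarrow> (nat \<Rightarrow> 'w \<Rightarrow> real ^ 'd) \<Rightarrow> bool" where
  "QAI_on A M Z \<longleftrightarrow> QAI M (\<lambda>i \<omega>. reduce A (Z i \<omega>))"

definition generated_sigma ::
    "'w measure \<Rightarrow> 'b measure \<Rightarrow> 'i set \<Rightarrow> ('i \<Rightarrow> 'w \<Rightarrow> 'b) \<Rightarrow> 'w set set" where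
  "generated_sigma M S I Y =
     sigma_sets (space M) (\<Union>i\<in>I. {Y i -` B \<inter> space M | B. B \<in> sets S})"

text \<open>
  Sequences are indexed from 0: \<open>X i\<close>, \<open>arrival \<theta> i\<close> are the claim vector and the arrival
  time with number \<open>i + 1\<close>, and \<open>\<theta> i\<close> is the inter-arrival time preceding that arrival.
\<close>
definition arrival :: "(nat \<Rightarrow> 'w \<Rightarrow> real) \<Rightarrow> nat \<Rightarrow> 'w \<Rightarrow> real" where
  "arrival \<theta> i \<omega> = (\<Sum>k\<le>i. \<theta> k \<omega>)"

definition claim_number :: "(nat \<Rightarrow> 'w \<Rightarrow> real) \<Rightarrow> real \<Rightarrow> 'w \<Rightarrow> enat" where
  "claim_number \<theta> t \<omega> = Sup {enat (Suc i) | i. arrival \<theta> i \<omega> \<le> t}"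

definition renewal_function :: "'w measure \<Rightarrow> (nat \<Rightarrow> 'w \<Rightarrow> real) \<Rightarrow> real \<Rightarrow> ennreal" where
  "renewal_function M \<theta> t = (\<integral>\<^sup>+\<omega>. ennreal_of_enat (claim_number \<theta> t \<omega>) \<partial>M)"

definition renewal_arrivals :: "'w measure \<Rightarrow> (nat \<Rightarrow> 'w \<Rightarrow> real) \<Rightarrow> bool" where
  "renewal_arrivals M \<theta> \<longleftrightarrow>
     prob_space.indep_vars M (\<lambda>_. borel) \<theta> UNIV \<and>
     (\<forall>i. distr M borel (\<theta> i) = distr M borel (\<theta> 0)) \<and>
     (\<forall>i. \<forall>\<omega>\<in>space M. 0 \<le> \<theta> i \<omega>) \<and>
     \<not> (AE \<omega> in M. \<theta> 0 \<omega> = 0) \<and>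
     (\<forall>t\<ge>0. renewal_function M \<theta> t < \<infinity>)"

definition renewal_measure :: "'w measure \<Rightarrow> (nat \<Rightarrow> 'w \<Rightarrow> real) \<Rightarrow> real measure" where
  "renewal_measure M \<theta> =
     measure_of UNIV (sets borel) (\<lambda>B. \<Sum>i. emeasure (distr M borel (arrival \<theta> i)) B)"

lemma sets_renewal_measure [simp, measurable_cong]: "sets (renewal_measure M \<theta>) = sets borel"
  unfolding renewal_measure_def by (metis sets.sigma_sets_eq sets_measure_of space_borel subset_UNIV Pow_UNIV)

lemma emeasure_renewal_measure:
  assumes "B \<in> sets borel"
  shows "emeasure (renewal_measure M \<theta>) B = (\<Sum>i. emeasure (distr M borel (arrival \<theta> i)) B)"
proof (rule emeasure_measure_of[OF renewal_measure_def])
  show "countably_additive (sets (renewal_measure M \<theta>))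
     (\<lambda>B. \<Sum>i. emeasure (distr M borel (arrival \<theta> i)) B)"
    unfolding countably_additive_def sets_renewal_measure
  proof (intro allI impI)
    fix S :: "nat \<Rightarrow> real set"
    assume S: "range S \<subseteq> sets borel" "disjoint_family S"
    have "(\<Sum>n. \<Sum>i. emeasure (distr M borel (arrival \<theta> i)) (S n)) =
      (\<integral>\<^sup>+n. (\<Sum>i. emeasure (distr M borel (arrival \<theta> i)) (S n)) \<partial>count_space UNIV)"
      by (simp add: nn_integral_count_space_nat)
    also have "\<dots> = (\<Sum>i. \<integral>\<^sup>+n. emeasure (distr M borel (arrival \<theta> i)) (S n) \<partial>count_space UNIV)"
      by (rule nn_integral_suminf) simp
    also have "\<dots> = (\<Sum>i. emeasure (distr M borel (arrival \<theta> i)) (\<Union>n. S n))"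
      using S by (simp add: nn_integral_count_space_nat suminf_emeasure)
    finally show "(\<Sum>n. \<Sum>i. emeasure (distr M borel (arrival \<theta> i)) (S n)) =
      (\<Sum>i. emeasure (distr M borel (arrival \<theta> i)) (\<Union>n. S n))" .
  qed
qed (use assms in \<open>auto simp: positive_def\<close>)

definition cadlag :: "(real \<Rightarrow> real) \<Rightarrow> bool" where
  "cadlag f \<longleftrightarrow> (\<forall>t\<ge>0. continuous (at_right t) f) \<and> (\<forall>t>0. \<exists>l. (f \<longlongrightarrow> l) (at_left t))"

definition cadlag_process :: "'w measure \<Rightarrow> (real \<Rightarrow> 'w \<Rightarrow> real) \<Rightarrow> bool" where
  "cadlag_process M \<xi> \<longleftrightarrow> (\<forall>t\<ge>0. \<xi> t \<in> borel_measurable M) \<and>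
     (\<forall>\<omega>\<in>space M. \<xi> 0 \<omega> = 0 \<and> cadlag (\<lambda>t. \<xi> t \<omega>))"

text \<open>
  Where the series diverges, \<^term>\<open>suminf\<close> is one fixed unspecified vector. As the origin is not in
  the closure of \<open>A\<close>, that vector lies outside \<open>x A\<close> for all large \<open>x\<close>, so divergent outcomes do
  not contribute to the probability of the event \<open>D(\<infinity>) \<in> x A\<close> as \<open>x\<close> tends to infinity.
\<close>
definition discounted_claims ::
    "(nat \<Rightarrow> 'w \<Rightarrow> real ^ 'd) \<Rightarrow> (nat \<Rightarrow> 'w \<Rightarrow> real) \<Rightarrow> (real \<Rightarrow> 'w \<Rightarrow> real) \<Rightarrow> 'w \<Rightarrow> real ^ 'd" where
  "discounted_claims X \<theta> \<xi> \<omega> = (\<Sum>i. exp (- \<xi> (arrival \<theta> i \<omega>) \<omega>) *\<^sub>R X i \<omega>)"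

text \<open>
  The three processes take values in different types, hence independence of the generated
  sigma-algebras instead of \<^const>\<open>prob_space.indep_vars\<close>.
\<close>
definition mutually_independent ::
    "'w measure \<Rightarrow> (nat \<Rightarrow> 'w \<Rightarrow> real ^ 'd) \<Rightarrow> (nat \<Rightarrow> 'w \<Rightarrow> real) \<Rightarrow> (real \<Rightarrow> 'w \<Rightarrow> real) \<Rightarrow> bool" where
  "mutually_independent M X \<theta> \<xi> \<longleftrightarrow>
     prob_space.indep_sets M
       (\<lambda>k. [generated_sigma M borel UNIV X,
             generated_sigma M (count_space UNIV) {0..} (claim_number \<theta>),
             generated_sigma M borel {0..} \<xi>] ! k) {..<3}"

definition moment :: "'w measure \<Rightarrow> (nat \<Rightarrow> 'w \<Rightarrow> real) \<Rightarrow> (real \<Rightarrow> 'w \<Rightarrow> real) \<Rightarrow> real \<Rightarrow> nat \<Rightarrow> real" where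
  "moment M \<theta> \<xi> p i = (\<integral>\<omega>. exp (- p * \<xi> (arrival \<theta> i \<omega>) \<omega>) \<partial>M)"

text \<open>
  The Bochner integral of a non-integrable function is 0, so the finiteness of the moments that is
  implicit in the convergence of the series is stated separately.
\<close>
definition moment_series_finite ::
    "'w measure \<Rightarrow> (nat \<Rightarrow> 'w \<Rightarrow> real) \<Rightarrow> (real \<Rightarrow> 'w \<Rightarrow> real) \<Rightarrow> real \<Rightarrow> real \<Rightarrow> real \<Rightarrow> bool" where
  "moment_series_finite M \<theta> \<xi> p1 p2 \<rho> \<longleftrightarrow>
     (\<forall>i. integrable M (\<lambda>\<omega>. exp (- p1 * \<xi> (arrival \<theta> i \<omega>) \<omega>)) \<and>
          integrable M (\<lambda>\<omega>. exp (- p2 * \<xi> (arrival \<theta> i \<omega>) \<omega>))) \<and>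
     summable (\<lambda>i. max (moment M \<theta> \<xi> p1 i) (moment M \<theta> \<xi> p2 i) powr (1 / \<rho>))"

text \<open>The domain of integration is \<open>[0,\<infinity>)\<close>: the renewal measure may have an atom at 0.\<close>
definition renewal_integral ::
    "'w measure \<Rightarrow> (nat \<Rightarrow> 'w \<Rightarrow> real) \<Rightarrow> (real \<Rightarrow> 'w \<Rightarrow> real) \<Rightarrow> real \<Rightarrow> ennreal" where
  "renewal_integral M \<theta> \<xi> \<alpha> =
     (\<integral>\<^sup>+s\<in>{0..}. (\<integral>\<^sup>+\<omega>. ennreal (exp (- \<alpha> * \<xi> s \<omega>)) \<partial>M) \<partial>renewal_measure M \<theta>)"

end

theory Submission
  imports Defs
begin

text \<open>
  Write \<open>h = reduce A\<close>. On the quadrant, \<open>h\<close> is the Minkowski functional of the convex complement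
  of \<open>A\<close>, so it is monotone and sublinear, and \<open>h z > x\<close> iff \<open>z \<in> x A\<close>. With
  \<open>Z\<^sub>i = exp (- \<xi> \<tau>\<^sub>i) h (X\<^sub>i)\<close> this gives \<open>max\<^sub>i Z\<^sub>i \<le> h (D \<infinity>) \<le> \<Sum>\<^sub>i Z\<^sub>i\<close>, which reduces the claim
  to one dimension. Multivariate regular variation yields \<open>P [h X > x] / G x \<longrightarrow> \<mu> A\<close> for the tail \<open>G\<close>,
  because \<open>{h > t}\<close> is a continuity set for all but countably many \<open>t\<close>. The Matuszewska indices
  enter only through Potter bounds, which turn the moment condition into a bound
  \<open>P [\<Sum>\<^sub>i\<^sub>\<ge>\<^sub>n Z\<^sub>i > x] \<le> K\<^sub>n P [h X > x]\<close> with \<open>K\<^sub>n \<longrightarrow> 0\<close>: the truncated moments of order \<open>\<rho>\<close>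
  are summed dyadically and combined by a weighted Jensen inequality. If \<open>\<mu> A = 0\<close> the bound with
  \<open>n = 0\<close> suffices. Otherwise the tail of \<open>h X\<close> is regularly varying, quasi-asymptotic independence
  makes joint exceedances negligible, and dominated convergence given the discount factors yields
  \<open>P [Z\<^sub>i > x] \<sim> \<mu> A (E [exp (- \<alpha> \<xi> \<tau>\<^sub>i)]) G x\<close>, whose sum is the renewal integral.
\<close>

section \<open>Matuszewska indices and Potter bounds\<close>

text \<open>The claims may depend on each other, so the series is estimated either pointwise in the
  outcome (truncation, convexity) or with the discount factors frozen. The exponents are dictated by
  the tail bound: a Potter bound with exponent \<open>q\<close> controls truncated moments of order
  \<rho> if \<open>q < \<rho>\<close>, and moments of order \<open>q\<close> of the discount factors
  follow by interpolation if \<open>p1 \<le> q \<le> p2\<close>; an upper index below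
  \<open>min p2 \<rho>\<close> leaves room for such a \<open>q\<close>. Regular variation is given
  on the compactified quadrant, where \<open>h\<close> is not defined. It is extended from below,
  and the power law that uniqueness of limits forces on the mass above its levels gives both the
  value at level 1 and the absence of mass at infinity. Finally \<open>h\<close> may vanish on
  non-zero vectors, so it says nothing about convergence of the vector series. For this a second
  gauge, the coordinate sum, is needed; when the limit mass of \<open>A\<close> is positive, its
  tail is bounded by a multiple of that of \<open>h X\<close>.\<close>

lemma lim_INF_of_eventually_below:
  fixes v :: "real \<Rightarrow> ereal"
  assumes "\<And>y c. y > 1 \<Longrightarrow> v y < ereal c \<Longrightarrow> \<forall>\<^sub>F s in at_top. v s < ereal c"
  shows "(v \<longlongrightarrow> (INF y\<in>{1<..}. v y)) at_top"
proof (rule order_tendstoI)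
  fix a assume a: "a < (INF y\<in>{1<..}. v y)"
  have "a < v y" if "y > 1" for y
    using a INF_lower[of y "{1<..}" v] that by (meson greaterThan_iff less_le_trans)
  then show "\<forall>\<^sub>F y in at_top. a < v y"
    by (auto intro: eventually_mono[OF eventually_gt_at_top[of "1::real"]])
next
  fix a assume "(INF y\<in>{1<..}. v y) < a"
  then obtain y where y: "y > 1" "v y < a" by (auto simp: INF_less_iff)
  then obtain c where c: "v y < ereal c" "ereal c < a" using ereal_dense2 by blast
  from assms[OF y(1) c(1)] show "\<forall>\<^sub>F y in at_top. v y < a"
    by (rule eventually_mono) (use c in auto)
qed

lemma tail_antimono:
  assumes "pos_tail_distribution G" "x \<le> y"
  shows "tail G y \<le> tail G x"
proof -
  interpret real_distribution G using assms by (simp add: pos_tail_distribution_def)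
  show ?thesis unfolding tail_def by (rule finite_measure_mono) (use assms in auto)
qed

lemma tail_pos:
  assumes "pos_tail_distribution G"
  shows "tail G x > 0"
  using assms tail_antimono[OF assms, of x "max x 0"]
  by (metis max.cobounded1 max.cobounded2 order_less_le_trans pos_tail_distribution_def)

lemma tail_le_1:
  assumes "pos_tail_distribution G"
  shows "tail G x \<le> 1"
proof -
  interpret real_distribution G using assms by (simp add: pos_tail_distribution_def)
  show ?thesis unfolding tail_def by simp
qed

lemma tail_tendsto_0:
  assumes "pos_tail_distribution G"
  shows "(tail G \<longlongrightarrow> 0) at_top"
proof -
  interpret real_distribution G using assms by (simp add: pos_tail_distribution_def)
  have "tail G = (\<lambda>x. 1 - cdf G x)"
  proof
    fix x
    have "{x<..} = space G - {..x}" by auto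
    then show "tail G x = 1 - cdf G x" unfolding tail_def cdf_def by (simp only:) (rule prob_compl, simp)
  qed
  moreover have "((\<lambda>x. 1 - cdf G x) \<longlongrightarrow> 1 - 1) at_top"
    by (intro tendsto_intros cdf_lim_at_top_prob)
  ultimately show ?thesis by simp
qed

lemma regularly_varying_ratio:
  assumes "regularly_varying \<alpha> G" "y > 0"
  shows "((\<lambda>x. tail G (y * x) / tail G x) \<longlongrightarrow> y powr (-\<alpha>)) at_top"
proof -
  have pos: "tail G x > 0" for x using assms by (auto simp: regularly_varying_def intro: tail_pos)
  have "(\<lambda>x. tail G (y * x)) \<sim>[at_top] (\<lambda>x. y powr (- \<alpha>) * tail G x)"
    using assms by (auto simp: regularly_varying_def)
  then have "((\<lambda>x. tail G (y * x) / (y powr (- \<alpha>) * tail G x)) \<longlongrightarrow> 1) at_top"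
    by (rule asymp_equivD_strong) (use pos assms in \<open>auto simp: less_imp_neq[THEN not_sym]\<close>)
  then have "((\<lambda>x. tail G (y * x) / (y powr (- \<alpha>) * tail G x) * y powr (-\<alpha>)) \<longlongrightarrow> 1 * y powr (-\<alpha>)) at_top"
    by (intro tendsto_intros)
  then show ?thesis using assms(2) by simp
qed

lemma antimono_le: "antimono f \<Longrightarrow> x \<le> y \<Longrightarrow> f y \<le> f x"
  by (simp add: antimonoD)

lemma powr_between:
  fixes y0 y :: real
  assumes "y0 > 1" "y \<ge> 1"
  obtains n :: nat where "y0 ^ n \<le> y" "y < y0 ^ Suc n"
proof -
  define n where "n = nat \<lfloor>log y0 y\<rfloor>"
  have l: "log y0 y \<ge> 0" using assms by simp
  have "real n \<le> log y0 y" "log y0 y < real n + 1"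
    using l unfolding n_def by linarith+
  then have "y0 powr real n \<le> y" "y < y0 powr (real n + 1)"
    using assms by (auto simp: le_log_iff log_less_iff)
  then show ?thesis using that[of n] assms
    by (simp add: powr_realpow powr_add mult.commute)
qed

text \<open>The bound for one step \<open>y0\<close> is iterated along \<open>y0 ^ n\<close>; a
  general \<open>y\<close> is rounded down to such a power, and the factor \<open>y0 powr p\<close>
  is the price of the rounding.\<close>

lemma upper_Potter:
  fixes f :: "real \<Rightarrow> real"
  assumes f: "antimono f" "\<And>x. f x > 0" and y0: "y0 > 1" and D: "D > 0" and p: "p \<ge> 0"
    and step: "\<And>x. x \<ge> D \<Longrightarrow> f (y0 * x) \<le> y0 powr (-p) * f x"
    and x: "x \<ge> D" and y: "y \<ge> 1"
  shows "f (y * x) \<le> y0 powr p * y powr (-p) * f x"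
proof -
  have it: "f (y0 ^ n * x) \<le> (y0 powr (-p)) ^ n * f x" for n
  proof (induction n)
    case (Suc n)
    have "1 * x \<le> y0 ^ n * x" using x y0 D by (intro mult_right_mono one_le_power) auto
    then have "y0 ^ n * x \<ge> D" using x by simp
    from step[OF this] have "f (y0 ^ Suc n * x) \<le> y0 powr (-p) * f (y0 ^ n * x)"
      by (simp add: mult.assoc)
    also have "\<dots> \<le> y0 powr (-p) * ((y0 powr (-p)) ^ n * f x)"
      by (rule mult_left_mono[OF Suc]) simp
    finally show ?case by (simp add: mult.assoc)
  qed simp
  from powr_between[OF y0 y] obtain n where n: "y0 ^ n \<le> y" "y < y0 ^ Suc n" by blast
  have "f (y * x) \<le> f (y0 ^ n * x)"
    by (rule antimono_le[OF f(1)]) (use n x D in auto)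
  also have "\<dots> \<le> (y0 powr (-p)) ^ n * f x" by (rule it)
  also have "(y0 powr (-p)) ^ n = y0 powr p * (y0 ^ Suc n) powr (-p)"
  proof -
    have "(y0 powr (-p)) ^ n = y0 powr (- p * n)" using y0 by (simp add: powr_realpow[symmetric] powr_powr)
    also have "\<dots> = y0 powr p * y0 powr (real (Suc n) * - p)"
      by (subst powr_add[symmetric]) (simp add: algebra_simps)
    also have "y0 powr (real (Suc n) * - p) = (y0 ^ Suc n) powr (-p)"
      using y0 by (subst powr_realpow[symmetric]) (simp_all add: powr_powr del: power_Suc)
    finally show ?thesis .
  qed
  also have "y0 powr p * (y0 ^ Suc n) powr (-p) * f x \<le> y0 powr p * y powr (-p) * f x"
    using n p f(2)[of x] y
    by (intro mult_right_mono mult_left_mono powr_mono2') (auto simp: less_imp_le)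
  finally show ?thesis by simp
qed

text \<open>Mirror image of \<open>upper_Potter\<close>: here \<open>y\<close> is rounded up to
  \<open>y0 ^ Suc n\<close>, which costs the factor \<open>y0 powr (-q)\<close>.\<close>

lemma lower_Potter:
  fixes f :: "real \<Rightarrow> real"
  assumes f: "antimono f" "\<And>x. f x > 0" and y0: "y0 > 1" and D: "D > 0" and q: "q \<ge> 0"
    and step: "\<And>x. x \<ge> D \<Longrightarrow> f (y0 * x) \<ge> y0 powr (-q) * f x"
    and x: "x \<ge> D" and y: "y \<ge> 1"
  shows "f (y * x) \<ge> y0 powr (-q) * y powr (-q) * f x"
proof -
  have it: "f (y0 ^ n * x) \<ge> (y0 powr (-q)) ^ n * f x" for n
  proof (induction n)
    case (Suc n)
    have "1 * x \<le> y0 ^ n * x" using x y0 D by (intro mult_right_mono one_le_power) auto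
    then have "y0 ^ n * x \<ge> D" using x by simp
    from step[OF this] have "f (y0 ^ Suc n * x) \<ge> y0 powr (-q) * f (y0 ^ n * x)"
      by (simp add: mult.assoc)
    moreover have "y0 powr (-q) * f (y0 ^ n * x) \<ge> y0 powr (-q) * ((y0 powr (-q)) ^ n * f x)"
      by (rule mult_left_mono[OF Suc]) simp
    ultimately show ?case by (simp add: mult.assoc)
  qed simp
  from powr_between[OF y0 y] obtain n where n: "y0 ^ n \<le> y" "y < y0 ^ Suc n" by blast
  have "y0 powr (-q) * y powr (-q) * f x \<le> y0 powr (-q) * (y0 ^ n) powr (-q) * f x"
    using n q f(2)[of x] y y0
    by (intro mult_right_mono mult_left_mono powr_mono2') (auto simp: less_imp_le)
  also have "y0 powr (-q) * (y0 ^ n) powr (-q) = (y0 powr (-q)) ^ Suc n"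
  proof -
    have "(y0 powr (-q)) ^ Suc n = y0 powr (- q * Suc n)"
      using y0 by (subst powr_realpow[symmetric]) (simp_all add: powr_powr)
    also have "\<dots> = y0 powr (-q) * y0 powr (real n * - q)"
      by (subst powr_add[symmetric]) (simp add: algebra_simps)
    also have "y0 powr (real n * - q) = (y0 ^ n) powr (-q)"
    proof -
      have "y0 powr real n = y0 ^ n" using y0 by (intro powr_realpow) auto
      then show ?thesis by (metis powr_powr)
    qed
    finally show ?thesis by (rule sym)
  qed
  also have "(y0 powr (-q)) ^ Suc n * f x \<le> f (y0 ^ Suc n * x)" by (rule it)
  also have "\<dots> \<le> f (y * x)"
    by (rule antimono_le[OF f(1)]) (use n x D in auto)
  finally show ?thesis by simp
qed

text \<open>Exponentiating turns bounds on the quotients in the Matuszewska indices into power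
  bounds on tail ratios. A real \<open>c\<close> makes the equivalence hold also where
  \<open>log_ext\<close> is infinite.\<close>

lemma log_ext_less_iff:
  assumes "y > 1"
  shows "log_ext z / ereal (ln y) < ereal c \<longleftrightarrow> z < ereal (y powr c)"
proof -
  have l: "ln y > 0" using assms by simp
  show ?thesis
  proof (cases z)
    case (real r)
    have "ln r < c * ln y \<longleftrightarrow> r < y powr c" if "r > 0"
      using that assms ln_less_cancel_iff[of r "y powr c"] by (simp add: ln_powr)
    moreover have "r \<le> 0 \<Longrightarrow> r < y powr c"
      using assms by (intro le_less_trans[of r 0]) auto
    ultimately show ?thesis using l real
      by (auto simp: log_ext_def divide_less_eq mult.commute)
  qed (use l assms in \<open>auto simp: log_ext_def ereal_divide_eq_0_iff\<close>)
qed

lemma less_log_ext_iff: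
  assumes "y > 1"
  shows "ereal c < log_ext z / ereal (ln y) \<longleftrightarrow> ereal (y powr c) < z"
proof -
  have l: "ln y > 0" using assms by simp
  show ?thesis
  proof (cases z)
    case (real r)
    have "c * ln y < ln r \<longleftrightarrow> y powr c < r" if "r > 0"
      using that assms ln_less_cancel_iff[of "y powr c" r] by (simp add: ln_powr)
    moreover have "r \<le> 0 \<Longrightarrow> \<not> y powr c < r"
      by (simp add: not_less order.trans[of r 0])
    ultimately show ?thesis using l real
      by (auto simp: log_ext_def less_divide_eq mult.commute)
  qed (use l assms in \<open>auto simp: log_ext_def ereal_divide_eq_0_iff\<close>)
qed

lemma eventually_const_times_powr_less:
  fixes a b C :: real
  assumes "a < b"
  shows "\<forall>\<^sub>F s in at_top. C * s powr a < s powr b"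
proof -
  \<comment> \<open>Chosen so that \<open>B powr (b - a)\<close> is
    \<open>\<bar>C\<bar> + 1\<close>, which exceeds \<open>C\<close>.\<close>
  define B where "B = (\<bar>C\<bar> + 1) powr (1 / (b - a))"
  have "\<forall>\<^sub>F s in at_top. C < s powr (b - a)"
    using eventually_gt_at_top[of B]
  proof eventually_elim
    case (elim s)
    have "C < (\<bar>C\<bar> + 1) powr (1 / (b - a) * (b - a))" using assms by simp
    also have "\<dots> = B powr (b - a)" unfolding B_def by (rule powr_powr[symmetric])
    also have "\<dots> \<le> s powr (b - a)"
      using elim assms by (intro powr_mono2) (auto simp: B_def)
    finally show ?case .
  qed
  with eventually_gt_at_top[of 0] show ?thesis
    by eventually_elim (simp add: powr_diff less_divide_eq)
qed

text \<open>A Fekete-type argument: a power bound on the ratio at one \<open>y\<close> spreads by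
  \<open>upper_Potter\<close> to all large \<open>s\<close>, with the same exponent up to a
  constant. This gives existence and value of the limit behind \<open>Lim\<close>, so that a strict
  bound on the index is witnessed at a single \<open>y\<close>.\<close>

lemma lower_Matuszewska_INF:
  assumes G: "pos_tail_distribution G"
  shows "lower_Matuszewska G = - (INF y\<in>{1<..}. log_ext (upper_tail_ratio G y) / ereal (ln y))"
proof -
  let ?f = "tail G" and ?v = "\<lambda>y. log_ext (upper_tail_ratio G y) / ereal (ln y)"
  note T = tail_pos[OF G] tail_antimono[OF G]
  have anti: "antimono ?f" using T by (simp add: antimono_def)
  have le1: "upper_tail_ratio G y \<le> 1" if "y > 1" for y
    unfolding upper_tail_ratio_def
    by (rule Limsup_bounded, rule eventually_mono[OF eventually_ge_at_top[of 0]])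
       (use that T in \<open>auto simp: divide_le_eq mult_le_cancel_right1\<close>)
  have "(?v \<longlongrightarrow> (INF y\<in>{1<..}. ?v y)) at_top"
  proof (rule lim_INF_of_eventually_below)
    fix y c :: real assume y: "y > 1" and c: "?v y < ereal c"
    show "\<forall>\<^sub>F s in at_top. ?v s < ereal c"
    \<comment> \<open>For positive \<open>c\<close> the trivial bound 1 on the ratio is enough;
      iterating requires a nonnegative decay exponent.\<close>
    proof (cases "c > 0")
      case True
      show ?thesis using eventually_gt_at_top[of 1]
      proof eventually_elim
        case (elim s)
        have "1 < s powr c" using powr_less_cancel_iff[of s 0 c] elim True by simp
        show ?case
          unfolding log_ext_less_iff[OF elim] by (rule le_less_trans[OF le1[OF elim]]) (use \<open>1 < s powr c\<close> in simp)
      qed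
    next
      case False
      \<comment> \<open>The room between \<open>c'\<close> and \<open>c\<close> absorbs the constant
        \<open>y powr (- c')\<close> produced by \<open>upper_Potter\<close>.\<close>
      from c obtain c' where c': "?v y < ereal c'" "ereal c' < ereal c" using ereal_dense2 by blast
      then have cc: "c' < c" "c' < 0" using False by auto
      have "upper_tail_ratio G y < ereal (y powr c')" using c' y by (simp add: log_ext_less_iff)
      then have "\<forall>\<^sub>F x in at_top. ereal (?f (y * x) / ?f x) < ereal (y powr c')"
        unfolding upper_tail_ratio_def by (rule Limsup_lessD)
      then obtain D where D: "\<And>x. x \<ge> D \<Longrightarrow> ?f (y * x) / ?f x < y powr c'"
        by (auto simp: eventually_at_top_linorder)
      define D' where "D' = max D 1"
      have step: "?f (y * x) \<le> y powr (- (- c')) * ?f x" if "x \<ge> D'" for x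
        using D[of x] that T(1)[of x] by (simp add: D'_def divide_less_eq)
      have bd: "upper_tail_ratio G s \<le> ereal (y powr (- c') * s powr c')" if "s > 1" for s
        unfolding upper_tail_ratio_def
      proof (rule Limsup_bounded, rule eventually_mono[OF eventually_ge_at_top[of D']])
        fix x assume x: "D' \<le> x"
        have "?f (s * x) \<le> y powr (-c') * s powr (-(- c')) * ?f x"
          by (rule upper_Potter[OF anti T(1) y _ _ step x]) (use that cc in \<open>auto simp: D'_def\<close>)
        then show "ereal (?f (s * x) / ?f x) \<le> ereal (y powr - c' * s powr c')"
          using T(1)[of x] by (simp add: divide_le_eq)
      qed
      from eventually_const_times_powr_less[OF cc(1), of "y powr (-c')"] eventually_gt_at_top[of 1]
      show ?thesis
      proof eventually_elim
        case (elim s)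
        show ?case unfolding log_ext_less_iff[OF elim(2)]
          by (rule le_less_trans[OF bd[OF elim(2)]]) (use elim in simp)
      qed
    qed
  qed
  then show ?thesis unfolding lower_Matuszewska_def
    by (simp add: tendsto_Lim)
qed

lemma upper_Matuszewska_SUP:
  assumes G: "pos_tail_distribution G"
  shows "upper_Matuszewska G = - (SUP y\<in>{1<..}. log_ext (lower_tail_ratio G y) / ereal (ln y))"
proof -
  let ?f = "tail G" and ?v = "\<lambda>y. log_ext (lower_tail_ratio G y) / ereal (ln y)"
  note T = tail_pos[OF G] tail_antimono[OF G]
  have anti: "antimono ?f" using T by (simp add: antimono_def)
  have le1: "lower_tail_ratio G y \<le> 1" if "y > 1" for y
    unfolding lower_tail_ratio_def
    by (rule order.trans[OF Liminf_le_Limsup], simp, rule Limsup_bounded,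
        rule eventually_mono[OF eventually_ge_at_top[of 0]])
       (use that T in \<open>auto simp: divide_le_eq mult_le_cancel_right1\<close>)
  have "((\<lambda>y. - ?v y) \<longlongrightarrow> (INF y\<in>{1<..}. - ?v y)) at_top"
  proof (rule lim_INF_of_eventually_below)
    fix y c0 :: real assume y: "y > 1" and c0: "- ?v y < ereal c0"
    define c where "c = - c0"
    have c: "ereal c < ?v y" using c0 unfolding c_def by (cases "?v y") auto
    have "\<forall>\<^sub>F s in at_top. ereal c < ?v s"
    proof -
      from c obtain c' where c': "ereal c < ereal c'" "ereal c' < ?v y" using ereal_dense2 by blast
      then have ly: "ereal (y powr c') < lower_tail_ratio G y" using y by (simp add: less_log_ext_iff)
      \<comment> \<open>The ratio is at most 1, so \<open>c'\<close> is negative without a case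
        distinction and \<open>- c'\<close> is an admissible exponent for
        \<open>lower_Potter\<close>.\<close>
      from less_le_trans[OF ly le1[OF y]] have "y powr c' < 1" by simp
      then have cc: "c < c'" "c' < 0" using c' y using powr_less_cancel_iff[of y c' 0] by auto
      from less_LiminfD[OF ly[unfolded lower_tail_ratio_def]]
      obtain D where D: "\<And>x. x \<ge> D \<Longrightarrow> ?f (y * x) / ?f x > y powr c'"
        by (auto simp: eventually_at_top_linorder)
      define D' where "D' = max D 1"
      have step: "?f (y * x) \<ge> y powr (- (- c')) * ?f x" if "x \<ge> D'" for x
        using D[of x] that T(1)[of x] by (simp add: D'_def less_divide_eq)
      have bd: "lower_tail_ratio G s \<ge> ereal (y powr c' * s powr c')" if "s > 1" for s
        unfolding lower_tail_ratio_def
      proof (rule Liminf_bounded, rule eventually_mono[OF eventually_ge_at_top[of D']])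
        fix x assume x: "D' \<le> x"
        have "?f (s * x) \<ge> y powr (-(-c')) * s powr (-(- c')) * ?f x"
          by (rule lower_Potter[OF anti T(1) y _ _ step x]) (use that cc in \<open>auto simp: D'_def\<close>)
        then show "ereal (?f (s * x) / ?f x) \<ge> ereal (y powr c' * s powr c')"
          using T(1)[of x] by (simp add: le_divide_eq)
      qed
      have "y powr c' > 0" using y by simp
      from eventually_const_times_powr_less[OF cc(1), of "inverse (y powr c')"] eventually_gt_at_top[of 1]
      show ?thesis
      proof eventually_elim
        case (elim s)
        from elim have "s powr c < y powr c' * s powr c'" using \<open>y powr c' > 0\<close>
          by (simp add: field_simps)
        show ?case unfolding less_log_ext_iff[OF elim(2)]
          by (rule less_le_trans[OF _ bd[OF elim(2)]]) (use \<open>s powr c < y powr c' * s powr c'\<close> in simp)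
      qed
    qed
    then show "\<forall>\<^sub>F s in at_top. - ?v s < ereal c0"
      by (rule eventually_mono) (simp add: c_def ereal_uminus_less_reorder)
  qed
  then have "(?v \<longlongrightarrow> - (INF y\<in>{1<..}. - ?v y)) at_top"
    using tendsto_uminus_ereal by fastforce
  then have "Lim at_top ?v = - (INF y\<in>{1<..}. - ?v y)"
    by (simp add: tendsto_Lim)
  then show ?thesis unfolding upper_Matuszewska_def by (simp add: ereal_SUP_uminus_eq ereal_INF_uminus_eq)
qed

text \<open>Dominated convergence and the dyadic sums need a bound uniform in
  \<open>\<theta> > 0\<close>, although the one-step estimates hold only above \<open>D\<close>.
  Small \<theta> are governed by \<open>p\<close>, large ones by \<open>q\<close>.\<close>

lemma tail_Potter_bound:
  assumes G: "pos_tail_distribution G"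
    and p: "0 < p" "ereal p < lower_Matuszewska G"
    and q: "upper_Matuszewska G < ereal q"
  obtains C D where "C > 0" "D > 0"
    "\<And>x \<theta>. x \<ge> D \<Longrightarrow> \<theta> > 0 \<Longrightarrow> tail G (x / \<theta>) \<le> C * (\<theta> powr p + \<theta> powr q) * tail G x"
proof -
  let ?f = "tail G"
  note T = tail_pos[OF G] tail_antimono[OF G]
  have anti: "antimono ?f" using T by (simp add: antimono_def)
  from p(2) have "(INF y\<in>{1<..}. log_ext (upper_tail_ratio G y) / ereal (ln y)) < ereal (-p)"
    unfolding lower_Matuszewska_INF[OF G] by (subst (asm) ereal_less_uminus_reorder) simp
  then obtain y1 where y1: "y1 > 1" "log_ext (upper_tail_ratio G y1) / ereal (ln y1) < ereal (-p)"
    by (auto simp: INF_less_iff)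
  then have "Limsup at_top (\<lambda>x. ereal (?f (y1 * x) / ?f x)) < ereal (y1 powr (-p))"
    by (simp add: log_ext_less_iff upper_tail_ratio_def)
  from Limsup_lessD[OF this] obtain D1 where D1: "\<And>x. x \<ge> D1 \<Longrightarrow> ?f (y1 * x) / ?f x < y1 powr (-p)"
    by (auto simp: eventually_at_top_linorder)
  from q have "ereal (-q) < (SUP y\<in>{1<..}. log_ext (lower_tail_ratio G y) / ereal (ln y))"
    unfolding upper_Matuszewska_SUP[OF G] by (simp add: ereal_uminus_less_reorder)
  then obtain y2 where y2: "y2 > 1" "ereal (-q) < log_ext (lower_tail_ratio G y2) / ereal (ln y2)"
    by (auto simp: less_SUP_iff)
  then have "ereal (y2 powr (-q)) < Liminf at_top (\<lambda>x. ereal (?f (y2 * x) / ?f x))"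
    by (simp add: less_log_ext_iff lower_tail_ratio_def)
  from less_LiminfD[OF this] obtain D2 where D2: "\<And>x. x \<ge> D2 \<Longrightarrow> ?f (y2 * x) / ?f x > y2 powr (-q)"
    by (auto simp: eventually_at_top_linorder)
  define D where "D = max (max D1 D2) 1"
  have D: "D > 0" by (simp add: D_def)
  have s1: "?f (y1 * x) \<le> y1 powr (-p) * ?f x" if "x \<ge> D" for x
    using D1[of x] that T(1)[of x] by (simp add: D_def divide_less_eq)
  have s2: "?f (y2 * x) \<ge> y2 powr (-q) * ?f x" if "x \<ge> D" for x
    using D2[of x] that T(1)[of x] by (simp add: D_def less_divide_eq)
  \<comment> \<open>Monotonicity of the tail yields \<open>q \<ge> 0\<close>, which
    \<open>lower_Potter\<close> requires.\<close>
  have "y2 powr (-q) * ?f D \<le> 1 * ?f D"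
    using s2[of D] T(2)[of D "y2 * D"] D y2 by (auto simp: mult_le_cancel_right1)
  then have "y2 powr (-q) \<le> 1" using T(1)[of D] by auto
  then have "q \<ge> 0" using powr_le_cancel_iff[of y2 "-q" 0] y2 by simp
  note U = upper_Potter[OF anti T(1) y1(1) D less_imp_le[OF p(1)] s1]
  note L = lower_Potter[OF anti T(1) y2(1) D \<open>q \<ge> 0\<close> s2]
  define k where "k = y2 powr (-q)"
  have k: "k > 0" using y2 by (simp add: k_def)
  \<comment> \<open>One summand for each case below: the rounding in \<open>upper_Potter\<close>,
    the rounding in \<open>lower_Potter\<close>, and the trivial bound 1 once
    \<open>x / \<theta>\<close> falls below \<open>D\<close>.\<close>
  define C where "C = y1 powr p + inverse k + inverse (k * ?f D)"
  have C: "y1 powr p \<le> C" "inverse k \<le> C" "inverse (k * ?f D) \<le> C" "C > 0"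
    using T(1)[of D] y1 k by (auto simp: C_def add_pos_nonneg)
  have "?f (x / \<theta>) \<le> C * (\<theta> powr p + \<theta> powr q) * ?f x" if x: "x \<ge> D" and th: "\<theta> > 0" for x \<theta>
  proof -
    consider "\<theta> \<le> 1" | "\<theta> > 1" "x / \<theta> \<ge> D" | "\<theta> > 1" "x / \<theta> < D" by linarith
    then show ?thesis
    proof cases
      case 1
      have "?f (x / \<theta>) \<le> y1 powr p * inverse \<theta> powr (-p) * ?f x"
        using U[of x "inverse \<theta>"] x th 1 by (simp add: field_simps)
      also have "inverse \<theta> powr (-p) = \<theta> powr p" using th by (simp add: powr_minus inverse_powr)
      also have "y1 powr p * \<theta> powr p * ?f x \<le> C * (\<theta> powr p + \<theta> powr q) * ?f x"
        using C T(1)[of x] by (intro mult_right_mono mult_mono) auto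
      finally show ?thesis .
    next
      case 2
      have "k * \<theta> powr (-q) * ?f (x / \<theta>) \<le> ?f x"
        using L[of "x / \<theta>" \<theta>] 2 k_def by simp
      then have "?f (x / \<theta>) \<le> inverse k * \<theta> powr q * ?f x"
        using k th by (simp add: powr_minus field_simps)
      also have "\<dots> \<le> C * (\<theta> powr p + \<theta> powr q) * ?f x"
        using C T(1)[of x] by (intro mult_right_mono mult_mono) auto
      finally show ?thesis .
    next
      case 3
      \<comment> \<open>No estimate is available at \<open>x / \<theta>\<close>, where the tail is
        bounded by 1. Instead \<open>x < D * \<theta>\<close> keeps
        \<open>\<theta> powr q * ?f x\<close> above a positive constant.\<close>
      have "k * \<theta> powr (-q) * ?f D \<le> k * (x / D) powr (-q) * ?f D"
        using 3 D x \<open>q \<ge> 0\<close> k T(1)[of D] th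
        by (intro mult_right_mono mult_left_mono powr_mono2') (auto simp: field_simps)
      also have "\<dots> \<le> ?f x" using L[of D "x / D"] x D k_def by simp
      finally have "1 \<le> inverse (k * ?f D) * \<theta> powr q * ?f x"
        using k th T(1)[of D] by (simp add: powr_minus field_simps)
      also have "\<dots> \<le> C * (\<theta> powr p + \<theta> powr q) * ?f x"
        using C T(1)[of x] by (intro mult_right_mono mult_mono) auto
      finally show ?thesis using tail_le_1[OF G, of "x / \<theta>"] by linarith
    qed
  qed
  with C D show ?thesis using that by blast
qed

section \<open>The Minkowski functional of a risk set\<close>

lemma nonneg_eqI_less:
  fixes a b :: real
  assumes "a \<ge> 0" "b \<ge> 0" "\<And>x. x > 0 \<Longrightarrow> x < a \<longleftrightarrow> x < b"
  shows "a = b"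
proof (rule ccontr)
  assume "a \<noteq> b"
  then have "min a b < max a b" by auto
  then obtain x where "min a b < x" "x < max a b" using dense by blast
  with assms(1,2) assms(3)[of x] show False by (auto simp: min_def max_def split: if_splits)
qed

lemma mem_scale_set_iff:
  assumes "u \<noteq> 0"
  shows "z \<in> scale_set u A \<longleftrightarrow> z /\<^sub>R u \<in> A"
proof
  assume "z /\<^sub>R u \<in> A"
  then have "u *\<^sub>R (z /\<^sub>R u) \<in> scale_set u A" unfolding scale_set_def by (rule imageI)
  then show "z \<in> scale_set u A" using assms by simp
qed (use assms in \<open>auto simp: scale_set_def\<close>)

context
  fixes A :: "(real ^ 'd) set"
  assumes A: "A \<in> risk_sets"
begin

lemma risk_set_ball:
  obtains r where "r > 0" "\<And>z. z \<in> A \<Longrightarrow> norm z \<ge> r"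
proof -
  have "open (- closure A)" "0 \<in> - closure A" using A by (auto simp: risk_sets_def)
  then obtain r where "r > 0" "ball 0 r \<subseteq> - closure A" by (meson open_contains_ball)
  then have "z \<in> A \<Longrightarrow> norm z \<ge> r" for z
    using closure_subset[of A] by (force simp: subset_iff not_le)
  with \<open>r > 0\<close> show ?thesis using that by blast
qed

lemma risk_set_bound:
  obtains r where "r > 0" "\<And>z u. u > 0 \<Longrightarrow> z \<in> scale_set u A \<Longrightarrow> u * r \<le> norm z"
proof -
  obtain r where r: "r > 0" "\<And>z. z \<in> A \<Longrightarrow> norm z \<ge> r" by (rule risk_set_ball) blast
  have "u * r \<le> norm z" if "u > 0" "z \<in> scale_set u A" for z u
  proof -
    from that obtain a where a: "a \<in> A" "z = u *\<^sub>R a" by (auto simp: scale_set_def)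
    then show ?thesis using r(2)[OF a(1)] that by (simp add: mult_left_mono)
  qed
  with r(1) show ?thesis using that by blast
qed

text \<open>The complement is convex and contains the origin, and \<open>z /\<^sub>R u\<close> lies
  on the segment from 0 to \<open>z /\<^sub>R v\<close>.\<close>

lemma scale_set_decreasing:
  assumes "0 < v" "v \<le> u" "z \<in> scale_set u A"
  shows "z \<in> scale_set v A"
proof (rule ccontr)
  assume "z \<notin> scale_set v A"
  then have n: "z /\<^sub>R v \<in> - A" using assms(1) mem_scale_set_iff[of v z A] by auto
  have z: "0 \<in> - A" using A closure_subset[of A] by (auto simp: risk_sets_def)
  have "(v / u) *\<^sub>R (z /\<^sub>R v) + (1 - v / u) *\<^sub>R 0 \<in> - A"
    using A n z assms by (intro convexD) (auto simp: risk_sets_def)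
  also have "(v / u) *\<^sub>R (z /\<^sub>R v) + (1 - v / u) *\<^sub>R 0 = (v / u * inverse v) *\<^sub>R z" by simp
  also have "v / u * inverse v = inverse u" using assms by (simp add: divide_inverse)
  finally show False using assms mem_scale_set_iff[of u z A] by simp
qed

text \<open>Since \<open>A\<close> is open, no positive scale is the largest one; this makes the
  strict inequality \<open>x < reduce A z\<close> equivalent to membership at scale
  \<open>x\<close>.\<close>

lemma scale_set_open_right:
  assumes "u > 0" "z \<in> scale_set u A"
  obtains v where "v > u" "z \<in> scale_set v A"
proof -
  have "((\<lambda>v. z /\<^sub>R v) \<longlongrightarrow> z /\<^sub>R u) (at_right u)"
    using assms(1) by (intro tendsto_intros) auto
  moreover have "open A" "z /\<^sub>R u \<in> A" using A assms by (auto simp: risk_sets_def mem_scale_set_iff)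
  ultimately have "\<forall>\<^sub>F v in at_right u. z /\<^sub>R v \<in> A" by (simp add: topological_tendstoD)
  with eventually_at_right_less[of u] have "\<forall>\<^sub>F v in at_right u. u < v \<and> z /\<^sub>R v \<in> A"
    by eventually_elim auto
  then obtain v where v: "u < v" "z /\<^sub>R v \<in> A"
    using eventually_happens[of _ "at_right u"] trivial_limit_at_right_real by blast
  show ?thesis by (rule that[of v]) (use v assms in \<open>auto simp: mem_scale_set_iff\<close>)
qed

text \<open>At a negative scale \<open>z /\<^sub>R u\<close> has nonpositive coordinates, so an
  increasing set containing it would contain the origin.\<close>

lemma scale_set_nonneg:
  assumes "z \<in> quadrant" "z \<in> scale_set u A"
  shows "u \<ge> 0"
proof (rule ccontr)
  assume u: "\<not> u \<ge> 0"
  then have "z /\<^sub>R u \<in> A" using assms by (simp add: mem_scale_set_iff)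
  moreover have "- (z /\<^sub>R u) \<in> quadrant" using assms u
    by (simp add: quadrant_def mult_nonpos_nonneg)
  ultimately have "z /\<^sub>R u + - (z /\<^sub>R u) \<in> A" using A unfolding risk_sets_def increasing_set_def by blast
  then have "0 \<in> A" by simp
  then show False using A closure_subset[of A] by (auto simp: risk_sets_def)
qed

lemma bdd_above_scales: "bdd_above {u. z \<in> scale_set u A}"
proof -
  obtain r where r: "r > 0" "\<And>z u. u > 0 \<Longrightarrow> z \<in> scale_set u A \<Longrightarrow> u * r \<le> norm z"
    by (rule risk_set_bound) blast
  show ?thesis
  proof (rule bdd_aboveI)
    fix u assume "u \<in> {u. z \<in> scale_set u A}"
    moreover have "u * r \<le> 0" if "u \<le> 0" using that r(1) by (simp add: mult_nonpos_nonneg)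
    ultimately have "u * r \<le> norm z" using r(2)[of u z] norm_ge_zero[of z]
      by (cases "u > 0") (auto intro: order.trans[of _ 0])
    then show "u \<le> norm z / r" using r(1) by (simp add: field_simps)
  qed
qed

text \<open>Covers all vectors because measurability is needed on the whole space. Off the quadrant
  negative scales may occur, and the default 0 for an empty set of scales needs its own
  case.\<close>

lemma less_reduce_iff_ex: "x < reduce A z \<longleftrightarrow>
    (if \<forall>u. z \<notin> scale_set u A then x < 0 else \<exists>u>x. z \<in> scale_set u A)"
  using bdd_above_scales[of z] by (auto simp: reduce_def Let_def less_cSup_iff)

lemma borel_measurable_reduce: "reduce A \<in> borel_measurable borel"
proof -
  have oA: "open (scale_set u A)" if "u \<noteq> 0" for u
    using A that by (auto simp: scale_set_def risk_sets_def intro: open_scaling)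
  have E: "{z. \<exists>u>x. z \<in> scale_set u A} \<in> sets borel" for x
  proof -
    \<comment> \<open>An uncountable union, but of open sets; only at scale 0 is the scaled set not
      open but at most a point.\<close>
    have "{z. \<exists>u>x. z \<in> scale_set u A} =
      (\<Union>u\<in>{x<..} - {0}. scale_set u A) \<union> (if x < 0 then scale_set 0 A else {})"
      by auto
    moreover have "scale_set 0 A = (if A = {} then {} else {0})" by (auto simp: scale_set_def)
    moreover have "open (\<Union>u\<in>{x<..} - {0}. scale_set u A)" using oA by auto
    ultimately show ?thesis by auto
  qed
  have N: "{z. \<forall>u. z \<notin> scale_set u A} \<in> sets borel"
  proof -
    have "{z. \<forall>u. z \<notin> scale_set u A} = - (\<Union>n. {z. \<exists>u > - real n. z \<in> scale_set u A})"
    proof -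
      have "\<exists>n. - real n < u" for u :: real
        using reals_Archimedean2[of "- u"] by (auto simp: minus_less_iff)
      then show ?thesis by blast
    qed
    then show ?thesis using E by auto
  qed
  have "{z \<in> space borel. x < reduce A z} \<in> sets borel" for x
  proof -
    have "{z \<in> space borel. x < reduce A z} =
      ({z. \<forall>u. z \<notin> scale_set u A} \<inter> (if x < 0 then UNIV else {})) \<union>
      ({z. \<exists>u>x. z \<in> scale_set u A} - {z. \<forall>u. z \<notin> scale_set u A})"
      by (auto simp: less_reduce_iff_ex)
    then show ?thesis using E[of x] N by auto
  qed
  then show ?thesis by (simp add: borel_measurable_iff_greater)
qed

lemma reduce_nonneg:
  assumes "z \<in> quadrant"
  shows "0 \<le> reduce A z"
proof (rule ccontr)
  assume "\<not> 0 \<le> reduce A z"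
  with less_reduce_iff_ex[of "reduce A z" z] scale_set_nonneg[OF assms] show False
    by (force split: if_splits)
qed

lemma less_reduce_iff:
  assumes "z \<in> quadrant" "x > 0"
  shows "x < reduce A z \<longleftrightarrow> z \<in> scale_set x A"
proof
  assume "x < reduce A z"
  then obtain u where "u > x" "z \<in> scale_set u A"
    using assms(2) unfolding less_reduce_iff_ex by (auto split: if_splits)
  then show "z \<in> scale_set x A" using assms(2) scale_set_decreasing[of x u z] by auto
next
  assume z: "z \<in> scale_set x A"
  from assms(2) z obtain v where "v > x" "z \<in> scale_set v A" by (rule scale_set_open_right)
  with z show "x < reduce A z" unfolding less_reduce_iff_ex by auto
qed

lemma reduce_scaleR:
  assumes z: "z \<in> quadrant" and c: "c > 0"
  shows "reduce A (c *\<^sub>R z) = c * reduce A z"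
proof (rule nonneg_eqI_less)
  have cz: "c *\<^sub>R z \<in> quadrant" using z c by (simp add: quadrant_def)
  show "0 \<le> reduce A (c *\<^sub>R z)" "0 \<le> c * reduce A z"
    using reduce_nonneg[OF cz] reduce_nonneg[OF z] c by auto
  fix x :: real assume x: "x > 0"
  have "x < c * reduce A z \<longleftrightarrow> x / c < reduce A z" using c by (simp add: field_simps)
  also have "\<dots> \<longleftrightarrow> z \<in> scale_set (x / c) A" using x c z by (intro less_reduce_iff) auto
  also have "\<dots> \<longleftrightarrow> c *\<^sub>R z \<in> scale_set x A"
    using x c by (simp add: mem_scale_set_iff field_simps)
  also have "\<dots> \<longleftrightarrow> x < reduce A (c *\<^sub>R z)" using less_reduce_iff[OF cz x] by simp
  finally show "x < reduce A (c *\<^sub>R z) \<longleftrightarrow> x < c * reduce A z" by simp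
qed

lemma reduce_mono:
  assumes z: "z \<in> quadrant" and w: "w \<in> quadrant"
  shows "reduce A z \<le> reduce A (z + w)"
proof (rule ccontr)
  have zw: "z + w \<in> quadrant" using z w by (simp add: quadrant_def)
  assume "\<not> ?thesis"
  then obtain x where x: "reduce A (z + w) < x" "x < reduce A z"
    using dense[of "reduce A (z + w)" "reduce A z"] by auto
  then have x0: "x > 0" using reduce_nonneg[OF zw] by linarith
  with x z have "z /\<^sub>R x \<in> A" by (simp add: less_reduce_iff mem_scale_set_iff)
  moreover have "w /\<^sub>R x \<in> quadrant" using w x0 by (simp add: quadrant_def)
  ultimately have "z /\<^sub>R x + w /\<^sub>R x \<in> A" using A by (auto simp: risk_sets_def increasing_set_def)
  then have "x < reduce A (z + w)" using x0 zw by (simp add: less_reduce_iff mem_scale_set_iff scaleR_add_right)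
  with x show False by simp
qed

text \<open>\<open>(z + w) /\<^sub>R (a + b)\<close> is the convex combination of
  \<open>z /\<^sub>R a\<close> and \<open>w /\<^sub>R b\<close> with weights
  \<open>a / (a + b)\<close> and \<open>b / (a + b)\<close>, so convexity keeps it in the
  complement.\<close>

lemma reduce_subadditive:
  assumes z: "z \<in> quadrant" and w: "w \<in> quadrant"
  shows "reduce A (z + w) \<le> reduce A z + reduce A w"
proof (rule ccontr)
  have zw: "z + w \<in> quadrant" using z w by (simp add: quadrant_def)
  assume c: "\<not> ?thesis"
  \<comment> \<open>A third of the gap: \<open>a + b\<close> stays below
    \<open>reduce A (z + w)\<close>, while \<open>a\<close> and \<open>b\<close> become positive
    even where the reduced values vanish.\<close>
  define e where "e = (reduce A (z + w) - (reduce A z + reduce A w)) / 3"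
  define a b where "a = reduce A z + e" and "b = reduce A w + e"
  have e: "e > 0" using c by (simp add: e_def)
  then have ab: "a > 0" "b > 0" "a > reduce A z" "b > reduce A w" "a + b < reduce A (z + w)"
    using reduce_nonneg[OF z] reduce_nonneg[OF w] c by (auto simp: a_def b_def e_def field_simps)
  then have n: "z /\<^sub>R a \<in> - A" "w /\<^sub>R b \<in> - A" and y: "(z + w) /\<^sub>R (a + b) \<in> A"
    using less_reduce_iff[OF z, of a] less_reduce_iff[OF w, of b] less_reduce_iff[OF zw, of "a + b"]
    by (auto simp: mem_scale_set_iff)
  have "(a / (a + b)) *\<^sub>R (z /\<^sub>R a) + (b / (a + b)) *\<^sub>R (w /\<^sub>R b) \<in> - A"
    using A n ab by (intro convexD) (auto simp: risk_sets_def add_divide_distrib[symmetric])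
  also have "(a / (a + b)) *\<^sub>R (z /\<^sub>R a) + (b / (a + b)) *\<^sub>R (w /\<^sub>R b) = (z + w) /\<^sub>R (a + b)"
    using ab by (simp add: scaleR_add_right divide_inverse mult.commute mult.left_commute mult.assoc[symmetric])
  finally show False using y by simp
qed

end

text \<open>Abstract because two gauges are used: \<open>reduce A\<close> for the event itself, and
  the coordinate sum, which controls norms and infinite coordinates.\<close>

locale quadrant_gauge =
  fixes h :: "real ^ 'd \<Rightarrow> real"
  assumes h_meas: "h \<in> borel_measurable borel"
    and h_nonneg: "z \<in> quadrant \<Longrightarrow> 0 \<le> h z"
    and h_scaleR: "z \<in> quadrant \<Longrightarrow> c > 0 \<Longrightarrow> h (c *\<^sub>R z) = c * h z"
    and h_mono: "z \<in> quadrant \<Longrightarrow> w \<in> quadrant \<Longrightarrow> h z \<le> h (z + w)"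
    and h_subadd: "z \<in> quadrant \<Longrightarrow> w \<in> quadrant \<Longrightarrow> h (z + w) \<le> h z + h w"

lemma quadrant_gauge_reduce:
  assumes "A \<in> risk_sets"
  shows "quadrant_gauge (reduce A)"
  using assms by unfold_locales
    (auto intro: borel_measurable_reduce reduce_nonneg reduce_scaleR reduce_mono reduce_subadditive)

lemma quadrant_gauge_sum: "quadrant_gauge (\<lambda>z :: real ^ 'd. \<Sum>j\<in>UNIV. z $ j)"
  by unfold_locales
    (auto simp: quadrant_def sum_distrib_left sum.distrib intro!: sum_nonneg borel_measurable_sum)

section \<open>Extension of a gauge to the compactified quadrant\<close>

lemma embed_scale_ext_iff:
  assumes "x > 0"
  shows "embed z \<in> scale_ext x B \<longleftrightarrow> embed (z /\<^sub>R x) \<in> B"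
proof -
  have eq: "embed z = (\<chi> j. ennreal x * b $ j) \<longleftrightarrow> b = embed (z /\<^sub>R x)" for b
  proof -
    have "ennreal (z $ j) = ennreal x * c \<longleftrightarrow> c = ennreal ((z /\<^sub>R x) $ j)" for j c
    proof
      assume "ennreal (z $ j) = ennreal x * c"
      then have "ennreal (inverse x) * ennreal (z $ j) = ennreal (inverse x) * ennreal x * c"
        by (simp add: mult.assoc)
      then show "c = ennreal ((z /\<^sub>R x) $ j)"
        using assms by (simp flip: ennreal_mult')
    next
      assume "c = ennreal ((z /\<^sub>R x) $ j)"
      then show "ennreal (z $ j) = ennreal x * c"
        using assms by (simp flip: ennreal_mult' add: mult.assoc[symmetric])
    qed
    then show ?thesis unfolding embed_def vec_eq_iff by simp
  qed
  then show ?thesis unfolding scale_ext_def image_iff by (simp only: eq) simp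
qed

lemma continuous_on_embed: "continuous_on UNIV (embed :: real ^ 'd \<Rightarrow> _)"
  unfolding embed_def by (intro continuous_on_vec_lambda continuous_on_ennreal continuous_intros)

text \<open>With this, the Radon condition, which speaks of compact sets, applies to every closed
  set that avoids the origin.\<close>

lemma compact_UNIV_ennreal_vec: "compact (UNIV :: (ennreal ^ 'd) set)"
proof -
  \<comment> \<open>A continuous map of [0,2] onto [0,\<infinity>]: the identity up to 1, then
    \<open>1 / (2 - t)\<close>, which agrees with it at 1 and is infinite at 2.\<close>
  define g :: "real \<Rightarrow> ennreal" where "g t = (if t \<le> 1 then ennreal t else inverse (ennreal (2 - t)))" for t
  have "continuous_on ({0..1} \<union> {1..2}) g" unfolding g_def
    by (intro continuous_on_cases continuous_intros continuous_on_inverse_ennreal continuous_on_ennreal) auto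
  then have g: "continuous_on {0..2} g" by (simp add: ivl_disj_un)
  have surj: "\<exists>t\<in>{0..2}. g t = y" for y
  proof (cases y)
    case (real r)
    show ?thesis
    proof (cases "r \<le> 1")
      case True
      then show ?thesis using real by (intro bexI[of _ r]) (auto simp: g_def)
    next
      case False
      then have "inverse r < 1" "inverse r > 0" by (auto simp: field_simps)
      then show ?thesis using real False
        by (intro bexI[of _ "2 - inverse r"]) (auto simp: g_def inverse_ennreal)
    qed
  next
    case top
    then show ?thesis by (intro bexI[of _ 2]) (auto simp: g_def)
  qed
  define f :: "real ^ 'd \<Rightarrow> ennreal ^ 'd" where "f z = (\<chi> j. g (z $ j))" for z
  have "continuous_on (cbox 0 2) f" unfolding f_def
    by (intro continuous_on_vec_lambda continuous_on_compose2[OF g] continuous_intros)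
       (auto simp: mem_box_cart)
  then have "compact (f ` cbox 0 2)" by (intro compact_continuous_image compact_cbox)
  moreover have "f ` cbox 0 2 = UNIV"
  proof -
    have "b \<in> f ` cbox 0 2" for b
    proof -
      obtain t where t: "\<And>j. t j \<in> {0..2} \<and> g (t j) = b $ j"
        using choice[of "\<lambda>j t. t \<in> {0..2} \<and> g t = b $ j"] surj by blast
      show ?thesis by (rule image_eqI[of _ _ "\<chi> j. t j"])
        (use t in \<open>auto simp: f_def vec_eq_iff mem_box_cart\<close>)
    qed
    then show ?thesis by auto
  qed
  ultimately show ?thesis by simp
qed

lemma open_vec_pred:
  assumes "\<And>j. open {x. P j x}"
  shows "open {b :: 'a::topological_space ^ 'd. \<forall>j. P j (b $ j)}"
proof -
  have "{b. \<forall>j. P j (b $ j)} = (\<Inter>j. (\<lambda>b. b $ j) -` {x. P j x})" by auto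
  moreover have "open ((\<lambda>b :: 'a ^ 'd. b $ j) -` {x. P j x})" for j
    using assms by (intro open_vimage continuous_intros)
  ultimately show ?thesis by auto
qed

context quadrant_gauge
begin

text \<open>Extension from below, as \<open>h\<close> has no value at vectors with infinite
  coordinates. Monotonicity makes it agree with \<open>h\<close> on the finite vectors of the
  quadrant.\<close>

definition ext :: "ennreal ^ 'd \<Rightarrow> ennreal" where
  "ext b = (SUP z\<in>{z \<in> quadrant. \<forall>j. ennreal (z $ j) \<le> b $ j}. ennreal (h z))"

lemma h_zero: "h 0 = 0"
  using h_scaleR[of 0 2] by (simp add: quadrant_def)

lemma h_mono_le:
  assumes "z \<in> quadrant" "\<And>j. z $ j \<le> w $ j"
  shows "h z \<le> h w"
  using h_mono[of z "w - z"] assms by (simp add: quadrant_def)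

lemma ext_upper: "z \<in> quadrant \<Longrightarrow> (\<And>j. ennreal (z $ j) \<le> b $ j) \<Longrightarrow> ennreal (h z) \<le> ext b"
  unfolding ext_def by (rule SUP_upper) simp

lemma ext_embed:
  assumes z: "z \<in> quadrant"
  shows "ext (embed z) = ennreal (h z)"
proof (rule antisym)
  show "ext (embed z) \<le> ennreal (h z)"
    unfolding ext_def embed_def
    using z by (intro SUP_least ennreal_leI h_mono_le) (auto simp: quadrant_def)
qed (use z in \<open>auto simp: embed_def intro: ext_upper\<close>)

text \<open>Lower semicontinuity. Homogeneity allows the witness \<open>z\<close> to be shrunk by
  some \<open>c < 1\<close>; its inequalities with \<open>b\<close> become strict in the positive
  coordinates and survive small changes of \<open>b\<close>.\<close>

lemma open_ext_greater: "open {b. ennreal t < ext b}"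
proof (subst open_subopen, safe)
  fix b assume "ennreal t < ext b"
  then obtain z where z: "z \<in> quadrant" "\<And>j. ennreal (z $ j) \<le> b $ j" and t: "ennreal t < ennreal (h z)"
    unfolding ext_def by (auto simp: less_SUP_iff)
  have "((\<lambda>c. ennreal (c * h z)) \<longlongrightarrow> ennreal (1 * h z)) (at_left 1)"
    by (intro tendsto_intros)
  then have "\<forall>\<^sub>F c in at_left 1. ennreal t < ennreal (c * h z)"
    using t by (intro order_tendstoD) auto
  moreover have "\<forall>\<^sub>F c in at_left (1::real). 0 < c \<and> c < 1"
    by (auto simp: eventually_at_left_field intro: exI[of _ 0])
  ultimately have "\<forall>\<^sub>F c in at_left 1. ennreal t < ennreal (c * h z) \<and> 0 < c \<and> c < (1::real)"
    by eventually_elim auto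
  then obtain c where c: "ennreal t < ennreal (c * h z)" "0 < c" "c < 1"
    using eventually_happens[of _ "at_left (1::real)"] trivial_limit_at_left_real by blast
  define N where "N = {b' :: ennreal ^ 'd. \<forall>j. z $ j > 0 \<longrightarrow> ennreal (c * z $ j) < b' $ j}"
  have "open N" unfolding N_def
  proof (rule open_vec_pred)
    show "open {x. z $ j > 0 \<longrightarrow> ennreal (c * z $ j) < x}" for j
      by (cases "z $ j > 0") (auto simp: open_Collect_less)
  qed
  moreover have "b \<in> N"
  proof -
    have "ennreal (c * z $ j) < b $ j" if "z $ j > 0" for j
      by (rule less_le_trans[OF _ z(2)]) (use that c in \<open>auto intro!: ennreal_lessI\<close>)
    then show ?thesis by (simp add: N_def)
  qed
  moreover have "N \<subseteq> {b. ennreal t < ext b}"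
  proof safe
    fix b' assume "b' \<in> N"
    then have "ennreal ((c *\<^sub>R z) $ j) \<le> b' $ j" for j
      using c by (cases "z $ j > 0")
        (auto simp: N_def less_imp_le not_less mult_nonneg_nonpos ennreal_neg)
    moreover have "c *\<^sub>R z \<in> quadrant" using z c by (simp add: quadrant_def)
    ultimately have "ennreal (h (c *\<^sub>R z)) \<le> ext b'" by (intro ext_upper)
    with c z show "ennreal t < ext b'" by (simp add: h_scaleR)
  qed
  ultimately show "\<exists>T. open T \<and> b \<in> T \<and> T \<subseteq> {b. ennreal t < ext b}" by blast
qed

text \<open>Upper semicontinuity. Raising the finite coordinates of \<open>b\<close> by less than
  \<open>d\<close> costs at most \<open>d * h 1\<close>, by subadditivity.\<close>

lemma open_ext_less: "open {b. ext b < t}"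
proof (subst open_subopen, safe)
  fix b assume b: "ext b < t"
  define u where "u = h 1"
  have u: "u \<ge> 0" unfolding u_def by (rule h_nonneg) (simp add: quadrant_def)
  have "((\<lambda>d. ext b + ennreal (d * u)) \<longlongrightarrow> ext b + ennreal (0 * u)) (at_right 0)"
    by (intro tendsto_intros)
  then have "\<forall>\<^sub>F d in at_right 0. ext b + ennreal (d * u) < t"
    using b by (intro order_tendstoD) auto
  with eventually_at_right_less[of "0::real"]
  have "\<forall>\<^sub>F d in at_right 0. 0 < d \<and> ext b + ennreal (d * u) < t" by eventually_elim auto
  then obtain d where d: "0 < d" "ext b + ennreal (d * u) < t"
    using eventually_happens[of _ "at_right (0::real)"] trivial_limit_at_right_real by blast
  define N where "N = {b' :: ennreal ^ 'd. \<forall>j. b $ j \<noteq> \<infinity> \<longrightarrow> b' $ j < b $ j + ennreal d}"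
  have "open N" unfolding N_def
  proof (rule open_vec_pred)
    show "open {x. b $ j \<noteq> \<infinity> \<longrightarrow> x < b $ j + ennreal d}" for j
      by (cases "b $ j = \<infinity>") (auto simp: open_Collect_less)
  qed
  moreover have "b \<in> N" using d(1) by (auto simp: N_def ennreal_add_left_cancel_less)
  moreover have "N \<subseteq> {b. ext b < t}"
  proof safe
    fix b' assume b': "b' \<in> N"
    have "ext b' \<le> ext b + ennreal (d * u)"
      unfolding ext_def[of b']
    proof (rule SUP_least)
      fix z assume "z \<in> {z \<in> quadrant. \<forall>j. ennreal (z $ j) \<le> b' $ j}"
      then have z: "z \<in> quadrant" "\<And>j. ennreal (z $ j) \<le> b' $ j" by auto
      \<comment> \<open>\<open>z\<close> lowered by \<open>d\<close> and cut off at 0 lies below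
        \<open>b\<close>, and \<open>z\<close> lies below \<open>w + d *\<^sub>R 1\<close>;
        coordinates where \<open>b\<close> is infinite impose nothing.\<close>
      define w :: "real ^ 'd" where "w = (\<chi> j. max (z $ j - d) 0)"
      have w: "w \<in> quadrant" by (simp add: w_def quadrant_def)
      have d1: "d *\<^sub>R 1 \<in> (quadrant :: (real ^ 'd) set)" using d by (simp add: quadrant_def)
      have wb: "ennreal (w $ j) \<le> b $ j" for j
      proof (cases "b $ j")
        case (real r)
        then have "b $ j \<noteq> \<infinity>" by simp
        then have "b' $ j < b $ j + ennreal d" using b' unfolding N_def by blast
        then have "ennreal (z $ j) < ennreal r + ennreal d"
          using le_less_trans[OF z(2)] real by simp
        then have "z $ j < r + d" using real d z(1) 
          by (auto simp: quadrant_def ennreal_less_iff simp flip: ennreal_plus)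
        then show ?thesis using real by (simp add: w_def ennreal_leI)
      qed auto
      have "h z \<le> h (w + d *\<^sub>R 1)"
        by (rule h_mono_le[OF z(1)]) (simp add: w_def)
      also have "\<dots> \<le> h w + d * u"
        using h_subadd[OF w d1] h_scaleR[of 1 d] d by (simp add: u_def quadrant_def)
      finally have "ennreal (h z) \<le> ennreal (h w + d * u)" by (rule ennreal_leI)
      also have "\<dots> = ennreal (h w) + ennreal (d * u)"
        using h_nonneg[OF w] d u by simp
      also have "\<dots> \<le> ext b + ennreal (d * u)"
        using ext_upper[OF w wb] by (rule add_right_mono)
      finally show "ennreal (h z) \<le> ext b + ennreal (d * u)" .
    qed
    with d show "ext b' < t" by (rule_tac le_less_trans)
  qed
  ultimately show "\<exists>T. open T \<and> b \<in> T \<and> T \<subseteq> {b. ext b < t}" by blast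
qed

lemma closed_ext_ge: "closed {b. t \<le> ext b}"
proof -
  have "{b. t \<le> ext b} = - {b. ext b < t}" by auto
  then show ?thesis using open_ext_less[of t] by (simp add: closed_def)
qed

lemma ext_zero: "ext 0 = 0"
proof -
  have "embed (0 :: real ^ 'd) = 0" by (simp add: embed_def vec_eq_iff)
  then show ?thesis using ext_embed[of 0] by (simp add: h_zero quadrant_def)
qed

lemma measurable_ext: "ext \<in> borel_measurable borel"
proof (rule borel_measurableI_less)
  fix t show "{x \<in> space borel. ext x < t} \<in> sets borel" using open_ext_less[of t] by simp
qed

lemma closure_ext_greater: "closure {b. ennreal t < ext b} \<subseteq> {b. ennreal t \<le> ext b}"
  by (rule closure_minimal) (auto intro: closed_ext_ge)

lemma frontier_ext_greater: "frontier {b. ennreal t < ext b} \<subseteq> {b. ext b = ennreal t}"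
  using closure_ext_greater[of t] open_ext_greater[of t]
  by (auto simp: frontier_def interior_open)

end

section \<open>Multivariate regular variation and the reduced tail\<close>

context quadrant_gauge
begin

context
  fixes \<mu> :: "(ennreal ^ 'd) measure"
  assumes \<mu>: "radon_punctured \<mu>"
begin

lemma punctured_setsI: "S \<in> sets borel \<Longrightarrow> 0 \<notin> S \<Longrightarrow> S \<in> sets \<mu>"
  using \<mu> by (auto simp: radon_punctured_def sets_restrict_space image_iff intro!: bexI[of _ S])

lemma emeasure_ext_ge_finite:
  assumes "t > 0"
  shows "emeasure \<mu> {b. ennreal t \<le> ext b} < \<infinity>"
proof -
  have "compact (UNIV \<inter> {b. ennreal t \<le> ext b})"
    using compact_UNIV_ennreal_vec closed_ext_ge by (rule compact_Int_closed)
  moreover have "0 \<notin> {b. ennreal t \<le> ext b}" using assms by (simp add: ext_zero)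
  ultimately show ?thesis using \<mu> by (simp add: radon_punctured_def)
qed

lemma sets_ext:
  assumes "t > 0"
  shows "{b. ennreal t \<le> ext b} \<in> sets \<mu>" "{b. ennreal t < ext b} \<in> sets \<mu>"
    "{b. ext b = ennreal t} \<in> sets \<mu>" "{b. ext b = \<infinity>} \<in> sets \<mu>"
proof -
  note [measurable] = measurable_ext
  show "{b. ennreal t \<le> ext b} \<in> sets \<mu>" "{b. ennreal t < ext b} \<in> sets \<mu>"
    "{b. ext b = ennreal t} \<in> sets \<mu>" "{b. ext b = \<infinity>} \<in> sets \<mu>"
    using assms by (auto intro!: punctured_setsI simp: ext_zero)
qed

lemma emeasure_ext_greater_finite:
  assumes "t > 0"
  shows "emeasure \<mu> {b. ennreal t < ext b} < \<infinity>"
  by (rule le_less_trans[OF emeasure_mono emeasure_ext_ge_finite[OF assms]])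
     (use sets_ext[OF assms] in auto)

text \<open>Above a positive level \<mu> is finite, and the image of a finite measure on the line
  has only countably many atoms.\<close>

lemma countable_atoms_ext:
  assumes s: "s > 0"
  shows "countable {t. s < t \<and> emeasure \<mu> {b. ext b = ennreal t} \<noteq> 0}"
proof -
  define S where "S = {b. ennreal s < ext b}"
  \<comment> \<open>\<open>enn2real\<close> sends \<infinity> to 0, which cannot be mistaken for a
    level \<open>t > s\<close>.\<close>
  define N where "N = distr (restrict_space \<mu> S) borel (\<lambda>b. enn2real (ext b))"
  have S: "S \<in> sets \<mu>" "emeasure \<mu> S < \<infinity>"
    using sets_ext[OF s] emeasure_ext_greater_finite[OF s] by (auto simp: S_def)
  then have sp: "space (restrict_space \<mu> S) = S"
    using sets.sets_into_space[OF S(1)] by (auto simp: space_restrict_space)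
  have "(\<lambda>b. enn2real (ext b)) \<in> borel_measurable borel" using measurable_ext by measurable
  moreover have "sets \<mu> = sets (restrict_space borel (- {0}))" using \<mu> by (simp add: radon_punctured_def)
  ultimately have m: "(\<lambda>b. enn2real (ext b)) \<in> restrict_space \<mu> S \<rightarrow>\<^sub>M borel"
    by (intro measurable_restrict_space1) (simp cong: measurable_cong_sets add: measurable_restrict_space1)
  interpret R: finite_measure "restrict_space \<mu> S"
    by (rule finite_measureI) (use S sp in \<open>auto simp: emeasure_restrict_space\<close>)
  interpret N: finite_measure N unfolding N_def by (rule R.finite_measure_distr[OF m])
  have "measure N {t} \<noteq> 0" if "s < t" "emeasure \<mu> {b. ext b = ennreal t} \<noteq> 0" for t
  proof -
    have *: "(\<lambda>b. enn2real (ext b)) -` {t} \<inter> S = {b. ext b = ennreal t}"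
    proof (intro set_eqI iffI)
      fix b assume b: "b \<in> (\<lambda>b. enn2real (ext b)) -` {t} \<inter> S"
      then show "b \<in> {b. ext b = ennreal t}" using that s
        by (cases "ext b") auto
    next
      fix b assume "b \<in> {b. ext b = ennreal t}"
      then show "b \<in> (\<lambda>b. enn2real (ext b)) -` {t} \<inter> S"
        using that s by (simp add: S_def ennreal_lessI)
    qed
    have "emeasure N {t} = emeasure (restrict_space \<mu> S) ((\<lambda>b. enn2real (ext b)) -` {t} \<inter> S)"
      unfolding N_def by (subst emeasure_distr[OF m]) (simp_all add: sp)
    also have "\<dots> = emeasure \<mu> {b. ext b = ennreal t}"
      unfolding * by (subst emeasure_restrict_space) (use * S sets.sets_into_space[OF S(1)] in \<open>auto simp: Int_absorb1\<close>)
    finally show ?thesis using that N.emeasure_eq_measure[of "{t}"] by auto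
  qed
  then have "{t. s < t \<and> emeasure \<mu> {b. ext b = ennreal t} \<noteq> 0} \<subseteq> {t. measure N {t} \<noteq> 0}" by auto
  then show ?thesis using N.countable_support countable_subset by blast
qed

lemma ex_non_atom_ext:
  assumes "0 < a" "a < b"
  obtains t where "a < t" "t < b" "emeasure \<mu> {x. ext x = ennreal t} = 0"
proof -
  have "\<not> {a<..<b} \<subseteq> {t. a < t \<and> emeasure \<mu> {b. ext b = ennreal t} \<noteq> 0}"
    using countable_atoms_ext[OF assms(1)] uncountable_open_interval[of a b] assms countable_subset by blast
  then show ?thesis using that by auto
qed

end

text \<open>The frontier of \<open>{b. ennreal t < ext b}\<close> lies in a level set, so a null
  level gives a continuity set. Its limit is carried over to the unscaled tail by substituting
  \<open>x / t\<close>, where regular variation of \<open>G\<close> contributes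
  \<open>t powr \<alpha>\<close>.\<close>

lemma MRV_scaled_tail:
  assumes M: "MRV \<alpha> \<mu> G V" and t: "t > 0" and null: "emeasure \<mu> {b. ext b = ennreal t} = 0"
  shows "((\<lambda>x. measure V {z. x < h z} / tail G x) \<longlongrightarrow> measure \<mu> {b. ennreal t < ext b} * t powr \<alpha>) at_top"
proof -
  define B where "B = {b. ennreal t < ext b}"
  have \<mu>: "radon_punctured \<mu>" and V: "quadrant_distribution V" and G: "regularly_varying \<alpha> G"
    using M by (auto simp: MRV_def)
  have pos: "tail G x > 0" for x using G by (auto simp: regularly_varying_def intro: tail_pos)
  have oB: "open B" using open_ext_greater by (simp add: B_def)
  have "0 \<notin> closure B" using closure_ext_greater[of t] t by (auto simp: B_def ext_zero)
  moreover have "emeasure \<mu> (frontier B) = 0"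
  proof -
    have "emeasure \<mu> (frontier B) \<le> emeasure \<mu> {b. ext b = ennreal t}"
      using frontier_ext_greater[of t] sets_ext(3)[OF \<mu> t] by (intro emeasure_mono) (auto simp: B_def)
    then show ?thesis using null by simp
  qed
  ultimately have lim: "((\<lambda>x. measure V {z. embed z \<in> scale_ext x B} / tail G x) \<longlongrightarrow> measure \<mu> B) at_top"
    using M oB by (auto simp: MRV_def)
  have eq: "measure V {z. embed z \<in> scale_ext x B} = measure V {z. x * t < h z}" if x: "x > 0" for x
  proof (rule measure_eq_AE)
    have sV: "sets V = sets borel" using V by (simp add: quadrant_distribution_def)
    show "AE z in V. z \<in> {z. embed z \<in> scale_ext x B} \<longleftrightarrow> z \<in> {z. x * t < h z}"
    proof -
      have "AE z in V. z \<in> quadrant" using V by (simp add: quadrant_distribution_def)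
      then show ?thesis
      proof eventually_elim
        case (elim z)
        have q: "z /\<^sub>R x \<in> quadrant" using elim x by (simp add: quadrant_def)
        have "embed z \<in> scale_ext x B \<longleftrightarrow> ennreal t < ext (embed (z /\<^sub>R x))"
          using x by (simp add: embed_scale_ext_iff B_def)
        also have "\<dots> \<longleftrightarrow> t < h z / x"
          using ext_embed[OF q] h_scaleR[OF elim, of "inverse x"] x t h_nonneg[OF q]
          by (simp add: ennreal_less_iff divide_inverse mult.commute)
        finally show ?case using x by (simp add: field_simps)
      qed
    qed
    have "{z. embed z \<in> scale_ext x B} = (\<lambda>z. embed (z /\<^sub>R x)) -` B"
      using x by (auto simp: embed_scale_ext_iff)
    moreover have "open ((\<lambda>z. embed (z /\<^sub>R x)) -` B)"
      by (intro open_vimage oB continuous_on_compose2[OF continuous_on_embed] continuous_intros) auto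
    ultimately show "{z. embed z \<in> scale_ext x B} \<in> sets V" by (simp add: sV)
    show "{z. x * t < h z} \<in> sets V" using h_meas by (simp add: sV)
  qed
  have "((\<lambda>x. measure V {z. x * t < h z} / tail G x) \<longlongrightarrow> measure \<mu> B) at_top"
    by (rule Lim_transform_eventually[OF lim], rule eventually_mono[OF eventually_gt_at_top[of 0]])
       (simp add: eq)
  moreover have dt: "filterlim (\<lambda>x. x / t) at_top at_top"
    using filterlim_tendsto_pos_mult_at_top[OF tendsto_const[of "inverse t"] _ filterlim_ident] t
    by (simp add: divide_inverse mult.commute)
  ultimately have 1: "((\<lambda>x. measure V {z. x / t * t < h z} / tail G (x / t)) \<longlongrightarrow> measure \<mu> B) at_top"
    by (rule filterlim_compose)
  have 2: "((\<lambda>x. tail G (x / t) / tail G x) \<longlongrightarrow> t powr \<alpha>) at_top"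
    using regularly_varying_ratio[OF G, of "inverse t"] t
    by (simp add: powr_minus inverse_powr divide_inverse mult.commute)
  from tendsto_mult[OF 1 2] show ?thesis
    using t pos by (simp add: B_def less_imp_neq[THEN not_sym])
qed

text \<open>The limit does not depend on the null level chosen, so the mass above each null level
  \<open>t\<close> is \<open>k * t powr (-\<alpha>)\<close>. Null levels on both sides of 1 squeeze
  the mass above 1, although level 1 is not known to be null; null levels tending to \<infinity>
  exclude mass at \<infinity>.\<close>

lemma MRV_gauge_limit:
  assumes M: "MRV \<alpha> \<mu> G V"
  shows "((\<lambda>x. measure V {z. x < h z} / tail G x) \<longlongrightarrow> measure \<mu> {b. 1 < ext b}) at_top"
    and "emeasure \<mu> {b. 1 < ext b} < \<infinity>"
    and "emeasure \<mu> {b. ext b = \<infinity>} = 0"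
proof -
  have \<mu>: "radon_punctured \<mu>" and \<alpha>: "\<alpha> > 0" using M by (auto simp: MRV_def regularly_varying_def)
  let ?m = "\<lambda>t. measure \<mu> {b. ennreal t < ext b}"
  let ?good = "\<lambda>t. t > 0 \<and> emeasure \<mu> {b. ext b = ennreal t} = 0"
  note fin = emeasure_ext_greater_finite[OF \<mu>]
  have good: "\<exists>t. a < t \<and> t < b \<and> ?good t" if ab: "0 < a" "a < b" for a b
  proof -
    obtain t where "a < t" "t < b" "emeasure \<mu> {x. ext x = ennreal t} = 0"
      by (rule ex_non_atom_ext[OF \<mu> ab])
    with ab show ?thesis by (intro exI[of _ t]) auto
  qed
  obtain t0 where t0: "?good t0" using good[of 1 2] by auto
  define k where "k = ?m t0 * t0 powr \<alpha>"
  have lim: "((\<lambda>x. measure V {z. x < h z} / tail G x) \<longlongrightarrow> k) at_top"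
    unfolding k_def using t0 by (intro MRV_scaled_tail[OF M]) auto
  have m: "?m t = k * t powr (-\<alpha>)" if "?good t" for t
  proof -
    have "?m t * t powr \<alpha> = k"
      by (rule tendsto_unique[OF _ MRV_scaled_tail[OF M] lim]) (use that in auto)
    then show ?thesis using that by (auto simp: powr_minus field_simps)
  qed
  have mono: "?m t \<le> ?m s" if "0 < s" "s \<le> t" for s t
  proof (rule measure_mono_fmeasurable)
    show "{b. ennreal t < ext b} \<subseteq> {b. ennreal s < ext b}"
      using that by (auto intro: le_less_trans[OF ennreal_leI])
    show "{b. ennreal t < ext b} \<in> sets \<mu>" using sets_ext[OF \<mu>] that by simp
    show "{b. ennreal s < ext b} \<in> fmeasurable \<mu>" using sets_ext[OF \<mu>] fin that by (intro fmeasurableI) auto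
  qed
  have "\<exists>t. 1 < t \<and> t < 1 + inverse (real (Suc n)) \<and> ?good t" for n
    by (rule good) auto
  then obtain u where u: "\<And>n. 1 < u n \<and> u n < 1 + inverse (real (Suc n)) \<and> ?good (u n)" by metis
  have u1: "u \<longlonglongrightarrow> 1"
  proof (rule real_tendsto_sandwich[of "\<lambda>_. 1" _ _ "\<lambda>n. 1 + inverse (real (Suc n))"])
    show "(\<lambda>n. 1 + inverse (real (Suc n))) \<longlonglongrightarrow> 1"
      using LIMSEQ_inverse_real_of_nat_add[of 1] by simp
  qed (use u in \<open>auto intro!: always_eventually less_imp_le\<close>)
  \<comment> \<open>The shift by two keeps the left endpoint positive at \<open>n = 0\<close>, as
    \<open>good\<close> demands.\<close>
  have "\<exists>t. 1 - inverse (real (Suc (Suc n))) < t \<and> t < 1 \<and> ?good t" for n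
    by (rule good) (auto simp: field_simps)
  then obtain l where l: "\<And>n. 1 - inverse (real (Suc (Suc n))) < l n \<and> l n < 1 \<and> ?good (l n)" by metis
  have l1: "l \<longlonglongrightarrow> 1"
  proof (rule real_tendsto_sandwich[of "\<lambda>n. 1 - inverse (real (Suc (Suc n)))" _ _ "\<lambda>_. 1"])
    have "(\<lambda>n. 1 + - inverse (real (Suc n))) \<longlonglongrightarrow> 1"
      by (rule LIMSEQ_inverse_real_of_nat_add_minus)
    from LIMSEQ_Suc[OF this] show "(\<lambda>n. 1 - inverse (real (Suc (Suc n)))) \<longlonglongrightarrow> 1" by simp
  qed (use l in \<open>auto intro!: always_eventually less_imp_le\<close>)
  have "?m 1 \<le> k"
  proof (rule tendsto_lowerbound)
    show "(\<lambda>n. k * l n powr (-\<alpha>)) \<longlonglongrightarrow> k"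
      using tendsto_mult[OF tendsto_const tendsto_powr[OF l1 tendsto_const[of "-\<alpha>"]], of k] by simp
    show "\<forall>\<^sub>F n in sequentially. ?m 1 \<le> k * l n powr (-\<alpha>)"
      proof (rule always_eventually, rule allI)
      show "?m 1 \<le> k * l n powr (-\<alpha>)" for n using mono[of "l n" 1] l[of n] m[of "l n"] by linarith
    qed
  qed simp
  moreover have "k \<le> ?m 1"
  proof (rule tendsto_upperbound)
    show "(\<lambda>n. k * u n powr (-\<alpha>)) \<longlonglongrightarrow> k"
      using tendsto_mult[OF tendsto_const tendsto_powr[OF u1 tendsto_const[of "-\<alpha>"]], of k] by simp
    show "\<forall>\<^sub>F n in sequentially. k * u n powr (-\<alpha>) \<le> ?m 1"
      proof (rule always_eventually, rule allI)
      show "k * u n powr (-\<alpha>) \<le> ?m 1" for n using mono[of 1 "u n"] u[of n] m[of "u n"] by linarith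
    qed
  qed simp
  ultimately show "((\<lambda>x. measure V {z. x < h z} / tail G x) \<longlongrightarrow> measure \<mu> {b. 1 < ext b}) at_top"
    using lim by simp
  show "emeasure \<mu> {b. 1 < ext b} < \<infinity>" using fin[of 1] by simp
  have "\<exists>t. real (Suc n) < t \<and> t < real (Suc n) + 1 \<and> ?good t" for n
    by (rule good) auto
  then obtain v where v: "\<And>n. real (Suc n) < v n \<and> v n < real (Suc n) + 1 \<and> ?good (v n)" by metis
  have "filterlim v at_top sequentially"
  proof (rule filterlim_at_top_mono[OF filterlim_real_sequentially always_eventually], rule allI)
    show "real n \<le> v n" for n using v[of n] by auto
  qed
  then have "(\<lambda>n. k * v n powr (-\<alpha>)) \<longlonglongrightarrow> k * 0"
    using \<alpha> by (intro tendsto_intros tendsto_neg_powr) auto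
  moreover have "measure \<mu> {b. ext b = \<infinity>} \<le> k * v n powr (-\<alpha>)" for n
  proof -
    have vn: "v n > 0" using v[of n] by blast
    have "measure \<mu> {b. ext b = \<infinity>} \<le> ?m (v n)"
      using sets_ext[OF \<mu> vn] fin[OF vn] by (intro measure_mono_fmeasurable fmeasurableI) auto
    with m[of "v n"] v[of n] show ?thesis by simp
  qed
  ultimately have "measure \<mu> {b. ext b = \<infinity>} \<le> 0"
    by (intro tendsto_lowerbound[of _ 0 sequentially]) auto
  moreover have "emeasure \<mu> {b. ext b = \<infinity>} < \<infinity>"
    by (rule le_less_trans[OF emeasure_mono fin[of 1]]) (use sets_ext[OF \<mu>, of 1] in auto)
  ultimately show "emeasure \<mu> {b. ext b = \<infinity>} = 0"
    by (simp add: emeasure_eq_ennreal_measure measure_le_0_iff)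
qed

end

text \<open>The extended coordinate sum is infinite as soon as one coordinate is, whereas the
  extension of \<open>reduce A\<close> may stay finite there; hence the second gauge.\<close>

lemma MRV_infinite_coordinates_null:
  fixes \<mu> :: "(ennreal ^ 'd) measure"
  assumes M: "MRV \<alpha> \<mu> G V"
  shows "emeasure \<mu> {b. \<exists>j. b $ j = \<infinity>} = 0"
proof -
  interpret S: quadrant_gauge "\<lambda>z :: real ^ 'd. \<Sum>j\<in>UNIV. z $ j" by (rule quadrant_gauge_sum)
  have \<mu>: "radon_punctured \<mu>" using M by (auto simp: MRV_def)
  have "S.ext b = \<infinity>" if "b $ j = \<infinity>" for b j
  proof -
    have "of_nat n \<le> S.ext b" for n
    proof -
      have "ennreal (\<Sum>i\<in>UNIV. axis j (real n) $ i) \<le> S.ext b"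
        using that by (intro S.ext_upper) (auto simp: quadrant_def axis_def)
      moreover have "(\<Sum>i\<in>UNIV. axis j (real n) $ i) = real n" by (simp add: axis_def)
      ultimately show ?thesis by (simp add: ennreal_of_nat_eq_real_of_nat)
    qed
    then show ?thesis by (metis ennreal_Ex_less_of_nat infinity_ennreal_def linorder_not_less top.not_eq_extremum)
  qed
  then have "emeasure \<mu> {b. \<exists>j. b $ j = \<infinity>} \<le> emeasure \<mu> {b. S.ext b = \<infinity>}"
    using S.sets_ext(4)[OF \<mu>, of 1] by (intro emeasure_mono) auto
  then show ?thesis using S.MRV_gauge_limit(3)[OF M] by simp
qed

text \<open>\<open>limit_mass\<close> counts finite vectors only, while
  \<open>{b. 1 < ext b}\<close> may contain vectors with infinite coordinates; the two differ by a
  null set.\<close>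

lemma MRV_reduced_tail:
  fixes \<mu> :: "(ennreal ^ 'd) measure" and A :: "(real ^ 'd) set"
  assumes M: "MRV \<alpha> \<mu> G V" and A: "A \<in> risk_sets"
  shows "((\<lambda>x. measure V {z. x < reduce A z} / tail G x) \<longlongrightarrow> limit_mass \<mu> A) at_top"
proof -
  interpret quadrant_gauge "reduce A" using A by (rule quadrant_gauge_reduce)
  have \<mu>: "radon_punctured \<mu>" using M by (auto simp: MRV_def)
  define I where "I = {b :: ennreal ^ 'd. \<exists>j. b $ j = \<infinity>}"
  have fin: "open (- I)"
  proof -
    have "- I = {b. \<forall>j. b $ j < \<infinity>}" by (simp add: I_def set_eq_iff top.not_eq_extremum)
    moreover have "open {x :: ennreal. x < \<infinity>}" using open_lessThan[of "\<infinity> :: ennreal"] by (simp add: lessThan_def)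
    ultimately show ?thesis by (simp only:) (rule open_vec_pred)
  qed
  have em: "embed ` (A \<inter> quadrant) = {b. 1 < ext b} - I"
  proof (intro set_eqI iffI)
    fix b assume "b \<in> embed ` (A \<inter> quadrant)"
    then obtain z where z: "z \<in> A" "z \<in> quadrant" "b = embed z" by auto
    then have "1 < reduce A z" using less_reduce_iff[OF A z(2), of 1] by (simp add: mem_scale_set_iff)
    then show "b \<in> {b. 1 < ext b} - I" using z ext_embed[OF z(2)]
      by (auto simp: I_def embed_def)
  next
    fix b assume b: "b \<in> {b. 1 < ext b} - I"
    define z where "z = (\<chi> j. enn2real (b $ j))"
    have z: "z \<in> quadrant" "b = embed z"
      using b by (auto simp: z_def quadrant_def I_def embed_def vec_eq_iff less_top)
    then have "1 < reduce A z" using b ext_embed[OF z(1)] h_nonneg[OF z(1)] by simp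
    then have "z \<in> A" using less_reduce_iff[OF A z(1), of 1] by (simp add: mem_scale_set_iff)
    with z show "b \<in> embed ` (A \<inter> quadrant)" by auto
  qed
  have s1: "{b. 1 < ext b} \<in> sets \<mu>" using sets_ext[OF \<mu>, of 1] by simp
  have "0 \<in> - I" by (simp add: I_def)
  then have sI: "I \<in> sets \<mu>"
    using borel_comp[OF borel_open[OF fin]] by (intro punctured_setsI[OF \<mu>]) auto
  have "measure \<mu> ({b. 1 < ext b} - I) = measure \<mu> {b. 1 < ext b}"
    unfolding measure_def
    using emeasure_Diff_null_set[of I \<mu> "{b. 1 < ext b}"] MRV_infinite_coordinates_null[OF M] sI s1
    by (simp add: I_def null_sets_def)
  then show ?thesis using MRV_gauge_limit(1)[OF M] by (simp add: limit_mass_def em)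
qed

section \<open>Independence, discount factors and the renewal integral\<close>

text \<open>Independence of two sigma-algebras is read as independence of the identity maps into
  them, so the law of \<open>(\<omega>, \<omega>)\<close> is a product. Conditioning on
  \<open>F1\<close> becomes Fubini: one copy of the outcome is frozen, the other integrated.\<close>

lemma (in prob_space) nn_integral_indep_diagonal:
  assumes F1: "subalgebra M F1" and F2: "subalgebra M F2"
    and indep: "indep_set (sets F1) (sets F2)"
    and f: "f \<in> borel_measurable (F1 \<Otimes>\<^sub>M F2)"
  shows "(\<integral>\<^sup>+\<omega>. f (\<omega>, \<omega>) \<partial>M) = (\<integral>\<^sup>+\<omega>1. \<integral>\<^sup>+\<omega>2. f (\<omega>1, \<omega>2) \<partial>M \<partial>M)"
proof -
  have m1: "(\<lambda>\<omega>. \<omega>) \<in> M \<rightarrow>\<^sub>M F1" and m2: "(\<lambda>\<omega>. \<omega>) \<in> M \<rightarrow>\<^sub>M F2"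
    using F1 F2 by (auto simp: subalgebra_def intro!: measurableI dest: sets.sets_into_space)
  have s: "{(\<lambda>\<omega>. \<omega>) -` A \<inter> space M | A. A \<in> sets F} = sets F" if "subalgebra M F" for F
    using that sets.sets_into_space[of _ F] by (auto simp: subalgebra_def Int_absorb2 intro!: exI)
  have "indep_var F1 (\<lambda>\<omega>. \<omega>) F2 (\<lambda>\<omega>. \<omega>)"
    unfolding indep_var_eq s[OF F1] s[OF F2]
    using indep m1 m2 F1 F2 by (simp add: subalgebra_def) (metis sets.sigma_sets_eq)
  then have eq: "distr M F1 (\<lambda>\<omega>. \<omega>) \<Otimes>\<^sub>M distr M F2 (\<lambda>\<omega>. \<omega>) = distr M (F1 \<Otimes>\<^sub>M F2) (\<lambda>\<omega>. (\<omega>, \<omega>))"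
    unfolding indep_var_distribution_eq by simp
  interpret D1: prob_space "distr M F1 (\<lambda>\<omega>. \<omega>)" by (rule prob_space_distr[OF m1])
  interpret D2: prob_space "distr M F2 (\<lambda>\<omega>. \<omega>)" by (rule prob_space_distr[OF m2])
  have f': "f \<in> borel_measurable (distr M F1 (\<lambda>\<omega>. \<omega>) \<Otimes>\<^sub>M distr M F2 (\<lambda>\<omega>. \<omega>))"
    using f by (simp cong: measurable_cong_sets)
  have "(\<integral>\<^sup>+\<omega>. f (\<omega>, \<omega>) \<partial>M) = (\<integral>\<^sup>+p. f p \<partial>distr M (F1 \<Otimes>\<^sub>M F2) (\<lambda>\<omega>. (\<omega>, \<omega>)))"
    using m1 m2 f by (subst nn_integral_distr) (auto intro: measurable_Pair)
  also have "\<dots> = (\<integral>\<^sup>+p. f p \<partial>(distr M F1 (\<lambda>\<omega>. \<omega>) \<Otimes>\<^sub>M distr M F2 (\<lambda>\<omega>. \<omega>)))" by (simp add: eq)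
  also have "\<dots> = (\<integral>\<^sup>+\<omega>1. \<integral>\<^sup>+\<omega>2. f (\<omega>1, \<omega>2) \<partial>distr M F2 (\<lambda>\<omega>. \<omega>) \<partial>distr M F1 (\<lambda>\<omega>. \<omega>))"
    using f' by (subst D2.nn_integral_fst[symmetric]) auto
  also have "\<dots> = (\<integral>\<^sup>+\<omega>1. \<integral>\<^sup>+\<omega>2. f (\<omega>1, \<omega>2) \<partial>distr M F2 (\<lambda>\<omega>. \<omega>) \<partial>M)"
  proof (rule nn_integral_distr[OF m1])
    show "(\<lambda>\<omega>1. \<integral>\<^sup>+\<omega>2. f (\<omega>1, \<omega>2) \<partial>distr M F2 (\<lambda>\<omega>. \<omega>)) \<in> borel_measurable (distr M F1 (\<lambda>\<omega>. \<omega>))"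
      using D2.borel_measurable_nn_integral_fst[OF f'] by simp
  qed
  also have "\<dots> = (\<integral>\<^sup>+\<omega>1. \<integral>\<^sup>+\<omega>2. f (\<omega>1, \<omega>2) \<partial>M \<partial>M)"
  proof (rule nn_integral_cong)
    fix \<omega>1 assume "\<omega>1 \<in> space M"
    then have "\<omega>1 \<in> space F1" using F1 by (simp add: subalgebra_def)
    then have "(\<lambda>\<omega>2. f (\<omega>1, \<omega>2)) \<in> borel_measurable F2" using f by measurable
    then show "(\<integral>\<^sup>+\<omega>2. f (\<omega>1, \<omega>2) \<partial>distr M F2 (\<lambda>\<omega>. \<omega>)) = (\<integral>\<^sup>+\<omega>2. f (\<omega>1, \<omega>2) \<partial>M)"
      by (subst nn_integral_distr[OF m2]) auto
  qed
  finally show ?thesis .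
qed

section \<open>Sigma-algebras generated by the three processes\<close>

definition process_algebra ::
    "'w measure \<Rightarrow> 'b measure \<Rightarrow> 'i set \<Rightarrow> ('i \<Rightarrow> 'w \<Rightarrow> 'b) \<Rightarrow> 'w measure" where
  "process_algebra M S I Y = sigma (space M) (\<Union>i\<in>I. {Y i -` B \<inter> space M | B. B \<in> sets S})"

lemma space_process_algebra [simp]: "space (process_algebra M S I Y) = space M"
  unfolding process_algebra_def by (rule space_measure_of) auto

lemma sets_process_algebra: "sets (process_algebra M S I Y) = generated_sigma M S I Y"
  unfolding process_algebra_def generated_sigma_def by (rule sets_measure_of) auto

lemma measurable_process_algebra:
  assumes "i \<in> I" "\<And>\<omega>. \<omega> \<in> space M \<Longrightarrow> Y i \<omega> \<in> space S"
  shows "Y i \<in> process_algebra M S I Y \<rightarrow>\<^sub>M S"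
proof (rule measurableI)
  fix B assume "B \<in> sets S"
  then show "Y i -` B \<inter> space (process_algebra M S I Y) \<in> sets (process_algebra M S I Y)"
    unfolding sets_process_algebra generated_sigma_def space_process_algebra
    using assms(1) by (intro sigma_sets.Basic) blast
qed (use assms in auto)

definition join_algebra :: "'w measure \<Rightarrow> 'w measure \<Rightarrow> 'w measure" where
  "join_algebra F1 F2 = sigma (space F1) (sets F1 \<union> sets F2)"

lemma join_algebra:
  assumes "space F2 = space F1"
  shows space_join_algebra: "space (join_algebra F1 F2) = space F1"
    and sets_join_algebra: "sets (join_algebra F1 F2) = sigma_sets (space F1) (sets F1 \<union> sets F2)"
proof -
  have "sets F1 \<union> sets F2 \<subseteq> Pow (space F1)"
    using sets.sets_into_space[of _ F1] sets.sets_into_space[of _ F2] assms by auto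
  then show "space (join_algebra F1 F2) = space F1"
    "sets (join_algebra F1 F2) = sigma_sets (space F1) (sets F1 \<union> sets F2)"
    by (auto simp: join_algebra_def)
qed

lemma measurable_join_algebraI:
  assumes "space F2 = space F1" "f \<in> F1 \<rightarrow>\<^sub>M N \<or> f \<in> F2 \<rightarrow>\<^sub>M N"
  shows "f \<in> join_algebra F1 F2 \<rightarrow>\<^sub>M N"
  using assms(2) join_algebra[OF assms(1)] assms(1)
  by (auto simp: measurable_def)

text \<open>The discount factors mix arrival times and \<xi>, so these two are merged into one block
  independent of the claims. Independence inside the block serves the renewal integral.\<close>

lemma mutually_independentD:
  fixes \<theta> :: "nat \<Rightarrow> 'w \<Rightarrow> real" and \<xi> :: "real \<Rightarrow> 'w \<Rightarrow> real"
  assumes "prob_space M" and ind: "mutually_independent M X \<theta> \<xi>"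
  defines "FX \<equiv> process_algebra M borel UNIV X"
    and "FN \<equiv> process_algebra M (count_space UNIV) {0..} (claim_number \<theta>)"
    and "F\<xi> \<equiv> process_algebra M borel {0..} \<xi>"
  shows "subalgebra M FX" "subalgebra M FN" "subalgebra M F\<xi>" "subalgebra M (join_algebra FN F\<xi>)"
    and "prob_space.indep_set M (sets FN) (sets F\<xi>)"
    and "prob_space.indep_set M (sets (join_algebra FN F\<xi>)) (sets FX)"
proof -
  interpret prob_space M by fact
  define E where "E k = [sets FX, sets FN, sets F\<xi>] ! k" for k :: nat
  have "indep_sets E {..<3}"
    using ind by (simp add: mutually_independent_def E_def[abs_def] FX_def FN_def F\<xi>_def sets_process_algebra)
  then have E: "indep_sets E {0, 1, 2}"
    by (simp add: eval_nat_numeral lessThan_Suc insert_commute)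
  then have "E 0 \<subseteq> events" "E 1 \<subseteq> events" "E 2 \<subseteq> events" by (auto simp: indep_sets_def)
  then show sub: "subalgebra M FX" "subalgebra M FN" "subalgebra M F\<xi>"
    by (auto simp: subalgebra_def E_def FX_def FN_def F\<xi>_def)
  have sp: "space FX = space M" "space FN = space M" "space F\<xi> = space M"
    by (auto simp: FX_def FN_def F\<xi>_def)
  then show "subalgebra M (join_algebra FN F\<xi>)"
    using sub sets.sigma_sets_subset[of "sets FN \<union> sets F\<xi>" M]
    by (auto simp: subalgebra_def join_algebra)
  have stable: "Int_stable (E k)" if "k \<in> {0, 1, 2}" for k
    using that by (auto simp: E_def Int_stable_def)
  have ss: "sigma_sets (space M) (E k) = E k" if "k \<in> {0, 1, 2}" for k
    using that sets.sigma_sets_eq[of FX] sets.sigma_sets_eq[of FN] sets.sigma_sets_eq[of F\<xi>] sp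
    by (auto simp: E_def)
  have "indep_sets (\<lambda>j. sigma_sets (space M) (\<Union>i\<in>case_bool {1, 2} {0} j. E i)) UNIV"
    by (rule indep_sets_collect_sigma)
       (use E stable in \<open>auto simp: UNIV_bool disjoint_family_on_def insert_commute split: bool.splits\<close>)
  moreover have "(\<lambda>j. sigma_sets (space M) (\<Union>i\<in>case_bool {1, 2} {0} j. E i)) =
      case_bool (sets (join_algebra FN F\<xi>)) (sets FX)"
    using ss[of 0] sp by (auto simp: fun_eq_iff join_algebra E_def split: bool.splits)
  ultimately show "indep_set (sets (join_algebra FN F\<xi>)) (sets FX)" by (simp add: indep_set_def)
  have "indep_sets (\<lambda>j. sigma_sets (space M) (\<Union>i\<in>case_bool {1} {2} j. E i)) UNIV"
    by (rule indep_sets_collect_sigma)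
       (use E stable in \<open>auto simp: UNIV_bool disjoint_family_on_def insert_commute split: bool.splits
          intro: indep_sets_mono_index[rotated]\<close>)
  moreover have "(\<lambda>j. sigma_sets (space M) (\<Union>i\<in>case_bool {1} {2} j. E i)) =
      case_bool (sets FN) (sets F\<xi>)"
    using ss[of 1] ss[of 2] by (auto simp: fun_eq_iff E_def split: bool.splits)
  ultimately show "indep_set (sets FN) (sets F\<xi>)" by (simp add: indep_set_def)
qed

section \<open>Arrival times, path evaluation and the renewal integral\<close>

lemma arrival_nonneg: "renewal_arrivals M \<theta> \<Longrightarrow> \<omega> \<in> space M \<Longrightarrow> 0 \<le> arrival \<theta> i \<omega>"
  by (auto simp: arrival_def renewal_arrivals_def intro: sum_nonneg)

text \<open>Independence is assumed for the counting process, so the arrival times have to be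
  recovered from it; nonnegative inter-arrival times order them.\<close>

lemma arrival_le_iff:
  assumes "renewal_arrivals M \<theta>" "\<omega> \<in> space M"
  shows "arrival \<theta> i \<omega> \<le> t \<longleftrightarrow> enat (Suc i) \<le> claim_number \<theta> t \<omega>"
proof
  assume "arrival \<theta> i \<omega> \<le> t"
  then show "enat (Suc i) \<le> claim_number \<theta> t \<omega>"
    unfolding claim_number_def by (intro Sup_upper) auto
next
  assume "enat (Suc i) \<le> claim_number \<theta> t \<omega>"
  \<comment> \<open>A strict bound below a supremum is exceeded by some element, whether or not the
    supremum is attained.\<close>
  then have "enat i < claim_number \<theta> t \<omega>" by (simp only: Suc_ile_eq)
  then obtain j where j: "i < Suc j" "arrival \<theta> j \<omega> \<le> t"
    unfolding claim_number_def less_Sup_iff by auto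
  have "arrival \<theta> i \<omega> \<le> arrival \<theta> j \<omega>"
    unfolding arrival_def using j assms
    by (intro sum_mono2) (auto simp: renewal_arrivals_def)
  with j show "arrival \<theta> i \<omega> \<le> t" by simp
qed

lemma measurable_arrival:
  assumes R: "renewal_arrivals M \<theta>"
  shows "arrival \<theta> i \<in> borel_measurable (process_algebra M (count_space UNIV) {0..} (claim_number \<theta>))"
proof -
  let ?F = "process_algebra M (count_space UNIV) {0..} (claim_number \<theta>)"
  have "{\<omega> \<in> space ?F. arrival \<theta> i \<omega> \<le> t} \<in> sets ?F" for t
  proof (cases "t \<ge> 0")
    case True
    have [measurable]: "claim_number \<theta> t \<in> ?F \<rightarrow>\<^sub>M count_space UNIV"
      using True by (intro measurable_process_algebra) auto
    have "{\<omega> \<in> space ?F. enat (Suc i) \<le> claim_number \<theta> t \<omega>} \<in> sets ?F" by measurable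
    also have "{\<omega> \<in> space ?F. enat (Suc i) \<le> claim_number \<theta> t \<omega>} = {\<omega> \<in> space ?F. arrival \<theta> i \<omega> \<le> t}"
      using arrival_le_iff[OF R] by auto
    finally show ?thesis .
  next
    \<comment> \<open>The generating family has only times \<open>t \<ge> 0\<close>; for negative
      \<open>t\<close> the event is empty.\<close>
    case False
    have "\<not> arrival \<theta> i \<omega> \<le> t" if "\<omega> \<in> space M" for \<omega>
      using arrival_nonneg[OF R that, of i] False by linarith
    then have eq: "{\<omega> \<in> space ?F. arrival \<theta> i \<omega> \<le> t} = {}" by auto
    show ?thesis unfolding eq by simp
  qed
  then show ?thesis by (simp add: borel_measurable_iff_le)
qed

text \<open>By right-continuity the path at \<open>t\<close> is the limit of its values at grid
  points to the right of \<open>t\<close>, and on each grid cell the approximation is a single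
  random variable. Time is clamped at 0, where the description of the process begins.\<close>

lemma measurable_cadlag_process:
  fixes \<xi> :: "real \<Rightarrow> 'w \<Rightarrow> real"
  assumes C: "cadlag_process M \<xi>"
  shows "(\<lambda>p. \<xi> (max (fst p) 0) (snd p)) \<in> borel_measurable (borel \<Otimes>\<^sub>M process_algebra M borel {0..} \<xi>)"
proof -
  let ?F = "process_algebra M borel {0..} \<xi>"
  \<comment> \<open>The next point strictly to the right of \<open>max t 0\<close> on the grid of
    mesh \<open>1 / Suc n\<close>; strictness is what \<open>at_right\<close> requires.\<close>
  define s where "s n t = (real_of_int \<lfloor>real (Suc n) * max t 0\<rfloor> + 1) / real (Suc n)" for n t
  have s: "max t 0 < s n t" "s n t \<le> max t 0 + inverse (real (Suc n))" for n t
  proof -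
    have "real (Suc n) * max t 0 < real_of_int \<lfloor>real (Suc n) * max t 0\<rfloor> + 1"
      "real_of_int \<lfloor>real (Suc n) * max t 0\<rfloor> + 1 \<le> real (Suc n) * max t 0 + 1" by linarith+
    moreover have "m * x < k \<Longrightarrow> k \<le> m * x + 1 \<Longrightarrow> 0 < m \<Longrightarrow> x < k / m \<and> k / m \<le> x + inverse m" for m x k :: real
      by (simp add: field_simps)
    note this[of "real (Suc n)" "max t 0" "real_of_int \<lfloor>real (Suc n) * max t 0\<rfloor> + 1"]
    ultimately show "max t 0 < s n t" "s n t \<le> max t 0 + inverse (real (Suc n))"
      unfolding s_def by simp_all
  qed
  show ?thesis
  proof (rule borel_measurable_LIMSEQ_real)
    fix n
    let ?k = "\<lambda>p. \<lfloor>real (Suc n) * max (fst p) 0\<rfloor>"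
    have "(\<lambda>p. (\<lambda>k p. \<xi> (max ((real_of_int k + 1) / real (Suc n)) 0) (snd p)) (?k p) p)
        \<in> borel_measurable (borel \<Otimes>\<^sub>M ?F)"
    proof (rule measurable_compose_countable[where g = ?k and
          f = "\<lambda>k p. \<xi> (max ((real_of_int k + 1) / real (Suc n)) 0) (snd p)"])
      fix k :: int
      have [measurable]: "\<xi> (max ((real_of_int k + 1) / real (Suc n)) 0) \<in> borel_measurable ?F"
        by (intro measurable_process_algebra) auto
      show "(\<lambda>p. \<xi> (max ((real_of_int k + 1) / real (Suc n)) 0) (snd p)) \<in> borel_measurable (borel \<Otimes>\<^sub>M ?F)"
        by measurable
    qed measurable
    then show "(\<lambda>p. \<xi> (s n (fst p)) (snd p)) \<in> borel_measurable (borel \<Otimes>\<^sub>M ?F)"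
    proof (rule measurable_cong[THEN iffD1, rotated])
      fix p :: "real \<times> 'w"
      have "max (s n (fst p)) 0 = s n (fst p)" using s(1)[of "fst p" n] by linarith
      then show "\<xi> (max ((real_of_int (?k p) + 1) / real (Suc n)) 0) (snd p) = \<xi> (s n (fst p)) (snd p)"
        unfolding s_def by (simp only:)
    qed
  next
    fix p :: "real \<times> 'w" assume "p \<in> space (borel \<Otimes>\<^sub>M ?F)"
    then have p: "snd p \<in> space M" by (auto simp: space_pair_measure)
    let ?t = "max (fst p) 0"
    have "continuous (at_right ?t) (\<lambda>t. \<xi> t (snd p))"
      using C p by (auto simp: cadlag_process_def cadlag_def)
    then have lim: "((\<lambda>t. \<xi> t (snd p)) \<longlongrightarrow> \<xi> ?t (snd p)) (at_right ?t)"
      by (simp add: continuous_within)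
    have "filterlim (\<lambda>n. s n (fst p)) (at_right ?t) sequentially"
    proof (rule tendsto_imp_filterlim_at_right)
      show "(\<lambda>n. s n (fst p)) \<longlonglongrightarrow> ?t"
        by (rule real_tendsto_sandwich[OF _ _ tendsto_const LIMSEQ_inverse_real_of_nat_add])
           (use s in \<open>auto intro!: always_eventually less_imp_le simp del: of_nat_Suc\<close>)
      show "\<forall>\<^sub>F n in sequentially. s n (fst p) > ?t" using s(1) by (intro always_eventually) simp
    qed
    from filterlim_compose[OF lim this] show "(\<lambda>n. \<xi> (s n (fst p)) (snd p)) \<longlonglongrightarrow> \<xi> ?t (snd p)" .
  qed
qed

text \<open>Campbell's formula for the arrivals, by induction over the construction of
  \<open>f\<close>; the sum over \<open>i\<close> commutes with monotone limits.\<close>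

lemma nn_integral_renewal_measure:
  assumes m: "\<And>i. arrival \<theta> i \<in> borel_measurable M" and f: "f \<in> borel_measurable borel"
  shows "(\<integral>\<^sup>+s. f s \<partial>renewal_measure M \<theta>) = (\<Sum>i. \<integral>\<^sup>+\<omega>. f (arrival \<theta> i \<omega>) \<partial>M)"
proof -
  have "(\<integral>\<^sup>+s. f s \<partial>renewal_measure M \<theta>) = (\<Sum>i. \<integral>\<^sup>+s. f s \<partial>distr M borel (arrival \<theta> i))"
    using f
  proof (induction rule: borel_measurable_induct)
    case (cong f g)
    then have "f = g" by auto
    with cong show ?case by simp
  next
    case (set A)
    then show ?case by (simp add: emeasure_renewal_measure)
  next
    case (mult u c)
    then show ?case by (simp add: nn_integral_cmult)
  next
    case (add u v)
    then show ?case by (simp add: nn_integral_add suminf_add)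
  next
    case (seq U)
    have [measurable]: "U i \<in> borel_measurable borel" for i using seq by auto
    have "(\<integral>\<^sup>+s. (SUP i. U i) s \<partial>renewal_measure M \<theta>) = (SUP j. \<integral>\<^sup>+s. U j s \<partial>renewal_measure M \<theta>)"
      unfolding SUP_apply by (rule nn_integral_monotone_convergence_SUP) (use seq in auto)
    also have "\<dots> = (SUP j. \<Sum>i. \<integral>\<^sup>+s. U j s \<partial>distr M borel (arrival \<theta> i))" using seq by simp
    also have "\<dots> = (\<Sum>i. SUP j. \<integral>\<^sup>+s. U j s \<partial>distr M borel (arrival \<theta> i))"
    proof (rule ennreal_suminf_SUP_eq[symmetric])
      show "incseq (\<lambda>j. \<integral>\<^sup>+s. U j s \<partial>distr M borel (arrival \<theta> i))" for i
        using seq by (auto simp: incseq_def le_fun_def intro!: nn_integral_mono)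
    qed
    also have "\<dots> = (\<Sum>i. \<integral>\<^sup>+s. (SUP j. U j) s \<partial>distr M borel (arrival \<theta> i))"
      unfolding SUP_apply
      by (intro arg_cong[where f=suminf] ext nn_integral_monotone_convergence_SUP[symmetric]) (use seq in auto)
    finally show ?case .
  qed
  then show ?thesis using m f by (simp add: nn_integral_distr)
qed

lemma measurable_discount_factor:
  assumes R: "renewal_arrivals M \<theta>" and C: "cadlag_process M \<xi>"
  shows "(\<lambda>\<omega>. \<xi> (arrival \<theta> i \<omega>) \<omega>) \<in> borel_measurable
    (join_algebra (process_algebra M (count_space UNIV) {0..} (claim_number \<theta>)) (process_algebra M borel {0..} \<xi>))"
    (is "_ \<in> borel_measurable ?J")
proof -
  let ?F = "process_algebra M borel {0..} \<xi>"
  have "arrival \<theta> i \<in> borel_measurable ?J"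
    using measurable_arrival[OF R] by (intro measurable_join_algebraI) auto
  moreover have "(\<lambda>\<omega>. \<omega>) \<in> ?J \<rightarrow>\<^sub>M ?F" by (rule measurable_join_algebraI) auto
  ultimately have "(\<lambda>\<omega>. (arrival \<theta> i \<omega>, \<omega>)) \<in> ?J \<rightarrow>\<^sub>M borel \<Otimes>\<^sub>M ?F" by (rule measurable_Pair)
  from measurable_compose[OF this measurable_cadlag_process[OF C]]
  have "(\<lambda>\<omega>. \<xi> (max (arrival \<theta> i \<omega>) 0) \<omega>) \<in> borel_measurable ?J" by simp
  then show ?thesis
    by (rule measurable_cong[THEN iffD1, rotated])
       (use arrival_nonneg[OF R] in \<open>simp add: space_join_algebra\<close>)
qed

text \<open>Campbell's formula samples time and path separately; independence of the counting
  process and \<xi> identifies this with evaluating the path at the arrival time of the same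
  outcome.\<close>

lemma renewal_integral_eq_suminf:
  assumes "prob_space M" and R: "renewal_arrivals M \<theta>" and C: "cadlag_process M \<xi>"
    and ind: "mutually_independent M X \<theta> \<xi>"
  shows "renewal_integral M \<theta> \<xi> \<alpha> = (\<Sum>i. \<integral>\<^sup>+\<omega>. ennreal (exp (- \<alpha> * \<xi> (arrival \<theta> i \<omega>) \<omega>)) \<partial>M)"
proof -
  interpret prob_space M by fact
  let ?N = "process_algebra M (count_space UNIV) {0..} (claim_number \<theta>)" and ?F = "process_algebra M borel {0..} \<xi>"
  note D = mutually_independentD[OF \<open>prob_space M\<close> ind]
  have idF: "(\<lambda>\<omega>. \<omega>) \<in> M \<rightarrow>\<^sub>M ?F"
    using D(3) by (auto simp: subalgebra_def intro!: measurableI dest: sets.sets_into_space)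
  have ar: "arrival \<theta> i \<in> borel_measurable M" for i
    using measurable_from_subalg[OF D(2) measurable_arrival[OF R]] .
  define g where "g p = ennreal (exp (- \<alpha> * \<xi> (max (fst p) 0) (snd p)))" for p
  have g [measurable]: "g \<in> borel_measurable (borel \<Otimes>\<^sub>M ?F)"
    unfolding g_def using measurable_cadlag_process[OF C] by measurable
  have gM: "g \<in> borel_measurable (borel \<Otimes>\<^sub>M M)"
  proof -
    have "(\<lambda>p. (fst p, snd p)) \<in> borel \<Otimes>\<^sub>M M \<rightarrow>\<^sub>M borel \<Otimes>\<^sub>M ?F"
      using idF by measurable
    from measurable_compose[OF this g] show ?thesis by simp
  qed
  have "renewal_integral M \<theta> \<xi> \<alpha> =
      (\<integral>\<^sup>+s. (\<integral>\<^sup>+\<omega>. g (s, \<omega>) \<partial>M) * indicator {0..} s \<partial>renewal_measure M \<theta>)"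
    unfolding renewal_integral_def by (intro nn_integral_cong) (auto simp: g_def max_def split: split_indicator)
  also have "\<dots> = (\<Sum>i. \<integral>\<^sup>+\<omega>'. (\<integral>\<^sup>+\<omega>. g (arrival \<theta> i \<omega>', \<omega>) \<partial>M) * indicator {0..} (arrival \<theta> i \<omega>') \<partial>M)"
    by (rule nn_integral_renewal_measure[OF ar])
       (intro borel_measurable_times_ennreal borel_measurable_nn_integral_fst[OF gM] borel_measurable_indicator, simp)
  also have "\<dots> = (\<Sum>i. \<integral>\<^sup>+\<omega>'. (\<integral>\<^sup>+\<omega>. g (arrival \<theta> i \<omega>', \<omega>) \<partial>M) \<partial>M)"
    using arrival_nonneg[OF R] by (intro arg_cong[where f=suminf] ext nn_integral_cong) (auto simp: indicator_def)
  also have "\<dots> = (\<Sum>i. \<integral>\<^sup>+\<omega>. g (arrival \<theta> i \<omega>, \<omega>) \<partial>M)"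
  proof (intro arg_cong[where f=suminf] ext)
    fix i
    have [measurable]: "arrival \<theta> i \<in> borel_measurable ?N" by (rule measurable_arrival[OF R])
    have "(\<lambda>p. g (arrival \<theta> i (fst p), snd p)) \<in> borel_measurable (?N \<Otimes>\<^sub>M ?F)" by measurable
    from nn_integral_indep_diagonal[OF D(2,3,5) this]
    show "(\<integral>\<^sup>+\<omega>'. (\<integral>\<^sup>+\<omega>. g (arrival \<theta> i \<omega>', \<omega>) \<partial>M) \<partial>M) = (\<integral>\<^sup>+\<omega>. g (arrival \<theta> i \<omega>, \<omega>) \<partial>M)" by simp
  qed
  also have "\<dots> = (\<Sum>i. \<integral>\<^sup>+\<omega>. ennreal (exp (- \<alpha> * \<xi> (arrival \<theta> i \<omega>) \<omega>)) \<partial>M)"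
    using arrival_nonneg[OF R] by (intro arg_cong[where f=suminf] ext nn_integral_cong) (auto simp: g_def)
  finally show ?thesis .
qed

section \<open>Tail bounds for discounted series\<close>

lemma powr_convex_nonneg:
  assumes "p \<ge> 1"
  shows "convex_on {0..} (\<lambda>x::real. x powr p)"
  unfolding convex_on_def
proof (intro conjI ballI allI impI)
  fix x y u v :: real
  assume xy: "x \<in> {0..}" "y \<in> {0..}" and uv: "0 \<le> u" "0 \<le> v" "u + v = 1"
  \<comment> \<open>Where one of the two points is 0, convexity reduces to
    \<open>c powr p \<le> c\<close> for \<open>0 \<le> c \<le> 1\<close>.\<close>
  have zero: "(c * z) powr p \<le> c * z powr p" if "0 \<le> c" "c \<le> 1" "0 \<le> z" for c z :: real
  proof -
    have "(c * z) powr p = c powr p * z powr p" using that by (simp add: powr_mult)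
    also have "c powr p \<le> c powr 1"
      using powr_mono'[of 1 p c] that assms by simp
    finally show ?thesis using that by (simp add: mult_right_mono)
  qed
  show "(u *\<^sub>R x + v *\<^sub>R y) powr p \<le> u * x powr p + v * y powr p"
  proof (cases "x = 0 \<or> y = 0")
    case True
    then show ?thesis using zero[of u x] zero[of v y] xy uv by auto
  next
    case False
    with xy uv powr_convex[OF assms] show ?thesis by (auto simp: convex_on_def)
  qed
qed simp

text \<open>Jensen's inequality with weights proportional to \<open>a\<close>; it replaces Minkowski's inequality.\<close>
lemma powr_sum_le_weighted:
  fixes a w :: "'i \<Rightarrow> real"
  assumes I: "finite I" "I \<noteq> {}" and a: "\<And>i. i \<in> I \<Longrightarrow> a i > 0" and w: "\<And>i. i \<in> I \<Longrightarrow> w i \<ge> 0" and p: "p \<ge> 1"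
  shows "(\<Sum>i\<in>I. w i) powr p \<le> (\<Sum>i\<in>I. a i) powr p * (\<Sum>i\<in>I. a i / (\<Sum>i\<in>I. a i) * (w i powr p / a i powr p))"
proof -
  define S where "S = (\<Sum>i\<in>I. a i)"
  have S: "S > 0" unfolding S_def using I a by (intro sum_pos) auto
  have "(\<Sum>i\<in>I. a i / S * (w i / a i)) = (\<Sum>i\<in>I. w i) / S"
    unfolding sum_divide_distrib using a by (intro sum.cong) (auto simp: less_imp_neq[THEN not_sym])
  then have "(\<Sum>i\<in>I. w i) powr p = (S * (\<Sum>i\<in>I. (a i / S) *\<^sub>R (w i / a i))) powr p"
    using S by simp
  also have "\<dots> = S powr p * (\<Sum>i\<in>I. (a i / S) *\<^sub>R (w i / a i)) powr p"
    using S a w by (subst powr_mult) (auto intro!: sum_nonneg simp: less_imp_le)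
  also have "(\<Sum>i\<in>I. (a i / S) *\<^sub>R (w i / a i)) powr p \<le> (\<Sum>i\<in>I. a i / S * ((w i / a i) powr p))"
  proof (rule convex_on_sum[OF I powr_convex_nonneg[OF p]])
    show "(\<Sum>i\<in>I. a i / S) = 1" using S by (simp add: sum_divide_distrib[symmetric] S_def)
  qed (use a w S in \<open>auto simp: less_imp_le\<close>)
  also have "(\<Sum>i\<in>I. a i / S * ((w i / a i) powr p)) = (\<Sum>i\<in>I. a i / S * (w i powr p / a i powr p))"
    using a w by (intro sum.cong) (auto simp: powr_divide less_imp_le)
  finally show ?thesis using S by (simp add: S_def mult_left_mono)
qed

text \<open>A sum above \<open>x\<close> forces the truncated ratios \<open>W i\<close> to add up to
  at least 1, whether or not a single term exceeds \<open>x\<close>. Markov's inequality of order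
  \<rho> and Jensen's inequality then average normalised moments, each at most \<open>b\<close>. In
  the application \<rho> lies above the tail exponent, so untruncated moments of this order may be
  infinite.\<close>

lemma (in prob_space) prob_partial_sum_exceeds:
  fixes Z :: "nat \<Rightarrow> 'a \<Rightarrow> real" and a :: "nat \<Rightarrow> real"
  assumes [measurable]: "\<And>i. Z i \<in> borel_measurable M" and Z: "\<And>i \<omega>. \<omega> \<in> space M \<Longrightarrow> 0 \<le> Z i \<omega>"
    and x: "x > 0" and \<rho>: "\<rho> \<ge> 1" and a: "\<And>i. a i > 0" "summable a" and b: "b \<ge> 0"
    and moment: "\<And>i. expectation (\<lambda>\<omega>. min (Z i \<omega> / x) 1 powr \<rho>) \<le> b * a i powr \<rho>"
  shows "prob {\<omega> \<in> space M. \<exists>N. x < (\<Sum>i\<in>{n..<N}. Z i \<omega>)} \<le> b * (\<Sum>i. a (i + n)) powr \<rho>"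
proof -
  let ?E = "\<lambda>N. {\<omega> \<in> space M. x < (\<Sum>i\<in>{n..<N}. Z i \<omega>)}"
  define W where "W i \<omega> = min (Z i \<omega> / x) 1" for i \<omega>
  have [measurable]: "W i \<in> borel_measurable M" for i by (simp add: W_def[abs_def])
  have W: "0 \<le> W i \<omega>" "W i \<omega> \<le> 1" if "\<omega> \<in> space M" for i \<omega>
    using Z[OF that] x by (auto simp: W_def)
  have int: "integrable M (\<lambda>\<omega>. W i \<omega> powr \<rho>)" for i
    by (rule integrable_const_bound[of _ 1]) (use W \<rho> in \<open>auto intro!: AE_I2 powr_le1\<close>)
  have fin: "prob (?E N) \<le> b * (\<Sum>i. a (i + n)) powr \<rho>" for N
  proof (cases "n < N")
    case False
    then have eq: "?E N = {}" using x by auto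
    show ?thesis unfolding eq using b by simp
  next
    case True
    let ?I = "{n..<N}"
    define S where "S = (\<Sum>i\<in>?I. a i)"
    have S: "S > 0" unfolding S_def using True a by (intro sum_pos) auto
    have "prob (?E N) = expectation (indicator (?E N))" by simp
    also have "\<dots> \<le> expectation (\<lambda>\<omega>. S powr \<rho> * (\<Sum>i\<in>?I. a i / S * (W i \<omega> powr \<rho> / a i powr \<rho>)))"
    proof (rule integral_mono)
      show "integrable M (\<lambda>\<omega>. S powr \<rho> * (\<Sum>i\<in>?I. a i / S * (W i \<omega> powr \<rho> / a i powr \<rho>)))"
        using int by (intro integrable_mult_right integrable_sum integrable_divide) auto
      fix \<omega> assume \<omega>: "\<omega> \<in> space M"
      have J: "(\<Sum>i\<in>?I. W i \<omega>) powr \<rho> \<le> S powr \<rho> * (\<Sum>i\<in>?I. a i / S * (W i \<omega> powr \<rho> / a i powr \<rho>))"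
        unfolding S_def using True a W[OF \<omega>] \<rho> by (intro powr_sum_le_weighted) auto
      show "indicator (?E N) \<omega> \<le> S powr \<rho> * (\<Sum>i\<in>?I. a i / S * (W i \<omega> powr \<rho> / a i powr \<rho>))"
      proof (cases "\<omega> \<in> ?E N")
        case True
        have "1 \<le> (\<Sum>i\<in>?I. W i \<omega>)"
        proof (cases "\<exists>i\<in>?I. Z i \<omega> > x")
          case True
          then obtain i where "i \<in> ?I" "W i \<omega> = 1" using x by (auto simp: W_def min_def)
          then show ?thesis using member_le_sum[of i ?I "\<lambda>i. W i \<omega>"] W[OF \<omega>] by auto
        next
          case False
          then have "W i \<omega> = Z i \<omega> / x" if "i \<in> ?I" for i
            using that x by (fastforce simp: W_def min_def not_less divide_le_eq)
          then have "(\<Sum>i\<in>?I. W i \<omega>) = (\<Sum>i\<in>?I. Z i \<omega>) / x" by (simp add: sum_divide_distrib)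
          then show ?thesis using True x by simp
        qed
        then have "1 \<le> (\<Sum>i\<in>?I. W i \<omega>) powr \<rho>" using \<rho> by (intro ge_one_powr_ge_zero) auto
        with J True show ?thesis by simp
      next
        case False
        have "0 \<le> (\<Sum>i\<in>?I. W i \<omega>) powr \<rho>" by simp
        also note J
        finally show ?thesis using False by simp
      qed
    qed (auto intro!: integrable_real_indicator simp: emeasure_eq_measure)
    also have "\<dots> = S powr \<rho> * (\<Sum>i\<in>?I. a i / S * (expectation (\<lambda>\<omega>. W i \<omega> powr \<rho>) / a i powr \<rho>))"
      using int by simp
    also have "\<dots> \<le> S powr \<rho> * (\<Sum>i\<in>?I. a i / S * b)"
    proof (intro mult_left_mono sum_mono)
      fix i
      show "expectation (\<lambda>\<omega>. W i \<omega> powr \<rho>) / a i powr \<rho> \<le> b"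
        using moment[of i] a(1)[of i] by (simp add: W_def divide_le_eq)
      show "0 \<le> a i / S" using a(1)[of i] S by simp
    qed simp
    also have "(\<Sum>i\<in>?I. a i / S * b) = b"
      using S by (simp add: sum_distrib_right[symmetric] sum_divide_distrib[symmetric] S_def)
    also have "S powr \<rho> * b \<le> b * (\<Sum>i. a (i + n)) powr \<rho>"
    proof -
      have sn: "summable (\<lambda>i. a (i + n))" using a(2) by (simp add: summable_iff_shift)
      have "S = (\<Sum>i<N - n. a (i + n))"
        unfolding S_def using True
        by (intro sum.reindex_bij_witness[of _ "\<lambda>i. i + n" "\<lambda>i. i - n"]) auto
      also have "\<dots> \<le> (\<Sum>i. a (i + n))" using sn a(1) by (intro sum_le_suminf) (auto simp: less_imp_le)
      finally show ?thesis using S \<rho> b by (simp add: mult.commute mult_left_mono powr_mono2)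
    qed
    finally show ?thesis .
  qed
  have inc: "incseq ?E"
  proof (rule incseq_SucI)
    fix N
    show "?E N \<subseteq> ?E (Suc N)"
    proof safe
      fix \<omega> assume \<omega>: "\<omega> \<in> space M" "x < (\<Sum>i\<in>{n..<N}. Z i \<omega>)"
      have "(\<Sum>i\<in>{n..<N}. Z i \<omega>) \<le> (\<Sum>i\<in>{n..<Suc N}. Z i \<omega>)"
        using Z[OF \<omega>(1)] by (intro sum_mono2) auto
      with \<omega> show "x < (\<Sum>i\<in>{n..<Suc N}. Z i \<omega>)" by simp
    qed
  qed
  \<comment> \<open>The bound is uniform in \<open>N\<close>, so continuity from below carries it to
    the whole series.\<close>
  have "(\<lambda>N. prob (?E N)) \<longlonglongrightarrow> prob (\<Union>N. ?E N)"
    by (rule finite_Lim_measure_incseq[OF _ inc]) auto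
  then have "prob (\<Union>N. ?E N) \<le> b * (\<Sum>i. a (i + n)) powr \<rho>"
    by (rule tendsto_upperbound) (use fin in auto)
  moreover have "(\<Union>N. ?E N) = {\<omega> \<in> space M. \<exists>N. x < (\<Sum>i\<in>{n..<N}. Z i \<omega>)}" by auto
  ultimately show ?thesis by simp
qed

lemma min_powr_le_dyadic:
  fixes z x \<rho> :: real
  assumes "z \<ge> 0" "x > 0" "\<rho> \<ge> 0"
  obtains k :: nat where "min (z / x) 1 powr \<rho> \<le> (2 powr (-\<rho>)) ^ k * indicator {z. x / 2 ^ Suc k < z} z"
proof -
  consider "z = 0" | "z \<ge> x" | "0 < z" "z < x" using assms by linarith
  then show ?thesis
  proof cases
    case 1
    then show ?thesis using that[of 0] by simp
  next
    case 2
    then have "x / 2 ^ Suc 0 < z" using assms by simp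
    then show ?thesis using 2 that[of 0] assms by (simp add: min_def)
  next
    case 3
    then have "x / z \<ge> 1" by simp
    then obtain k where k: "2 ^ k \<le> x / z" "x / z < 2 ^ Suc k"
      using powr_between[of 2 "x / z"] by auto
    have "z / x \<le> 1 / 2 ^ k" "x / 2 ^ Suc k < z" using k 3 assms by (auto simp: field_simps)
    moreover from this have "(z / x) powr \<rho> \<le> (1 / 2 ^ k) powr \<rho>"
      using 3 assms by (intro powr_mono2) auto
    moreover have "(1 / 2 ^ k) powr \<rho> = (2 powr (-\<rho>)) ^ k"
    proof -
      have "(1 / 2 ^ k) powr \<rho> = (2 powr - real k) powr \<rho>" by (simp add: powr_minus_divide powr_realpow)
      also have "\<dots> = (2 powr (-\<rho>)) powr real k" by (simp add: powr_powr mult.commute)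
      also have "\<dots> = (2 powr (-\<rho>)) ^ k" by (rule powr_realpow) simp
      finally show ?thesis .
    qed
    ultimately show ?thesis using 3 that[of k] by (simp add: min_def)
  qed
qed

text \<open>The dyadic levels contribute a geometric series of ratio
  \<open>2 powr (q - \<rho>)\<close>, which converges because the tail exponent lies below the order
  of the moment. The factor \<open>2 powr q\<close> stems from the offset in
  \<open>Suc k\<close>.\<close>

lemma (in prob_space) truncated_moment_le:
  fixes Z :: "'a \<Rightarrow> real"
  assumes [measurable]: "Z \<in> borel_measurable M" and Z: "\<And>\<omega>. \<omega> \<in> space M \<Longrightarrow> 0 \<le> Z \<omega>"
    and x: "x > 0" and q: "q < \<rho>" "0 \<le> \<rho>" and c: "c \<ge> 0"
    and tail: "\<And>k. prob {\<omega> \<in> space M. x / 2 ^ Suc k < Z \<omega>} \<le> c * (2 ^ Suc k) powr q"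
  shows "expectation (\<lambda>\<omega>. min (Z \<omega> / x) 1 powr \<rho>) \<le> c * (2 powr q / (1 - 2 powr (q - \<rho>)))"
proof -
  define r where "r = 2 powr (-\<rho>)"
  define s where "s = 2 powr (q - \<rho>)"
  have s: "0 < s" "s < 1" using q by (auto simp: s_def powr_less_one)
  have summand: "ennreal (r ^ k) * emeasure M {\<omega> \<in> space M. x / 2 ^ Suc k < Z \<omega>} \<le> ennreal (c * 2 powr q * s ^ k)" for k
  proof -
    have "r ^ k * prob {\<omega> \<in> space M. x / 2 ^ Suc k < Z \<omega>} \<le> r ^ k * (c * (2 ^ Suc k) powr q)"
      by (intro mult_left_mono tail) (simp add: r_def)
    also have "\<dots> = c * 2 powr q * s ^ k"
    proof -
      have "(2 ^ Suc k :: real) powr q = 2 powr q * (2 powr q) ^ k"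
        by (simp add: powr_mult powr_powr powr_realpow[symmetric] mult.commute)
      moreover have "s ^ k = r ^ k * (2 powr q) ^ k"
        by (simp add: s_def r_def powr_diff powr_minus power_mult_distrib[symmetric] divide_inverse mult.commute)
      ultimately show ?thesis by simp
    qed
    finally show ?thesis
      by (simp add: emeasure_eq_measure r_def ennreal_mult'[symmetric] ennreal_leI)
  qed
  have "(\<integral>\<^sup>+\<omega>. ennreal (min (Z \<omega> / x) 1 powr \<rho>) \<partial>M) \<le>
      (\<integral>\<^sup>+\<omega>. (\<Sum>k. ennreal (r ^ k) * indicator {\<omega> \<in> space M. x / 2 ^ Suc k < Z \<omega>} \<omega>) \<partial>M)"
  proof (rule nn_integral_mono)
    fix \<omega> assume \<omega>: "\<omega> \<in> space M"
    obtain k where "min (Z \<omega> / x) 1 powr \<rho> \<le> r ^ k * indicator {z. x / 2 ^ Suc k < z} (Z \<omega>)"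
      unfolding r_def using Z[OF \<omega>] x q(2) by (rule min_powr_le_dyadic)
    then have "ennreal (min (Z \<omega> / x) 1 powr \<rho>) \<le> ennreal (r ^ k) * indicator {\<omega> \<in> space M. x / 2 ^ Suc k < Z \<omega>} \<omega>"
      using \<omega> by (auto simp: indicator_def ennreal_leI)
    also have "\<dots> \<le> (\<Sum>k. ennreal (r ^ k) * indicator {\<omega> \<in> space M. x / 2 ^ Suc k < Z \<omega>} \<omega>)"
      using sum_le_suminf[of "\<lambda>k. ennreal (r ^ k) * indicator {\<omega> \<in> space M. x / 2 ^ Suc k < Z \<omega>} \<omega>" "{k}"]
      by (simp only: sum.insert finite.emptyI sum.empty finite.insertI summableI empty_iff not_False_eq_True add_0_right zero_le simp_thms)
    finally show "ennreal (min (Z \<omega> / x) 1 powr \<rho>) \<le> \<dots>" .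
  qed
  also have "\<dots> = (\<Sum>k. ennreal (r ^ k) * emeasure M {\<omega> \<in> space M. x / 2 ^ Suc k < Z \<omega>})"
    by (subst nn_integral_suminf) (auto simp: nn_integral_cmult_indicator)
  also have "\<dots> \<le> (\<Sum>k. ennreal (c * 2 powr q * s ^ k))"
    by (intro suminf_le summand) auto
  also have "\<dots> = ennreal (\<Sum>k. c * 2 powr q * s ^ k)"
    using s c by (intro suminf_ennreal2) (auto intro!: summable_mult)
  also have "(\<Sum>k. c * 2 powr q * s ^ k) = c * (2 powr q / (1 - s))"
    using s by (subst suminf_mult) (auto simp: suminf_geometric)
  finally have le: "(\<integral>\<^sup>+\<omega>. ennreal (min (Z \<omega> / x) 1 powr \<rho>) \<partial>M) \<le> ennreal (c * (2 powr q / (1 - s)))" .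
  have "expectation (\<lambda>\<omega>. min (Z \<omega> / x) 1 powr \<rho>) = enn2real (\<integral>\<^sup>+\<omega>. ennreal (min (Z \<omega> / x) 1 powr \<rho>) \<partial>M)"
    by (rule integral_eq_nn_integral) auto
  also have "\<dots> \<le> c * (2 powr q / (1 - s))"
    using enn2real_mono[OF le] c s by simp
  finally show ?thesis by (simp add: s_def)
qed

section \<open>Discounted series under a Potter bound\<close>

lemma (in prob_space) prob_indep_diagonal:
  assumes F1: "subalgebra M F1" and F2: "subalgebra M F2"
    and indep: "indep_set (sets F1) (sets F2)"
    and P [measurable]: "Measurable.pred (F1 \<Otimes>\<^sub>M F2) (\<lambda>p. P (fst p) (snd p))"
  shows "prob {\<omega> \<in> space M. P \<omega> \<omega>} = expectation (\<lambda>\<omega>1. prob {\<omega>2 \<in> space M. P \<omega>1 \<omega>2})"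
    and "(\<lambda>\<omega>1. prob {\<omega>2 \<in> space M. P \<omega>1 \<omega>2}) \<in> borel_measurable M"
proof -
  have sp: "space F1 = space M" "space F2 = space M" using F1 F2 by (auto simp: subalgebra_def)
  have idm: "(\<lambda>p. (fst p, snd p)) \<in> M \<Otimes>\<^sub>M M \<rightarrow>\<^sub>M F1 \<Otimes>\<^sub>M F2"
    using F1 F2 by (intro measurable_Pair measurable_from_subalg[THEN measurable_compose[OF measurable_fst]]
        measurable_compose[OF measurable_fst] measurable_compose[OF measurable_snd])
      (auto simp: subalgebra_def intro!: measurableI dest: sets.sets_into_space)
  define S where "S = {p \<in> space (F1 \<Otimes>\<^sub>M F2). P (fst p) (snd p)}"
  have S [measurable]: "S \<in> sets (F1 \<Otimes>\<^sub>M F2)" unfolding S_def by measurable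
  have ind: "indicator S \<in> borel_measurable (M \<Otimes>\<^sub>M M)"
    using measurable_compose[OF idm borel_measurable_indicator[OF S]] by simp
  have T: "{\<omega> \<in> space M. P \<omega> \<omega>} \<in> sets M"
  proof -
    have "(\<lambda>\<omega>. (\<omega>, \<omega>)) \<in> M \<rightarrow>\<^sub>M F1 \<Otimes>\<^sub>M F2"
      using F1 F2 by (intro measurable_Pair)
        (auto simp: subalgebra_def intro!: measurableI dest: sets.sets_into_space)
    from measurable_sets[OF this S] show ?thesis
      by (rule back_subst[of "\<lambda>A. A \<in> sets M"]) (auto simp: S_def space_pair_measure sp)
  qed
  have T2: "{\<omega>2 \<in> space M. P \<omega>1 \<omega>2} \<in> sets M" if "\<omega>1 \<in> space M" for \<omega>1
  proof -
    have "(\<lambda>\<omega>2. (\<omega>1, \<omega>2)) \<in> M \<rightarrow>\<^sub>M F1 \<Otimes>\<^sub>M F2"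
      using F1 F2 that by (intro measurable_Pair)
        (auto simp: subalgebra_def intro!: measurableI dest: sets.sets_into_space)
    from measurable_sets[OF this S] show ?thesis
      by (rule back_subst[of "\<lambda>A. A \<in> sets M"]) (use that in \<open>auto simp: S_def space_pair_measure sp\<close>)
  qed
  have inner: "(\<integral>\<^sup>+\<omega>2. indicator S (\<omega>1, \<omega>2) \<partial>M) = ennreal (prob {\<omega>2 \<in> space M. P \<omega>1 \<omega>2})" if "\<omega>1 \<in> space M" for \<omega>1
  proof -
    have "(\<integral>\<^sup>+\<omega>2. indicator S (\<omega>1, \<omega>2) \<partial>M) = (\<integral>\<^sup>+\<omega>2. indicator {\<omega>2 \<in> space M. P \<omega>1 \<omega>2} \<omega>2 \<partial>M)"
      by (rule nn_integral_cong) (use that in \<open>auto simp: S_def space_pair_measure sp indicator_def\<close>)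
    then show ?thesis using T2[OF that] by (simp add: emeasure_eq_measure)
  qed
  show meas: "(\<lambda>\<omega>1. prob {\<omega>2 \<in> space M. P \<omega>1 \<omega>2}) \<in> borel_measurable M"
  proof -
    have "(\<lambda>\<omega>1. enn2real (\<integral>\<^sup>+\<omega>2. indicator S (\<omega>1, \<omega>2) \<partial>M)) \<in> borel_measurable M"
      using borel_measurable_nn_integral_fst[OF ind] by measurable
    then show ?thesis by (rule measurable_cong[THEN iffD1, rotated]) (simp add: inner)
  qed
  have "ennreal (prob {\<omega> \<in> space M. P \<omega> \<omega>}) = (\<integral>\<^sup>+\<omega>. indicator {\<omega> \<in> space M. P \<omega> \<omega>} \<omega> \<partial>M)"
    using T by (simp add: emeasure_eq_measure)
  also have "\<dots> = (\<integral>\<^sup>+\<omega>. indicator S (\<omega>, \<omega>) \<partial>M)"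
    by (rule nn_integral_cong) (auto simp: S_def space_pair_measure sp indicator_def)
  also have "\<dots> = (\<integral>\<^sup>+\<omega>1. \<integral>\<^sup>+\<omega>2. indicator S (\<omega>1, \<omega>2) \<partial>M \<partial>M)"
    by (rule nn_integral_indep_diagonal[OF F1 F2 indep]) measurable
  also have "\<dots> = (\<integral>\<^sup>+\<omega>1. ennreal (prob {\<omega>2 \<in> space M. P \<omega>1 \<omega>2}) \<partial>M)"
    by (rule nn_integral_cong) (rule inner)
  also have "\<dots> = ennreal (expectation (\<lambda>\<omega>1. prob {\<omega>2 \<in> space M. P \<omega>1 \<omega>2}))"
    by (rule nn_integral_eq_integral) (auto intro!: integrable_const_bound[of _ 1] meas)
  finally show "prob {\<omega> \<in> space M. P \<omega> \<omega>} = expectation (\<lambda>\<omega>1. prob {\<omega>2 \<in> space M. P \<omega>1 \<omega>2})"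
    by (simp add: integral_nonneg)
qed

text \<open>\<open>F1\<close> carries the discount factors, \<open>F2\<close> the claims. The bound
  \<open>q \<le> p2\<close> gives moments of order \<open>q\<close> by interpolation, and
  \<open>q < \<rho>\<close> gives convergence of the dyadic sums. \<rho> is separate from
  \<open>p2\<close> because it is 1 when the upper index is below 1.\<close>

locale discounted_claims_model = prob_space M for M :: "'w measure" +
  fixes F1 F2 :: "'w measure" and \<Theta> :: "nat \<Rightarrow> 'w \<Rightarrow> real" and f :: "real \<Rightarrow> real"
    and p q p2 \<rho> C D :: real
  assumes F1: "subalgebra M F1" and F2: "subalgebra M F2"
    and indep: "indep_set (sets F1) (sets F2)"
    and \<Theta>_meas_F1: "\<And>i. \<Theta> i \<in> borel_measurable F1"
    and \<Theta>_pos: "\<And>i \<omega>. \<Theta> i \<omega> > 0"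
    and f_pos: "\<And>x. f x > 0" and f_anti: "antimono f"
    and exponents: "0 < p" "p \<le> q" "q \<le> p2" "q < \<rho>" "1 \<le> \<rho>"
    and CD: "0 < C" "0 < D"
    and Potter: "\<And>x \<theta>. x \<ge> D \<Longrightarrow> \<theta> > 0 \<Longrightarrow> f (x / \<theta>) \<le> C * (\<theta> powr p + \<theta> powr q) * f x"
    and int_p: "\<And>i. integrable M (\<lambda>\<omega>. \<Theta> i \<omega> powr p)"
    and int_p2: "\<And>i. integrable M (\<lambda>\<omega>. \<Theta> i \<omega> powr p2)"
    and summable_moments: "summable (\<lambda>i. max (expectation (\<lambda>\<omega>. \<Theta> i \<omega> powr p))
      (expectation (\<lambda>\<omega>. \<Theta> i \<omega> powr p2)) powr (1 / \<rho>))"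
begin

definition mom :: "nat \<Rightarrow> real" where
  "mom i = max (expectation (\<lambda>\<omega>. \<Theta> i \<omega> powr p)) (expectation (\<lambda>\<omega>. \<Theta> i \<omega> powr p2))"

lemma \<Theta>_meas [measurable]: "\<Theta> i \<in> borel_measurable M"
  by (rule measurable_from_subalg[OF F1 \<Theta>_meas_F1])

text \<open>Strict positivity matters because roots of these moments become weights in Jensen's
  inequality, where they are divided by.\<close>

lemma mom_pos: "mom i > 0"
proof -
  have "expectation (\<lambda>_. 0) < expectation (\<lambda>\<omega>. \<Theta> i \<omega> powr p)"
  proof (rule integral_less_AE_space)
    show "AE \<omega> in M. 0 < \<Theta> i \<omega> powr p" using \<Theta>_pos[of i] by (auto simp: less_imp_neq[THEN not_sym])
  qed (use int_p emeasure_space_1 in auto)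
  then show ?thesis by (simp add: mom_def)
qed

lemma powr_q_le: "\<theta> > 0 \<Longrightarrow> \<theta> powr q \<le> \<theta> powr p + \<theta> powr p2" for \<theta> :: real
proof (cases "\<theta> \<le> 1")
  case True
  assume "\<theta> > 0"
  then have "\<theta> powr q \<le> \<theta> powr p" using powr_mono'[of p q \<theta>] True exponents by simp
  then show ?thesis by (simp add: add_increasing2)
next
  case False
  then have "\<theta> powr q \<le> \<theta> powr p2" using powr_mono[of q p2 \<theta>] exponents by simp
  then show ?thesis by (simp add: add_increasing)
qed

lemma int_q: "integrable M (\<lambda>\<omega>. \<Theta> i \<omega> powr q)"
  by (rule Bochner_Integration.integrable_bound[of _ "\<lambda>\<omega>. \<Theta> i \<omega> powr p + \<Theta> i \<omega> powr p2"])
     (use int_p int_p2 powr_q_le \<Theta>_pos in auto)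

lemma expectation_q_le: "expectation (\<lambda>\<omega>. \<Theta> i \<omega> powr q) \<le> 2 * mom i"
proof -
  have "expectation (\<lambda>\<omega>. \<Theta> i \<omega> powr q) \<le> expectation (\<lambda>\<omega>. \<Theta> i \<omega> powr p + \<Theta> i \<omega> powr p2)"
    by (rule integral_mono) (use int_p int_p2 int_q powr_q_le \<Theta>_pos in auto)
  also have "\<dots> \<le> 2 * mom i" using int_p int_p2 by (simp add: mom_def)
  finally show ?thesis .
qed

lemma prob_discounted_exceeds:
  fixes V :: "'w \<Rightarrow> real"
  assumes V [measurable]: "V \<in> borel_measurable F2"
  shows "prob {\<omega> \<in> space M. x < c * \<Theta> i \<omega> * V \<omega>}
      = expectation (\<lambda>\<omega>1. prob {\<omega>2 \<in> space M. x < c * \<Theta> i \<omega>1 * V \<omega>2})"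
    and "(\<lambda>\<omega>1. prob {\<omega>2 \<in> space M. x < c * \<Theta> i \<omega>1 * V \<omega>2}) \<in> borel_measurable M"
proof -
  note [measurable] = \<Theta>_meas_F1
  have "Measurable.pred (F1 \<Otimes>\<^sub>M F2) (\<lambda>p. x < c * \<Theta> i (fst p) * V (snd p))" by measurable
  from prob_indep_diagonal[OF F1 F2 indep this]
  show "prob {\<omega> \<in> space M. x < c * \<Theta> i \<omega> * V \<omega>}
      = expectation (\<lambda>\<omega>1. prob {\<omega>2 \<in> space M. x < c * \<Theta> i \<omega>1 * V \<omega>2})"
    "(\<lambda>\<omega>1. prob {\<omega>2 \<in> space M. x < c * \<Theta> i \<omega>1 * V \<omega>2}) \<in> borel_measurable M" by auto
qed

text \<open>With the discount factor frozen, Potter's bound applies with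
  \<open>c * \<Theta> i \<omega>1\<close> in the role of \<theta>; the dilation \<open>c\<close>
  will be a power of 2.\<close>

lemma prob_discounted_exceeds_le:
  fixes V :: "'w \<Rightarrow> real"
  assumes V [measurable]: "V \<in> borel_measurable F2" and B: "B \<ge> 0"
    and tail: "\<And>u. u > 0 \<Longrightarrow> prob {\<omega> \<in> space M. u < V \<omega>} \<le> B * f u"
    and c: "c \<ge> 1" and x: "x \<ge> D"
  shows "prob {\<omega> \<in> space M. x < c * \<Theta> i \<omega> * V \<omega>} \<le> 3 * B * C * f x * mom i * c powr q"
proof -
  have "prob {\<omega> \<in> space M. x < c * \<Theta> i \<omega> * V \<omega>}
      = expectation (\<lambda>\<omega>1. prob {\<omega>2 \<in> space M. x < c * \<Theta> i \<omega>1 * V \<omega>2})"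
    by (rule prob_discounted_exceeds[OF V])
  also have "\<dots> \<le> expectation (\<lambda>\<omega>1. B * C * f x * (c powr p * \<Theta> i \<omega>1 powr p + c powr q * \<Theta> i \<omega>1 powr q))"
  proof (rule integral_mono)
    show "integrable M (\<lambda>\<omega>1. prob {\<omega>2 \<in> space M. x < c * \<Theta> i \<omega>1 * V \<omega>2})"
      by (rule integrable_const_bound[of _ 1]) (use prob_discounted_exceeds(2)[OF V] in auto)
    show "integrable M (\<lambda>\<omega>1. B * C * f x * (c powr p * \<Theta> i \<omega>1 powr p + c powr q * \<Theta> i \<omega>1 powr q))"
      using int_p int_q by auto
    fix \<omega>1
    have pos: "c * \<Theta> i \<omega>1 > 0" using c \<Theta>_pos[of i \<omega>1] by simp
    then have "{\<omega>2 \<in> space M. x < c * \<Theta> i \<omega>1 * V \<omega>2} = {\<omega>2 \<in> space M. x / (c * \<Theta> i \<omega>1) < V \<omega>2}"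
      by (simp add: pos_divide_less_eq mult.commute)
    then have "prob {\<omega>2 \<in> space M. x < c * \<Theta> i \<omega>1 * V \<omega>2} \<le> B * f (x / (c * \<Theta> i \<omega>1))"
      using tail[of "x / (c * \<Theta> i \<omega>1)"] pos x CD by simp
    also have "\<dots> \<le> B * (C * ((c * \<Theta> i \<omega>1) powr p + (c * \<Theta> i \<omega>1) powr q) * f x)"
      by (intro mult_left_mono Potter x pos B)
    also have "\<dots> = B * C * f x * (c powr p * \<Theta> i \<omega>1 powr p + c powr q * \<Theta> i \<omega>1 powr q)"
      using c \<Theta>_pos[of i \<omega>1] by (simp add: powr_mult)
    finally show "prob {\<omega>2 \<in> space M. x < c * \<Theta> i \<omega>1 * V \<omega>2} \<le> \<dots>" .
  qed
  also have "\<dots> = B * C * f x * (c powr p * expectation (\<lambda>\<omega>. \<Theta> i \<omega> powr p) + c powr q * expectation (\<lambda>\<omega>. \<Theta> i \<omega> powr q))"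
    using int_p int_q by simp
  \<comment> \<open>Origin of the constant 3: one \<open>mom i\<close> from order \<open>p\<close>
    and two from order \<open>q\<close>. Since \<open>c \<ge> 1\<close>, \<open>c powr p\<close> is
    at most \<open>c powr q\<close>.\<close>
  also have "\<dots> \<le> B * C * f x * (c powr q * mom i + c powr q * (2 * mom i))"
  proof (intro mult_left_mono add_mono)
    show "c powr p * expectation (\<lambda>\<omega>. \<Theta> i \<omega> powr p) \<le> c powr q * mom i"
      using c exponents by (intro mult_mono powr_mono) (auto simp: mom_def)
    show "0 \<le> B * C * f x" using B CD f_pos[of x] by simp
  qed (use expectation_q_le in auto)
  finally show ?thesis by (simp add: algebra_simps)
qed

text \<open>The summand of the moment condition itself. Its power of order \<rho> is the moment, so
  the weights in Jensen's inequality are summable by assumption.\<close>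

definition weight :: "nat \<Rightarrow> real" where "weight i = mom i powr (1 / \<rho>)"

lemma weight: "weight i > 0" "weight i powr \<rho> = mom i" "summable weight"
proof -
  show "weight i > 0" "weight i powr \<rho> = mom i"
    using mom_pos[of i] exponents by (auto simp: weight_def powr_powr)
  show "summable weight" using summable_moments by (simp add: weight_def[abs_def] mom_def)
qed

definition series_const :: real where
  "series_const = 3 * C * (2 powr q / (1 - 2 powr (q - \<rho>)))"

lemma series_const_nonneg: "series_const \<ge> 0"
  using CD exponents powr_less_one[of 2 "q - \<rho>"] by (simp add: series_const_def)

text \<open>The factor \<open>B\<close> allows a second use with the norms of the claims, whose tail
  is only bounded by a multiple of \<open>f\<close>.\<close>

lemma prob_series_exceeds_le:
  fixes V :: "nat \<Rightarrow> 'w \<Rightarrow> real"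
  assumes V: "\<And>i. V i \<in> borel_measurable F2" "\<And>i \<omega>. 0 \<le> V i \<omega>" and B: "B \<ge> 0"
    and tail: "\<And>i u. u > 0 \<Longrightarrow> prob {\<omega> \<in> space M. u < V i \<omega>} \<le> B * f u"
    and x: "x \<ge> D"
  shows "prob {\<omega> \<in> space M. \<exists>N. x < (\<Sum>i\<in>{n..<N}. \<Theta> i \<omega> * V i \<omega>)}
    \<le> series_const * B * f x * (\<Sum>i. weight (i + n)) powr \<rho>"
proof (rule prob_partial_sum_exceeds)
  show m: "(\<lambda>\<omega>. \<Theta> i \<omega> * V i \<omega>) \<in> borel_measurable M" for i
    using measurable_from_subalg[OF F2 V(1)] by measurable
  show "0 \<le> \<Theta> i \<omega> * V i \<omega>" for i \<omega> using \<Theta>_pos[of i \<omega>] V(2)[of i \<omega>] by simp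
  show x0: "x > 0" using x CD by simp
  show "0 \<le> series_const * B * f x" using series_const_nonneg B f_pos[of x] by simp
  fix i
  have "expectation (\<lambda>\<omega>. min (\<Theta> i \<omega> * V i \<omega> / x) 1 powr \<rho>)
      \<le> 3 * B * C * f x * mom i * (2 powr q / (1 - 2 powr (q - \<rho>)))"
  proof (rule truncated_moment_le[OF m])
    show "0 \<le> 3 * B * C * f x * mom i" using B CD f_pos[of x] mom_pos[of i] by simp
    fix k
    \<comment> \<open>The dyadic factor moves from \<open>x\<close> to the discount factor: Potter's
      bound holds for all \<open>\<theta> > 0\<close> but only for \<open>x \<ge> D\<close>, and
      \<open>x / 2 ^ Suc k\<close> eventually leaves that range.\<close>
    have "{\<omega> \<in> space M. x / 2 ^ Suc k < \<Theta> i \<omega> * V i \<omega>} = {\<omega> \<in> space M. x < 2 ^ Suc k * \<Theta> i \<omega> * V i \<omega>}"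
      by (simp add: pos_divide_less_eq mult.commute mult.left_commute)
    then show "prob {\<omega> \<in> space M. x / 2 ^ Suc k < \<Theta> i \<omega> * V i \<omega>} \<le> 3 * B * C * f x * mom i * (2 ^ Suc k) powr q"
      using prob_discounted_exceeds_le[OF V(1) B tail _ x, of "2 ^ Suc k" i i] one_le_power[of "2 :: real" "Suc k"]
      by simp
  qed (use exponents x0 \<Theta>_pos V(2) in \<open>auto simp: less_imp_le\<close>)
  then show "expectation (\<lambda>\<omega>. min (\<Theta> i \<omega> * V i \<omega> / x) 1 powr \<rho>) \<le> series_const * B * f x * weight i powr \<rho>"
    by (simp add: weight series_const_def mult_ac)
qed (use exponents weight in auto)

end

section \<open>The single big jump\<close>

lemma (in prob_space) prob_Union_ge_Bonferroni:
  fixes A :: "nat \<Rightarrow> 'a set"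
  assumes A: "\<And>i. A i \<in> events"
  shows "(\<Sum>i<n. prob (A i)) - (\<Sum>j<n. \<Sum>i<j. prob (A i \<inter> A j)) \<le> prob (\<Union>i<n. A i)"
proof (induction n)
  case (Suc n)
  have U: "(\<Union>i<n. A i) \<in> events" using A by auto
  have "prob ((\<Union>i<n. A i) \<inter> A n) = prob (\<Union>i<n. A i \<inter> A n)" by (simp add: Int_UN_distrib2)
  also have "\<dots> \<le> (\<Sum>i<n. prob (A i \<inter> A n))"
    by (rule finite_measure_subadditive_finite) (use A in auto)
  finally have "prob ((\<Union>i<n. A i) \<inter> A n) \<le> (\<Sum>i<n. prob (A i \<inter> A n))" .
  moreover have "prob (\<Union>i<Suc n. A i) = prob (\<Union>i<n. A i) + prob (A n) - prob ((\<Union>i<n. A i) \<inter> A n)"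
  proof -
    have "(\<Union>i<Suc n. A i) = (\<Union>i<n. A i) \<union> A n" by (auto simp: less_Suc_eq)
    moreover have "prob ((\<Union>i<n. A i) \<union> A n) = prob (\<Union>i<n. A i) + prob (A n - (\<Union>i<n. A i))"
      by (rule finite_measure_Union') (use A U in auto)
    moreover have "prob (A n - (\<Union>i<n. A i)) = prob (A n) - prob (A n \<inter> (\<Union>i<n. A i))"
      by (rule finite_measure_Diff') (use A U in auto)
    ultimately show ?thesis by (simp add: Int_commute)
  qed
  ultimately show ?case using Suc by simp
qed simp

text \<open>Some term exceeds \<open>x / n\<close>. If no other term passes
  \<open>d / n * x\<close>, the others add up to at most \<open>d * x\<close>, which leaves more
  than \<open>(1 - d) * x\<close> for this one.\<close>

lemma sum_exceeds_cases:
  fixes z :: "nat \<Rightarrow> real"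
  assumes z: "\<And>i. i < n \<Longrightarrow> 0 \<le> z i" and x: "x > 0" and d: "0 < d" "d < 1" and s: "x < (\<Sum>i<n. z i)"
  shows "(\<exists>i<n. (1 - d) * x < z i) \<or> (\<exists>i<n. \<exists>j\<in>{..<n} - {i}. d / n * x < z i \<and> d / n * x < z j)"
proof (rule ccontr)
  assume c: "\<not> ?thesis"
  have n: "n > 0" using s x by (cases n) auto
  have "\<exists>i<n. x / n < z i"
  proof (rule ccontr)
    assume "\<not> (\<exists>i<n. x / n < z i)"
    then have "(\<Sum>i<n. z i) \<le> (\<Sum>i<n. x / n)" by (intro sum_mono) (metis lessThan_iff not_less)
    with s n show False by simp
  qed
  then obtain i where i: "i < n" "x / n < z i" by blast
  have "d / n * x < x / n * 1" using d x n by (simp add: field_simps)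
  with i have di: "d / n * x < z i" by simp
  have c': "\<And>i. i < n \<Longrightarrow> z i \<le> (1 - d) * x"
    "\<And>i j. i < n \<Longrightarrow> j \<in> {..<n} - {i} \<Longrightarrow> d / n * x < z i \<Longrightarrow> z j \<le> d / n * x"
    using c not_less by blast+
  have "z i \<le> (1 - d) * x" using c'(1) i by simp
  moreover have "(\<Sum>j\<in>{..<n} - {i}. z j) \<le> (\<Sum>j\<in>{..<n} - {i}. d / n * x)"
    using c'(2)[OF i(1) _ di] by (intro sum_mono)
  moreover have "(\<Sum>j\<in>{..<n} - {i}. d / n * x) \<le> d * x"
  proof -
    have "(\<Sum>j\<in>{..<n} - {i}. d / n * x) = real (n - 1) * (d / n * x)" using i by simp
    also have "\<dots> \<le> real n * (d / n * x)" using d x by (intro mult_right_mono) auto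
    finally show ?thesis using n by simp
  qed
  moreover have "(\<Sum>i<n. z i) = z i + (\<Sum>j\<in>{..<n} - {i}. z j)"
    using i by (intro sum.remove) auto
  ultimately show False using s by (simp add: algebra_simps)
qed

text \<open>\<open>f\<close> is the common tail of the reduced claims and \<open>g\<close> the
  reference tail. Positivity of \<kappa> makes them comparable, so that \<open>f\<close> inherits
  regular variation and joint exceedances are negligible against \<open>g\<close> too.\<close>

locale regular_claims_model = discounted_claims_model +
  fixes V :: "nat \<Rightarrow> 'a \<Rightarrow> real" and g :: "real \<Rightarrow> real" and \<alpha> \<kappa> :: real
  assumes V_meas_F2: "\<And>i. V i \<in> borel_measurable F2" and V_nonneg: "\<And>i \<omega>. 0 \<le> V i \<omega>"
    and V_tail: "\<And>i u. u > 0 \<Longrightarrow> prob {\<omega> \<in> space M. u < V i \<omega>} = f u"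
    and g_pos: "\<And>x. g x > 0"
    and g_regular: "\<And>y. y > 0 \<Longrightarrow> ((\<lambda>x. g (y * x) / g x) \<longlongrightarrow> y powr (-\<alpha>)) at_top"
    and \<kappa>: "\<kappa> > 0" "((\<lambda>x. f x / g x) \<longlongrightarrow> \<kappa>) at_top"
    and pairs: "\<And>i j. i \<noteq> j \<Longrightarrow>
      ((\<lambda>x. prob {\<omega> \<in> space M. x < V i \<omega> \<and> x < V j \<omega>} / f x) \<longlongrightarrow> 0) at_top"
begin

definition Z :: "nat \<Rightarrow> 'a \<Rightarrow> real" where "Z i \<omega> = \<Theta> i \<omega> * V i \<omega>"

lemma V_meas [measurable]: "V i \<in> borel_measurable M"
  by (rule measurable_from_subalg[OF F2 V_meas_F2])

lemma Z_meas [measurable]: "Z i \<in> borel_measurable M"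
  unfolding Z_def by measurable

lemma Z_nonneg: "0 \<le> Z i \<omega>"
  using \<Theta>_pos[of i \<omega>] V_nonneg[of i \<omega>] by (simp add: Z_def)

lemma filterlim_scale: "c > 0 \<Longrightarrow> filterlim (\<lambda>x::real. c * x) at_top at_top"
  by (rule filterlim_tendsto_pos_mult_at_top[OF tendsto_const _ filterlim_ident])

lemma scaled_limit:
  assumes P: "((\<lambda>x. P x / g x) \<longlongrightarrow> L) at_top" and c: "c > 0"
  shows "((\<lambda>x. P (c * x) / g x) \<longlongrightarrow> L * c powr (-\<alpha>)) at_top"
proof -
  have "((\<lambda>x. P (c * x) / g (c * x) * (g (c * x) / g x)) \<longlongrightarrow> L * c powr (-\<alpha>)) at_top"
    by (intro tendsto_mult g_regular c filterlim_compose[OF P filterlim_scale])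
  then show ?thesis using g_pos by (simp add: less_imp_neq[THEN not_sym])
qed

lemma f_scaled:
  assumes "\<theta> > 0"
  shows "((\<lambda>x. f (x / \<theta>) / g x) \<longlongrightarrow> \<kappa> * \<theta> powr \<alpha>) at_top"
  using scaled_limit[OF \<kappa>(2), of "inverse \<theta>"] assms
  by (simp add: divide_inverse mult.commute powr_minus inverse_powr)

lemma ratio_bound: "\<forall>\<^sub>F x in at_top. f x / g x \<le> \<kappa> + 1"
proof -
  have "\<forall>\<^sub>F x in at_top. f x / g x < \<kappa> + 1" using \<kappa> by (intro order_tendstoD(2)[OF \<kappa>(2)]) simp
  then show ?thesis by eventually_elim simp
qed

text \<open>Potter's bound divided by \<open>g x\<close>, in the limit; this replaces a comparison
  of \<alpha> with the Matuszewska indices.\<close>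

lemma powr_alpha_le:
  assumes "\<theta> > 0"
  shows "\<theta> powr \<alpha> \<le> C * (\<theta> powr p + \<theta> powr q)"
proof -
  have "\<kappa> * \<theta> powr \<alpha> \<le> C * (\<theta> powr p + \<theta> powr q) * \<kappa>"
  proof (rule tendsto_le[OF _ tendsto_mult[OF tendsto_const \<kappa>(2)] f_scaled[OF assms]])
    show "\<forall>\<^sub>F x in at_top. f (x / \<theta>) / g x \<le> C * (\<theta> powr p + \<theta> powr q) * (f x / g x)"
      using eventually_ge_at_top[of D]
    proof eventually_elim
      case (elim x)
      show ?case using Potter[OF elim assms] g_pos[of x] by (simp add: field_simps)
    qed
  qed simp
  then show ?thesis using \<kappa>(1) by simp
qed

lemma int_alpha: "integrable M (\<lambda>\<omega>. \<Theta> i \<omega> powr \<alpha>)"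
  by (rule Bochner_Integration.integrable_bound[of _ "\<lambda>\<omega>. C * (\<Theta> i \<omega> powr p + \<Theta> i \<omega> powr q)"])
     (use int_p int_q powr_alpha_le \<Theta>_pos CD in \<open>auto intro: order.trans[OF _ abs_ge_self]\<close>)

definition e :: "nat \<Rightarrow> real" where "e i = expectation (\<lambda>\<omega>. \<Theta> i \<omega> powr \<alpha>)"

lemma e_nonneg: "e i \<ge> 0"
  unfolding e_def by (rule Bochner_Integration.integral_nonneg) simp

lemma e_pos: "e i > 0"
proof -
  have "expectation (\<lambda>_. 0) < expectation (\<lambda>\<omega>. \<Theta> i \<omega> powr \<alpha>)"
  proof (rule integral_less_AE_space)
    show "AE \<omega> in M. 0 < \<Theta> i \<omega> powr \<alpha>" using \<Theta>_pos[of i] by (auto simp: less_imp_neq[THEN not_sym])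
  qed (use int_alpha emeasure_space_1 in auto)
  then show ?thesis by (simp add: e_def)
qed

lemma summable_e: "summable e"
proof (rule summable_comparison_test_ev)
  have "\<forall>\<^sub>F i in sequentially. weight i < 1"
    using summable_LIMSEQ_zero[OF weight(3)] by (intro order_tendstoD(2)) auto
  then show "\<forall>\<^sub>F i in sequentially. norm (e i) \<le> C * 3 * weight i"
  proof eventually_elim
    case (elim i)
    have "e i \<le> expectation (\<lambda>\<omega>. C * (\<Theta> i \<omega> powr p + \<Theta> i \<omega> powr q))"
      unfolding e_def by (rule integral_mono) (use int_alpha int_p int_q powr_alpha_le \<Theta>_pos in auto)
    also have "\<dots> = C * (expectation (\<lambda>\<omega>. \<Theta> i \<omega> powr p) + expectation (\<lambda>\<omega>. \<Theta> i \<omega> powr q))"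
      using int_p int_q by simp
    also have "\<dots> \<le> C * (mom i + 2 * mom i)"
      using expectation_q_le CD by (intro mult_left_mono add_mono) (auto simp: mom_def)
    \<comment> \<open>\<open>mom i\<close> is \<open>weight i powr \<rho>\<close> with
      \<open>\<rho> \<ge> 1\<close>, and \<open>weight i < 1\<close> for large
      \<open>i\<close>.\<close>
    also have "mom i \<le> weight i"
      using powr_mono'[of 1 \<rho> "weight i"] elim exponents weight(1,2)[of i] by simp
    finally show ?case using e_nonneg[of i] CD by (simp add: mult_left_mono)
  qed
  show "summable (\<lambda>i. C * 3 * weight i)" using weight(3) by (rule summable_mult)
qed

text \<open>A limit of Breiman's type: Potter's bound times the eventual bound
  \<open>\<kappa> + 1\<close> on \<open>f x / g x\<close> dominates the integrands uniformly in
  \<open>x\<close>.\<close>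

lemma single_limit:
  assumes "c > 0"
  shows "((\<lambda>x. prob {\<omega> \<in> space M. c * x < Z i \<omega>} / g x) \<longlongrightarrow> \<kappa> * e i * c powr (-\<alpha>)) at_top"
proof (rule scaled_limit[OF _ assms, where P = "\<lambda>x. prob {\<omega> \<in> space M. x < Z i \<omega>}"])
  have eq: "prob {\<omega> \<in> space M. x < Z i \<omega>} / g x = expectation (\<lambda>\<omega>. f (x / \<Theta> i \<omega>) / g x)" if "x > 0" for x
  proof -
    have "prob {\<omega> \<in> space M. x < Z i \<omega>} = expectation (\<lambda>\<omega>1. prob {\<omega>2 \<in> space M. x < 1 * \<Theta> i \<omega>1 * V i \<omega>2})"
      using prob_discounted_exceeds(1)[OF V_meas_F2, of x 1 i i] by (simp add: Z_def)
    also have "\<dots> = expectation (\<lambda>\<omega>. f (x / \<Theta> i \<omega>))"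
    proof (rule Bochner_Integration.integral_cong[OF refl])
      fix \<omega>1
      have "{\<omega>2 \<in> space M. x < 1 * \<Theta> i \<omega>1 * V i \<omega>2} = {\<omega>2 \<in> space M. x / \<Theta> i \<omega>1 < V i \<omega>2}"
        using \<Theta>_pos[of i \<omega>1] by (simp add: pos_divide_less_eq mult.commute)
      then show "prob {\<omega>2 \<in> space M. x < 1 * \<Theta> i \<omega>1 * V i \<omega>2} = f (x / \<Theta> i \<omega>1)"
        using V_tail[of "x / \<Theta> i \<omega>1" i] that \<Theta>_pos[of i \<omega>1] by simp
    qed
    finally show ?thesis by simp
  qed
  have [measurable]: "f \<in> borel_measurable borel"
    using borel_measurable_mono[of "\<lambda>x. - f x"] f_anti
    by (auto simp: mono_def antimono_def dest: borel_measurable_uminus)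
  have "((\<lambda>x. expectation (\<lambda>\<omega>. f (x / \<Theta> i \<omega>) / g x)) \<longlongrightarrow> expectation (\<lambda>\<omega>. \<kappa> * \<Theta> i \<omega> powr \<alpha>)) at_top"
  proof (rule integral_dominated_convergence_at_top)
    show "integrable M (\<lambda>\<omega>. (\<kappa> + 1) * (C * (\<Theta> i \<omega> powr p + \<Theta> i \<omega> powr q)))"
      using int_p int_q by simp
    show "AE \<omega> in M. ((\<lambda>x. f (x / \<Theta> i \<omega>) / g x) \<longlongrightarrow> \<kappa> * \<Theta> i \<omega> powr \<alpha>) at_top"
      using f_scaled \<Theta>_pos by auto
    show "\<forall>\<^sub>F x in at_top. AE \<omega> in M. norm (f (x / \<Theta> i \<omega>) / g x) \<le> (\<kappa> + 1) * (C * (\<Theta> i \<omega> powr p + \<Theta> i \<omega> powr q))"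
      using ratio_bound eventually_ge_at_top[of D]
    proof eventually_elim
      case (elim x)
      show ?case
      proof (rule AE_I2)
        fix \<omega>
        have "norm (f (x / \<Theta> i \<omega>) / g x) = f (x / \<Theta> i \<omega>) / g x" using f_pos g_pos by (simp add: less_imp_le)
        also have "\<dots> \<le> C * (\<Theta> i \<omega> powr p + \<Theta> i \<omega> powr q) * f x / g x"
          using Potter[OF elim(2) \<Theta>_pos] g_pos[of x] by (intro divide_right_mono) (auto simp: less_imp_le)
        also have "\<dots> = f x / g x * (C * (\<Theta> i \<omega> powr p + \<Theta> i \<omega> powr q))" by simp
        also have "\<dots> \<le> (\<kappa> + 1) * (C * (\<Theta> i \<omega> powr p + \<Theta> i \<omega> powr q))"
          using elim CD by (intro mult_right_mono) auto
        finally show "norm (f (x / \<Theta> i \<omega>) / g x) \<le> \<dots>" .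
      qed
    qed
  qed measurable
  also have "expectation (\<lambda>\<omega>. \<kappa> * \<Theta> i \<omega> powr \<alpha>) = \<kappa> * e i" by (simp add: e_def)
  finally show "((\<lambda>x. prob {\<omega> \<in> space M. x < Z i \<omega>} / g x) \<longlongrightarrow> \<kappa> * e i) at_top"
    by (rule Lim_transform_eventually[OF _ eventually_mono[OF eventually_gt_at_top[of 0]]]) (rule eq[symmetric])
qed

lemma pair_limit:
  assumes ij: "i \<noteq> j" and c: "c > 0"
  shows "((\<lambda>x. prob {\<omega> \<in> space M. c * x < Z i \<omega> \<and> c * x < Z j \<omega>} / g x) \<longlongrightarrow> 0) at_top"
proof -
  define P where "P x \<omega> = prob {\<omega>2 \<in> space M. x < \<Theta> i \<omega> * V i \<omega>2 \<and> x < \<Theta> j \<omega> * V j \<omega>2}" for x \<omega>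
  have 1: "prob {\<omega> \<in> space M. x < Z i \<omega> \<and> x < Z j \<omega>} = expectation (P x)" "P x \<in> borel_measurable M" for x
  proof -
    note [measurable] = \<Theta>_meas_F1 V_meas_F2
    have "Measurable.pred (F1 \<Otimes>\<^sub>M F2) (\<lambda>p. x < \<Theta> i (fst p) * V i (snd p) \<and> x < \<Theta> j (fst p) * V j (snd p))"
      by measurable
    from prob_indep_diagonal[OF F1 F2 indep this]
    show "prob {\<omega> \<in> space M. x < Z i \<omega> \<and> x < Z j \<omega>} = expectation (P x)" "P x \<in> borel_measurable M"
      by (auto simp: P_def[abs_def] Z_def)
  qed
  have P0: "P x \<omega> \<ge> 0" for x \<omega> by (simp add: P_def)
  have "((\<lambda>x. expectation (\<lambda>\<omega>. P x \<omega> / g x)) \<longlongrightarrow> expectation (\<lambda>_. 0)) at_top"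
  proof (rule integral_dominated_convergence_at_top)
    show "integrable M (\<lambda>\<omega>. (\<kappa> + 1) * (C * (\<Theta> i \<omega> powr p + \<Theta> i \<omega> powr q)))"
      using int_p int_q by simp
    show "\<forall>\<^sub>F x in at_top. AE \<omega> in M. norm (P x \<omega> / g x) \<le> (\<kappa> + 1) * (C * (\<Theta> i \<omega> powr p + \<Theta> i \<omega> powr q))"
      using ratio_bound eventually_ge_at_top[of D]
    proof eventually_elim
      case (elim x)
      show ?case
      proof (rule AE_I2)
        fix \<omega>
        have "P x \<omega> \<le> prob {\<omega>2 \<in> space M. x / \<Theta> i \<omega> < V i \<omega>2}"
          unfolding P_def using \<Theta>_pos[of i \<omega>]
          by (intro finite_measure_mono) (auto simp: pos_divide_less_eq mult.commute)
        also have "\<dots> = f (x / \<Theta> i \<omega>)" using elim CD \<Theta>_pos by (intro V_tail) (auto intro!: divide_pos_pos)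
        also have "\<dots> \<le> C * (\<Theta> i \<omega> powr p + \<Theta> i \<omega> powr q) * f x" by (rule Potter[OF elim(2) \<Theta>_pos])
        finally have "P x \<omega> / g x \<le> C * (\<Theta> i \<omega> powr p + \<Theta> i \<omega> powr q) * f x / g x"
          using g_pos[of x] by (intro divide_right_mono) (auto simp: less_imp_le)
        also have "\<dots> = f x / g x * (C * (\<Theta> i \<omega> powr p + \<Theta> i \<omega> powr q))" by simp
        also have "\<dots> \<le> (\<kappa> + 1) * (C * (\<Theta> i \<omega> powr p + \<Theta> i \<omega> powr q))"
          using elim CD by (intro mult_right_mono) auto
        finally show "norm (P x \<omega> / g x) \<le> \<dots>" using P0 g_pos[of x] by simp
      qed
    qed
    show "AE \<omega> in M. ((\<lambda>x. P x \<omega> / g x) \<longlongrightarrow> 0) at_top"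
    proof (rule AE_I2)
      fix \<omega>
      \<comment> \<open>The two claims carry different discount factors; the larger one places both
        events inside exceedances of the common level \<open>x / m\<close>, where
        \<open>pairs\<close> applies.\<close>
      define m where "m = max (\<Theta> i \<omega>) (\<Theta> j \<omega>)"
      have m: "m > 0" "\<Theta> i \<omega> \<le> m" "\<Theta> j \<omega> \<le> m" using \<Theta>_pos[of i \<omega>] by (auto simp: m_def)
      have "filterlim (\<lambda>x. x / m) at_top at_top"
        using filterlim_scale[of "inverse m"] m by (simp add: divide_inverse mult.commute)
      then have "((\<lambda>x. prob {\<omega> \<in> space M. x / m < V i \<omega> \<and> x / m < V j \<omega>} / f (x / m) * (f (x / m) / g x))
          \<longlongrightarrow> 0 * (\<kappa> * m powr \<alpha>)) at_top"
        using m by (intro tendsto_mult f_scaled filterlim_compose[OF pairs[OF ij]]) auto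
      moreover have "f y \<noteq> 0" for y using f_pos[of y] by simp
      ultimately have lim: "((\<lambda>x. prob {\<omega> \<in> space M. x / m < V i \<omega> \<and> x / m < V j \<omega>} / g x) \<longlongrightarrow> 0) at_top"
        by simp
      show "((\<lambda>x. P x \<omega> / g x) \<longlongrightarrow> 0) at_top"
      proof (rule tendsto_sandwich[OF _ _ tendsto_const lim])
        show "\<forall>\<^sub>F x in at_top. 0 \<le> P x \<omega> / g x" using P0 g_pos by (simp add: less_imp_le)
        show "\<forall>\<^sub>F x in at_top. P x \<omega> / g x \<le> prob {\<omega> \<in> space M. x / m < V i \<omega> \<and> x / m < V j \<omega>} / g x"
        proof (rule always_eventually, rule allI)
          fix x
          have "x / m < v" if "x < t * v" "0 \<le> v" "t \<le> m" for t v :: real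
            using that m mult_right_mono[of t m v] by (simp add: pos_divide_less_eq mult.commute)
          then have "P x \<omega> \<le> prob {\<omega> \<in> space M. x / m < V i \<omega> \<and> x / m < V j \<omega>}"
            unfolding P_def using m V_nonneg by (intro finite_measure_mono) auto
          then show "P x \<omega> / g x \<le> prob {\<omega> \<in> space M. x / m < V i \<omega> \<and> x / m < V j \<omega>} / g x"
            using g_pos[of x] by (intro divide_right_mono) (auto simp: less_imp_le)
        qed
      qed
    qed
  qed (use 1 in auto)
  then have "((\<lambda>x. prob {\<omega> \<in> space M. x < Z i \<omega> \<and> x < Z j \<omega>} / g x) \<longlongrightarrow> 0) at_top"
    by (simp add: 1)
  from scaled_limit[OF this c] show ?thesis by simp
qed

lemma tail_sums_tendsto: "(\<lambda>n. (\<Sum>i. weight (i + n)) powr \<rho>) \<longlonglongrightarrow> 0"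
proof -
  have "(\<lambda>n. (\<Sum>i. weight i) - (\<Sum>i<n. weight i)) \<longlonglongrightarrow> (\<Sum>i. weight i) - (\<Sum>i. weight i)"
    by (intro tendsto_diff tendsto_const summable_LIMSEQ weight(3))
  then have "(\<lambda>n. \<Sum>i. weight (i + n)) \<longlonglongrightarrow> 0"
    using weight(3) by (simp add: suminf_minus_initial_segment)
  then have "(\<lambda>n. (\<Sum>i. weight (i + n)) powr \<rho>) \<longlonglongrightarrow> 0 powr \<rho>"
    using exponents weight by (intro tendsto_powr') (auto intro!: always_eventually suminf_nonneg simp: less_imp_le summable_iff_shift)
  then show ?thesis by simp
qed

text \<open>The level is split twice: a share \<open>d * x\<close> goes to the series from
  \<open>n\<close> on, and the remaining \<open>(1 - d) * x\<close> is treated by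
  \<open>sum_exceeds_cases\<close>, which produces the square of \<open>1 - d\<close>.\<close>

lemma prob_series_exceeds_upper:
  assumes d: "0 < d" "d < 1" and x: "d * x \<ge> D"
  shows "prob {\<omega> \<in> space M. \<exists>N. x < (\<Sum>i<N. Z i \<omega>)} \<le>
    (\<Sum>i<n. prob {\<omega> \<in> space M. (1 - d) * (1 - d) * x < Z i \<omega>}) +
    (\<Sum>i<n. \<Sum>j\<in>{..<n} - {i}. prob {\<omega> \<in> space M. d / n * (1 - d) * x < Z i \<omega> \<and> d / n * (1 - d) * x < Z j \<omega>}) +
    series_const * (\<Sum>i. weight (i + n)) powr \<rho> * f (d * x)"
proof -
  have x0: "x > 0" using x d CD by (metis less_le_trans zero_less_mult_pos)
  let ?A = "\<lambda>i. {\<omega> \<in> space M. (1 - d) * (1 - d) * x < Z i \<omega>}"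
  let ?B = "\<lambda>i j. {\<omega> \<in> space M. d / n * (1 - d) * x < Z i \<omega> \<and> d / n * (1 - d) * x < Z j \<omega>}"
  let ?T = "{\<omega> \<in> space M. \<exists>N. d * x < (\<Sum>i\<in>{n..<N}. \<Theta> i \<omega> * V i \<omega>)}"
  have "{\<omega> \<in> space M. \<exists>N. x < (\<Sum>i<N. Z i \<omega>)} \<subseteq> ((\<Union>i<n. ?A i) \<union> (\<Union>i<n. \<Union>j\<in>{..<n} - {i}. ?B i j)) \<union> ?T"
  proof
    fix \<omega> assume "\<omega> \<in> {\<omega> \<in> space M. \<exists>N. x < (\<Sum>i<N. Z i \<omega>)}"
    then obtain N where \<omega>: "\<omega> \<in> space M" "x < (\<Sum>i<N. Z i \<omega>)" by auto
    have "(\<Sum>i<N. Z i \<omega>) \<le> (\<Sum>i\<in>{..<n} \<union> {n..<N}. Z i \<omega>)"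
      using Z_nonneg by (intro sum_mono2) auto
    also have "\<dots> = (\<Sum>i<n. Z i \<omega>) + (\<Sum>i\<in>{n..<N}. Z i \<omega>)" by (rule sum.union_disjoint) auto
    finally consider "d * x < (\<Sum>i\<in>{n..<N}. Z i \<omega>)" | "(1 - d) * x < (\<Sum>i<n. Z i \<omega>)"
      using \<omega> by (force simp: algebra_simps)
    then show "\<omega> \<in> ((\<Union>i<n. ?A i) \<union> (\<Union>i<n. \<Union>j\<in>{..<n} - {i}. ?B i j)) \<union> ?T"
    proof cases
      case 1
      then show ?thesis using \<omega> by (auto simp: Z_def)
    next
      case 2
      have "(\<exists>i<n. (1 - d) * ((1 - d) * x) < Z i \<omega>) \<or>
          (\<exists>i<n. \<exists>j\<in>{..<n} - {i}. d / n * ((1 - d) * x) < Z i \<omega> \<and> d / n * ((1 - d) * x) < Z j \<omega>)"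
        using Z_nonneg x0 d 2 by (intro sum_exceeds_cases) auto
      then show ?thesis using \<omega> by (auto simp: mult.assoc)
    qed
  qed
  then have "prob {\<omega> \<in> space M. \<exists>N. x < (\<Sum>i<N. Z i \<omega>)} \<le>
      prob (((\<Union>i<n. ?A i) \<union> (\<Union>i<n. \<Union>j\<in>{..<n} - {i}. ?B i j)) \<union> ?T)"
    by (intro finite_measure_mono) auto
  also have "\<dots> \<le> prob ((\<Union>i<n. ?A i) \<union> (\<Union>i<n. \<Union>j\<in>{..<n} - {i}. ?B i j)) + prob ?T"
    by (rule measure_Un_le) auto
  also have "prob ((\<Union>i<n. ?A i) \<union> (\<Union>i<n. \<Union>j\<in>{..<n} - {i}. ?B i j)) \<le>
      prob (\<Union>i<n. ?A i) + prob (\<Union>i<n. \<Union>j\<in>{..<n} - {i}. ?B i j)"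
    by (rule measure_Un_le) auto
  also have "prob (\<Union>i<n. ?A i) \<le> (\<Sum>i<n. prob (?A i))"
    by (rule finite_measure_subadditive_finite) auto
  also have "prob (\<Union>i<n. \<Union>j\<in>{..<n} - {i}. ?B i j) \<le> (\<Sum>i<n. prob (\<Union>j\<in>{..<n} - {i}. ?B i j))"
    by (rule finite_measure_subadditive_finite) auto
  also have "\<dots> \<le> (\<Sum>i<n. \<Sum>j\<in>{..<n} - {i}. prob (?B i j))"
    by (intro sum_mono finite_measure_subadditive_finite) auto
  also have "prob ?T \<le> series_const * 1 * f (d * x) * (\<Sum>i. weight (i + n)) powr \<rho>"
    by (rule prob_series_exceeds_le[OF V_meas_F2 V_nonneg _ _ x]) (auto simp: V_tail)
  finally show ?thesis by (simp add: mult_ac)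
qed

lemma prob_max_exceeds_lower:
  "(\<Sum>i<n. prob {\<omega> \<in> space M. x < Z i \<omega>}) -
    (\<Sum>j<n. \<Sum>i<j. prob {\<omega> \<in> space M. x < Z i \<omega> \<and> x < Z j \<omega>}) \<le> prob {\<omega> \<in> space M. \<exists>i<n. x < Z i \<omega>}"
proof -
  let ?A = "\<lambda>i. {\<omega> \<in> space M. x < Z i \<omega>}"
  have "(\<Sum>i<n. prob (?A i)) - (\<Sum>j<n. \<Sum>i<j. prob (?A i \<inter> ?A j)) \<le> prob (\<Union>i<n. ?A i)"
    by (rule prob_Union_ge_Bonferroni) auto
  also have "(\<Union>i<n. ?A i) = {\<omega> \<in> space M. \<exists>i<n. x < Z i \<omega>}" by auto
  finally have "(\<Sum>i<n. prob (?A i)) - (\<Sum>j<n. \<Sum>i<j. prob (?A i \<inter> ?A j)) \<le> prob {\<omega> \<in> space M. \<exists>i<n. x < Z i \<omega>}" .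
  moreover have "?A i \<inter> ?A j = {\<omega> \<in> space M. x < Z i \<omega> \<and> x < Z j \<omega>}" for i j by auto
  ultimately show ?thesis by simp
qed

text \<open>\<open>P\<close> stays abstract: only its comparison with finite maxima from below and
  with the whole series from above enters.\<close>

theorem single_big_jump:
  assumes lower: "\<And>n. \<forall>\<^sub>F x in at_top. prob {\<omega> \<in> space M. \<exists>i<n. x < Z i \<omega>} \<le> P x"
    and upper: "\<forall>\<^sub>F x in at_top. P x \<le> prob {\<omega> \<in> space M. \<exists>N. x < (\<Sum>i<N. Z i \<omega>)}"
  shows "((\<lambda>x. P x / g x) \<longlongrightarrow> \<kappa> * (\<Sum>i. e i)) at_top"
proof (rule order_tendstoI)
  fix a assume "a < \<kappa> * (\<Sum>i. e i)"
  moreover have "(\<lambda>n. \<kappa> * (\<Sum>i<n. e i)) \<longlonglongrightarrow> \<kappa> * (\<Sum>i. e i)"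
    by (intro tendsto_mult tendsto_const summable_LIMSEQ summable_e)
  ultimately have "\<forall>\<^sub>F n in sequentially. a < \<kappa> * (\<Sum>i<n. e i)" by (intro order_tendstoD)
  then obtain n where n: "a < \<kappa> * (\<Sum>i<n. e i)" by (auto simp: eventually_sequentially)
  let ?L = "\<lambda>x. (\<Sum>i<n. prob {\<omega> \<in> space M. x < Z i \<omega>} / g x) -
    (\<Sum>j<n. \<Sum>i<j. prob {\<omega> \<in> space M. x < Z i \<omega> \<and> x < Z j \<omega>} / g x)"
  have "(?L \<longlongrightarrow> (\<Sum>i<n. \<kappa> * e i) - (\<Sum>j<n. \<Sum>i<j. 0)) at_top"
    by (intro tendsto_diff tendsto_sum)
       (use single_limit[of 1] pair_limit[of _ _ 1] in auto)
  then have "\<forall>\<^sub>F x in at_top. a < ?L x"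
    using n by (intro order_tendstoD(1)) (auto simp: sum_distrib_left)
  with lower[of n] show "\<forall>\<^sub>F x in at_top. a < P x / g x"
  proof eventually_elim
    case (elim x)
    have "?L x = ((\<Sum>i<n. prob {\<omega> \<in> space M. x < Z i \<omega>}) -
        (\<Sum>j<n. \<Sum>i<j. prob {\<omega> \<in> space M. x < Z i \<omega> \<and> x < Z j \<omega>})) / g x"
      by (simp add: diff_divide_distrib sum_divide_distrib)
    also have "\<dots> \<le> P x / g x"
      using prob_max_exceeds_lower[of x n] elim g_pos[of x] by (intro divide_right_mono) (auto simp: less_imp_le)
    finally show ?case using elim by simp
  qed
next
  fix a assume a: "\<kappa> * (\<Sum>i. e i) < a"
  define L where "L = \<kappa> * (\<Sum>i. e i)"
  have "((\<lambda>d. L * ((1 - d) * (1 - d)) powr (-\<alpha>)) \<longlongrightarrow> L * ((1 - 0) * (1 - 0)) powr (-\<alpha>)) (at_right 0)"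
    by (intro tendsto_intros) auto
  then have "\<forall>\<^sub>F d in at_right 0. L * ((1 - d) * (1 - d)) powr (-\<alpha>) < a"
    using a by (intro order_tendstoD(2)) (auto simp: L_def)
  moreover have "\<forall>\<^sub>F d in at_right (0::real). 0 < d \<and> d < 1"
    by (auto simp: eventually_at_right_field intro: exI[of _ 1])
  ultimately have "\<forall>\<^sub>F d in at_right 0. L * ((1 - d) * (1 - d)) powr (-\<alpha>) < a \<and> 0 < d \<and> d < 1"
    by eventually_elim auto
  then obtain d where d: "L * ((1 - d) * (1 - d)) powr (-\<alpha>) < a" "0 < d" "d < 1"
    using eventually_happens[of _ "at_right (0::real)"] trivial_limit_at_right_real by blast
  define s where "s = (1 - d) * (1 - d)"
  \<comment> \<open>The limit of \<open>f (d * x) / g x\<close>. It depends on \<open>d\<close>, so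
    \<open>d\<close> is fixed before \<open>n\<close> is taken large enough to make the remainder
    small.\<close>
  define k where "k = \<kappa> * inverse d powr \<alpha>"
  have "(\<lambda>n. L * s powr (-\<alpha>) + series_const * (\<Sum>i. weight (i + n)) powr \<rho> * k) \<longlonglongrightarrow>
      L * s powr (-\<alpha>) + series_const * 0 * k"
    by (intro tendsto_intros tail_sums_tendsto)
  then have "\<forall>\<^sub>F n in sequentially. L * s powr (-\<alpha>) + series_const * (\<Sum>i. weight (i + n)) powr \<rho> * k < a"
    using d by (intro order_tendstoD(2)) (auto simp: s_def)
  with eventually_gt_at_top[of 0]
  have "\<forall>\<^sub>F n in sequentially. 0 < n \<and> L * s powr (-\<alpha>) + series_const * (\<Sum>i. weight (i + n)) powr \<rho> * k < a"
    by eventually_elim auto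
  then obtain n where n: "n > 0" "L * s powr (-\<alpha>) + series_const * (\<Sum>i. weight (i + n)) powr \<rho> * k < a"
    by (auto simp: eventually_sequentially)
  let ?U = "\<lambda>x. (\<Sum>i<n. prob {\<omega> \<in> space M. s * x < Z i \<omega>} / g x) +
    (\<Sum>i<n. \<Sum>j\<in>{..<n} - {i}. prob {\<omega> \<in> space M. d / n * (1 - d) * x < Z i \<omega> \<and> d / n * (1 - d) * x < Z j \<omega>} / g x) +
    series_const * (\<Sum>i. weight (i + n)) powr \<rho> * (f (x / inverse d) / g x)"
  have lim: "(?U \<longlongrightarrow> (\<Sum>i<n. \<kappa> * e i * s powr (-\<alpha>)) + (\<Sum>i<n. \<Sum>j\<in>{..<n} - {i}. 0) +
      series_const * (\<Sum>i. weight (i + n)) powr \<rho> * k) at_top"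
    unfolding k_def using d n
    by (intro tendsto_add tendsto_sum tendsto_mult tendsto_const single_limit pair_limit f_scaled) (auto simp: s_def)
  have "(\<Sum>i<n. \<kappa> * e i * s powr (-\<alpha>)) \<le> L * s powr (-\<alpha>)"
  proof -
    have "(\<Sum>i<n. e i) \<le> (\<Sum>i. e i)" using summable_e e_nonneg by (intro sum_le_suminf) auto
    then show ?thesis using \<kappa>(1) by (simp add: L_def sum_distrib_left[symmetric] sum_distrib_right[symmetric] mult_right_mono)
  qed
  then have "\<forall>\<^sub>F x in at_top. ?U x < a"
    using n by (intro order_tendstoD(2)[OF lim]) simp
  with upper eventually_ge_at_top[of "D / d"] show "\<forall>\<^sub>F x in at_top. P x / g x < a"
  proof eventually_elim
    case (elim x)
    then have "d * x \<ge> D" using d by (simp add: pos_divide_le_eq mult.commute)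
    from prob_series_exceeds_upper[OF d(2,3) this, of n]
    have "P x / g x \<le> ((\<Sum>i<n. prob {\<omega> \<in> space M. s * x < Z i \<omega>}) +
        (\<Sum>i<n. \<Sum>j\<in>{..<n} - {i}. prob {\<omega> \<in> space M. d / n * (1 - d) * x < Z i \<omega> \<and> d / n * (1 - d) * x < Z j \<omega>}) +
        series_const * (\<Sum>i. weight (i + n)) powr \<rho> * f (d * x)) / g x"
      using elim g_pos[of x] unfolding s_def by (intro divide_right_mono) (auto simp: less_imp_le)
    also have "d * x = x / inverse d" by (simp add: divide_inverse mult.commute)
    also have "((\<Sum>i<n. prob {\<omega> \<in> space M. s * x < Z i \<omega>}) +
        (\<Sum>i<n. \<Sum>j\<in>{..<n} - {i}. prob {\<omega> \<in> space M. d / n * (1 - d) * x < Z i \<omega> \<and> d / n * (1 - d) * x < Z j \<omega>}) +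
        series_const * (\<Sum>i. weight (i + n)) powr \<rho> * f (x / inverse d)) / g x = ?U x"
      by (simp add: add_divide_distrib sum_divide_distrib)
    finally show ?case using elim by simp
  qed
qed

end

section \<open>The discounted aggregate claim vector\<close>

context quadrant_gauge
begin

lemma h_sum_le:
  fixes z :: "nat \<Rightarrow> real ^ 'd"
  assumes "\<And>i. i < N \<Longrightarrow> z i \<in> quadrant"
  shows "(\<Sum>i<N. z i) \<in> quadrant" "h (\<Sum>i<N. z i) \<le> (\<Sum>i<N. h (z i))"
proof -
  have "(\<Sum>i<N. z i) \<in> quadrant \<and> h (\<Sum>i<N. z i) \<le> (\<Sum>i<N. h (z i))"
    using assms
  proof (induction N)
    case 0
    then show ?case by (simp add: h_zero quadrant_def)
  next
    case (Suc N)
    then have IH: "(\<Sum>i<N. z i) \<in> quadrant" "h (\<Sum>i<N. z i) \<le> (\<Sum>i<N. h (z i))" by auto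
    with h_subadd[OF IH(1) Suc.prems[of N]] Suc.prems[of N] show ?case
      by (auto simp: quadrant_def)
  qed
  then show "(\<Sum>i<N. z i) \<in> quadrant" "h (\<Sum>i<N. z i) \<le> (\<Sum>i<N. h (z i))" by auto
qed

end

text \<open>\<open>scale_set x A\<close> is open, so a partial sum already lies in it, and
  subadditivity for finite sums suffices.\<close>

lemma suminf_mem_scale_setD:
  fixes z :: "nat \<Rightarrow> real ^ 'd"
  assumes A: "A \<in> risk_sets" and z: "\<And>i. z i \<in> quadrant" and s: "summable z"
    and x: "x > 0" and mem: "suminf z \<in> scale_set x A"
  shows "\<exists>N. x < (\<Sum>i<N. reduce A (z i))"
proof -
  interpret quadrant_gauge "reduce A" using A by (rule quadrant_gauge_reduce)
  have "open (scale_set x A)" using A x by (auto simp: scale_set_def risk_sets_def intro: open_scaling)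
  with summable_LIMSEQ[OF s] mem have "\<forall>\<^sub>F N in sequentially. (\<Sum>i<N. z i) \<in> scale_set x A"
    by (simp add: topological_tendstoD)
  then obtain N where "(\<Sum>i<N. z i) \<in> scale_set x A" by (auto simp: eventually_sequentially)
  then have "x < reduce A (\<Sum>i<N. z i)" using less_reduce_iff[OF A h_sum_le(1) x] z by simp
  also have "\<dots> \<le> (\<Sum>i<N. reduce A (z i))" using z by (rule h_sum_le)
  finally show ?thesis ..
qed

lemma suminf_not_summable:
  fixes z w :: "nat \<Rightarrow> real ^ 'd"
  assumes "\<not> summable z" "\<not> summable w"
  shows "suminf z = suminf w"
  using assms by (simp add: suminf_def summable_def)

text \<open>The default value of \<open>suminf\<close> is represented by the constant series 1, and
  the scaled sets leave every ball as \<open>x\<close> grows.\<close>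

lemma ex_bound_not_summable:
  fixes A :: "(real ^ 'd) set"
  assumes A: "A \<in> risk_sets"
  obtains x0 where "\<And>z x. \<not> summable z \<Longrightarrow> x > x0 \<Longrightarrow> x > 0 \<Longrightarrow> suminf z \<notin> scale_set x A"
proof -
  obtain r where r: "r > 0" "\<And>z u. u > 0 \<Longrightarrow> z \<in> scale_set u A \<Longrightarrow> u * r \<le> norm z"
    by (rule risk_set_bound[OF A]) blast
  have bound: "suminf z \<notin> scale_set x A"
    if "\<not> summable z" "x > norm (suminf (\<lambda>_. 1 :: real ^ 'd)) / r" "x > 0" for z x
  proof
    have "\<not> summable (\<lambda>_. 1 :: real ^ 'd)"
      using summable_LIMSEQ_zero LIMSEQ_const_iff[of "1 :: real ^ 'd" 0] by auto
    then have "suminf z = suminf (\<lambda>_. 1)" using that(1) by (intro suminf_not_summable)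
    moreover assume "suminf z \<in> scale_set x A"
    ultimately have "x * r \<le> norm (suminf (\<lambda>_. 1 :: real ^ 'd))" using r(2)[OF that(3)] by metis
    with that r show False by (simp add: pos_divide_less_eq)
  qed
  show ?thesis by (rule that[OF bound])
qed

lemma suminf_mem_scale_setI:
  fixes z :: "nat \<Rightarrow> real ^ 'd"
  assumes A: "A \<in> risk_sets" and z: "\<And>i. z i \<in> quadrant" and s: "summable z"
    and x: "x > 0" and i: "x < reduce A (z i)"
  shows "suminf z \<in> scale_set x A"
proof -
  interpret quadrant_gauge "reduce A" using A by (rule quadrant_gauge_reduce)
  have comp: "suminf z $ j = (\<Sum>k. z k $ j)" "summable (\<lambda>k. z k $ j)" for j
    using bounded_linear.suminf[OF bounded_linear_vec_nth s, of j] bounded_linear.summable[OF bounded_linear_vec_nth s, of j]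
    by auto
  have le: "z i $ j \<le> suminf z $ j" for j
    unfolding comp using sum_le_suminf[OF comp(2), of "{i}" j] z by (simp add: quadrant_def)
  then have "suminf z \<in> quadrant" using z[of i] by (auto simp: quadrant_def intro: order.trans)
  moreover have "x < reduce A (suminf z)" using h_mono_le[OF z le] i by simp
  ultimately show ?thesis using less_reduce_iff[OF A _ x] by blast
qed

lemma tail_reduced_distr:
  assumes A: "A \<in> risk_sets" and X: "X \<in> borel_measurable M"
  shows "tail (reduced_distr A (distr M borel X)) u = measure M {\<omega> \<in> space M. u < reduce A (X \<omega>)}"
proof -
  note [measurable] = borel_measurable_reduce[OF A] X
  show ?thesis unfolding tail_def reduced_distr_def
    by (subst distr_distr, simp, simp, subst measure_distr) (auto intro!: arg_cong[where f="measure M"])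
qed

text \<open>
  The reduction of a claim does not control its norm. This bound makes the claim series converge.
\<close>
lemma MRV_norm_tail_bound:
  fixes F :: "(real ^ 'd) measure"
  assumes M: "MRV \<alpha> \<mu> G F" and f: "antimono f" "\<And>x. f x > 0"
    and k: "k > 0" "((\<lambda>x. f x / tail G x) \<longlongrightarrow> k) at_top"
  obtains B where "B \<ge> 0" "\<And>u. u > 0 \<Longrightarrow> measure F {z. u < norm z} \<le> B * f u"
proof -
  interpret S: quadrant_gauge "\<lambda>z :: real ^ 'd. \<Sum>j\<in>UNIV. z $ j" by (rule quadrant_gauge_sum)
  have F: "prob_space F" "sets F = sets borel" "AE z in F. z \<in> quadrant" and G: "regularly_varying \<alpha> G"
    using M by (auto simp: MRV_def quadrant_distribution_def)
  interpret F: prob_space F by fact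
  have gpos: "tail G x > 0" for x using G by (auto simp: regularly_varying_def intro: tail_pos)
  have le: "measure F {z. u < norm z} \<le> measure F {z. u < (\<Sum>j\<in>UNIV. z $ j)}" for u
  proof (rule F.finite_measure_mono_AE)
    show "AE z in F. z \<in> {z. u < norm z} \<longrightarrow> z \<in> {z. u < (\<Sum>j\<in>UNIV. z $ j)}"
      using F(3)
    proof eventually_elim
      case (elim z)
      \<comment> \<open>On the quadrant the coordinate sum is the 1-norm, so the gauge limit for the
        sum bounds the tail of the norm.\<close>
      have "norm z \<le> (\<Sum>j\<in>UNIV. \<bar>z $ j\<bar>)" by (rule norm_le_l1_cart)
      also have "\<dots> = (\<Sum>j\<in>UNIV. z $ j)" using elim by (simp add: quadrant_def)
      finally show ?case by auto
    qed
    show "{z. u < (\<Sum>j\<in>UNIV. z $ j)} \<in> sets F" unfolding F(2) using S.h_meas by simp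
  qed
  define L where "L = measure \<mu> {b. 1 < S.ext b}"
  have "((\<lambda>x. measure F {z. x < (\<Sum>j\<in>UNIV. z $ j)} / tail G x / (f x / tail G x)) \<longlongrightarrow> L / k) at_top"
    unfolding L_def using k by (intro tendsto_divide S.MRV_gauge_limit(1)[OF M]) auto
  then have "\<forall>\<^sub>F x in at_top. measure F {z. x < (\<Sum>j\<in>UNIV. z $ j)} / tail G x / (f x / tail G x) < L / k + 1"
    by (rule order_tendstoD) simp
  then obtain u0 where u0: "\<And>x. x \<ge> u0 \<Longrightarrow> measure F {z. x < (\<Sum>j\<in>UNIV. z $ j)} / tail G x / (f x / tail G x) < L / k + 1"
    by (auto simp: eventually_at_top_linorder)
  \<comment> \<open>The second entry covers \<open>u < u0\<close>, where
    \<open>f u \<ge> f u0\<close> and a probability is at most 1.\<close>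
  define B where "B = max (L / k + 1) (1 / f u0)"
  have "measure F {z. u < norm z} \<le> B * f u" for u
  proof (cases "u \<ge> u0")
    case True
    have "tail G u \<noteq> 0" "f u \<noteq> 0" using gpos[of u] f(2)[of u] by auto
    then have "measure F {z. u < (\<Sum>j\<in>UNIV. z $ j)} < (L / k + 1) * f u"
      using u0[OF True] f(2)[of u] gpos[of u] by (simp add: pos_divide_less_eq)
    also have "\<dots> \<le> B * f u" using f(2)[of u] by (simp add: B_def)
    finally show ?thesis using le[of u] by simp
  next
    case False
    then have "f u0 \<le> f u" using antimono_le[OF f(1), of u u0] by simp
    then have "1 \<le> 1 / f u0 * f u" using f(2)[of u0] by (simp add: field_simps)
    also have "\<dots> \<le> B * f u" using f(2)[of u] by (intro mult_right_mono) (auto simp: B_def)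
    finally show ?thesis using F.prob_le_1[of "{z. u < norm z}"] by linarith
  qed
  moreover have "B \<ge> 0" using f(2)[of u0] by (simp add: B_def le_max_iff_disj less_imp_le)
  ultimately show ?thesis using that by blast
qed

text \<open>For limit mass 0 the right-hand side vanishes identically, and asymptotic equivalence
  would force the probability to be eventually 0; the assertion is then read as negligibility
  against \<open>tail G\<close>. For positive limit mass the renewal integral turns out to be
  finite, so \<open>enn2real\<close> loses nothing.\<close>

theorem corollary3p2:
  fixes M :: "'w measure"
    and X :: "nat \<Rightarrow> 'w \<Rightarrow> real ^ 'd"
    and \<theta> :: "nat \<Rightarrow> 'w \<Rightarrow> real"
    and \<xi> :: "real \<Rightarrow> 'w \<Rightarrow> real"
    and F :: "(real ^ 'd) measure"
    and A :: "(real ^ 'd) set"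
    and \<mu> :: "(ennreal ^ 'd) measure"
    and G :: "real measure"
    and \<alpha> :: real
  assumes "prob_space M"
    and "A \<in> risk_sets"
    and "\<And>i. X i \<in> borel_measurable M"
    and "\<And>i. distr M borel (X i) = F"
    and "quadrant_distribution F"
    and "AE z in F. z \<noteq> 0"
    and "renewal_arrivals M \<theta>"
    and "cadlag_process M \<xi>"
    and "mutually_independent M X \<theta> \<xi>"
    and "QAI_on A M X"
    and "consistently_varying (reduced_distr A F)"
    and "positively_decreasing (reduced_distr A F)"
    and "\<exists>p1 p2 :: real. 0 < p1 \<and>
           ereal p1 < lower_Matuszewska (reduced_distr A F) \<and>
           lower_Matuszewska (reduced_distr A F) \<le> upper_Matuszewska (reduced_distr A F) \<and>
           upper_Matuszewska (reduced_distr A F) < ereal p2 \<and>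
           moment_series_finite M \<theta> \<xi> p1 p2
             (if upper_Matuszewska (reduced_distr A F) < 1 then 1 else p2)"
    and "MRV \<alpha> \<mu> G F"
  shows "(limit_mass \<mu> A > 0 \<longrightarrow>
            (\<lambda>x. measure M {\<omega>\<in>space M. discounted_claims X \<theta> \<xi> \<omega> \<in> scale_set x A})
              \<sim>[at_top]
            (\<lambda>x. limit_mass \<mu> A * tail G x * enn2real (renewal_integral M \<theta> \<xi> \<alpha>))) \<and>
         (limit_mass \<mu> A = 0 \<longrightarrow>
            (\<lambda>x. measure M {\<omega>\<in>space M. discounted_claims X \<theta> \<xi> \<omega> \<in> scale_set x A})
              \<in> o[at_top](tail G))"
proof -
  interpret prob_space M by fact
  note A = \<open>A \<in> risk_sets\<close> and R = \<open>renewal_arrivals M \<theta>\<close> and Cd = \<open>cadlag_process M \<xi>\<close>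
    and ind = \<open>mutually_independent M X \<theta> \<xi>\<close> and MRV = \<open>MRV \<alpha> \<mu> G F\<close>
    and X [measurable] = \<open>\<And>i. X i \<in> borel_measurable M\<close>
    and FX = \<open>\<And>i. distr M borel (X i) = F\<close>
  define FR where "FR = reduced_distr A F"
  have pt: "pos_tail_distribution FR"
    using \<open>consistently_varying (reduced_distr A F)\<close> by (simp add: consistently_varying_def FR_def)
  have G: "regularly_varying \<alpha> G" using MRV by (simp add: MRV_def)
  then have gpos: "tail G x > 0" for x by (auto simp: regularly_varying_def intro: tail_pos)
  let ?f = "tail FR"
  have f: "antimono ?f" "\<And>x. ?f x > 0"
    using tail_antimono[OF pt] tail_pos[OF pt] by (auto simp: antimono_def)
  have tailR: "?f u = prob {\<omega> \<in> space M. u < reduce A (X i \<omega>)}" for u i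
    using tail_reduced_distr[OF A X, of i u] by (simp add: FX FR_def)
  have fg: "((\<lambda>x. ?f x / tail G x) \<longlongrightarrow> limit_mass \<mu> A) at_top"
  proof -
    have "measure F {z. x < reduce A z} = ?f x" for x
      unfolding tailR[of x 0] FX[of 0, symmetric] using borel_measurable_reduce[OF A]
      by (subst measure_distr) (auto intro!: arg_cong[where f = prob])
    then show ?thesis using MRV_reduced_tail[OF MRV A] by simp
  qed
  obtain p1 p2 where p: "0 < p1" "ereal p1 < lower_Matuszewska FR"
      "lower_Matuszewska FR \<le> upper_Matuszewska FR" "upper_Matuszewska FR < ereal p2"
      and moments: "moment_series_finite M \<theta> \<xi> p1 p2 (if upper_Matuszewska FR < 1 then 1 else p2)"
    using assms(13) by (auto simp: FR_def)
  define \<rho> where "\<rho> = (if upper_Matuszewska FR < 1 then 1 else p2)"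
  have rho: "upper_Matuszewska FR < ereal \<rho>" "1 \<le> \<rho>"
    using p(4) by (auto simp: \<rho>_def not_less one_ereal_def dest: le_less_trans)
  \<comment> \<open>The upper index is below \<open>p2\<close> by assumption and below \<rho> by the
    choice of \<rho>; \<open>q\<close> is taken from the gap.\<close>
  have "upper_Matuszewska FR < ereal (min p2 \<rho>)"
    using p(4) rho(1) by (simp add: min_def)
  then obtain q where q: "upper_Matuszewska FR < ereal q" "ereal q < ereal (min p2 \<rho>)"
    using ereal_dense2 by blast
  have "ereal p1 < ereal q" using p(2,3) q(1) by (metis le_less_trans less_le_trans less_trans)
  then have pq: "p1 \<le> q" "q \<le> p2" "q < \<rho>" using q(2) by auto
  obtain C D where CD: "C > 0" "D > 0"
    "\<And>x \<theta>. x \<ge> D \<Longrightarrow> \<theta> > 0 \<Longrightarrow> ?f (x / \<theta>) \<le> C * (\<theta> powr p1 + \<theta> powr q) * ?f x"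
    by (rule tail_Potter_bound[OF pt p(1,2) q(1)]) blast
  define F1 where "F1 = join_algebra (process_algebra M (count_space UNIV) {0..} (claim_number \<theta>))
    (process_algebra M borel {0..} \<xi>)"
  define F2 where "F2 = process_algebra M borel UNIV X"
  note I = mutually_independentD[OF \<open>prob_space M\<close> ind, folded F1_def F2_def]
  define \<Theta> where "\<Theta> i \<omega> = exp (- \<xi> (arrival \<theta> i \<omega>) \<omega>)" for i \<omega>
  have \<Theta>_powr: "\<Theta> i \<omega> powr r = exp (- r * \<xi> (arrival \<theta> i \<omega>) \<omega>)" for i \<omega> r
    by (simp add: \<Theta>_def exp_powr_real mult.commute)
  interpret D: discounted_claims_model M F1 F2 \<Theta> ?f p1 q p2 \<rho> C D
  proof (unfold_locales)
    show "\<Theta> i \<in> borel_measurable F1" for i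
      unfolding \<Theta>_def F1_def using measurable_discount_factor[OF R Cd, of i] by measurable
    show "integrable M (\<lambda>\<omega>. \<Theta> i \<omega> powr p1)" "integrable M (\<lambda>\<omega>. \<Theta> i \<omega> powr p2)" for i
      using moments by (auto simp: moment_series_finite_def \<Theta>_powr)
    show "summable (\<lambda>i. max (expectation (\<lambda>\<omega>. \<Theta> i \<omega> powr p1)) (expectation (\<lambda>\<omega>. \<Theta> i \<omega> powr p2)) powr (1 / \<rho>))"
      using moments by (simp add: moment_series_finite_def \<Theta>_powr moment_def \<rho>_def)
  qed (use I f p CD pq rho in \<open>auto simp: \<Theta>_def\<close>)
  have X2: "X i \<in> borel_measurable F2" for i
    unfolding F2_def by (rule measurable_process_algebra) auto
  \<comment> \<open>Outside the quadrant, a null event, \<open>reduce A\<close> may be negative.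
    Cutting off at 0 gives nonnegativity at every outcome and changes no exceedance of a positive
    level.\<close>
  define V where "V i \<omega> = max 0 (reduce A (X i \<omega>))" for i \<omega>
  have V2: "V i \<in> borel_measurable F2" for i
    unfolding V_def using measurable_compose[OF X2 borel_measurable_reduce[OF A]] by measurable
  have V_nonneg: "0 \<le> V i \<omega>" for i \<omega> by (simp add: V_def)
  have V_less: "u < V i \<omega> \<longleftrightarrow> u < reduce A (X i \<omega>)" if "u > 0" for u i \<omega>
    using that by (auto simp: V_def)
  have V_tail: "prob {\<omega> \<in> space M. u < V i \<omega>} = ?f u" if "u > 0" for u i
    using that by (simp add: V_less tailR[of u i])
  have quad: "AE \<omega> in M. \<forall>i. X i \<omega> \<in> quadrant"
  proof -
    have "AE z in distr M borel (X i). z \<in> quadrant" for i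
      unfolding FX using \<open>quadrant_distribution F\<close> by (simp add: quadrant_distribution_def)
    from AE_distrD[OF X this] have "AE \<omega> in M. X i \<omega> \<in> quadrant" for i .
    then show ?thesis by (simp add: AE_all_countable)
  qed
  let ?P = "\<lambda>x. measure M {\<omega>\<in>space M. discounted_claims X \<theta> \<xi> \<omega> \<in> scale_set x A}"
  let ?S = "\<lambda>x. {\<omega> \<in> space M. \<exists>N. x < (\<Sum>i<N. \<Theta> i \<omega> * V i \<omega>)}"
  have dc: "discounted_claims X \<theta> \<xi> \<omega> = (\<Sum>i. \<Theta> i \<omega> *\<^sub>R X i \<omega>)" for \<omega>
    by (simp add: discounted_claims_def \<Theta>_def)
  have V_meas [measurable]: "V i \<in> borel_measurable M" for i
    by (rule measurable_from_subalg[OF I(1)[folded F2_def] V2])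
  have red: "\<Theta> i \<omega> *\<^sub>R X i \<omega> \<in> quadrant" "reduce A (\<Theta> i \<omega> *\<^sub>R X i \<omega>) = \<Theta> i \<omega> * V i \<omega>"
    if "X i \<omega> \<in> quadrant" for i \<omega>
    using that reduce_scaleR[OF A that, of "\<Theta> i \<omega>"] reduce_nonneg[OF A that] D.\<Theta>_pos[of i \<omega>]
    by (auto simp: V_def quadrant_def)
  obtain x0 where x0: "\<And>z x. \<not> summable z \<Longrightarrow> x > x0 \<Longrightarrow> x > 0 \<Longrightarrow> suminf z \<notin> scale_set x A"
    by (rule ex_bound_not_summable[OF A]) blast
  \<comment> \<open>Divergent outcomes are excluded through \<open>x > x0\<close>, so the upper
    bound does not presuppose convergence of the claim series.\<close>
  have upper: "?P x \<le> prob (?S x)" if x: "x > x0" "x > 0" for x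
  proof (rule finite_measure_mono_AE)
    show "AE \<omega> in M. \<omega> \<in> {\<omega> \<in> space M. discounted_claims X \<theta> \<xi> \<omega> \<in> scale_set x A} \<longrightarrow> \<omega> \<in> ?S x"
      using quad
    proof eventually_elim
      case (elim \<omega>)
      show ?case
      proof
        assume \<omega>: "\<omega> \<in> {\<omega> \<in> space M. discounted_claims X \<theta> \<xi> \<omega> \<in> scale_set x A}"
        then have "summable (\<lambda>i. \<Theta> i \<omega> *\<^sub>R X i \<omega>)" using x0[OF _ x] by (auto simp: dc)
        from suminf_mem_scale_setD[OF A _ this x(2)] \<omega> show "\<omega> \<in> ?S x" using elim by (simp add: dc red)
      qed
    qed
  qed measurable
  have ev_upper: "\<forall>\<^sub>F x in at_top. ?P x \<le> prob (?S x)"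
    using eventually_gt_at_top[of x0] eventually_gt_at_top[of 0] by eventually_elim (rule upper)
  show ?thesis
  proof (intro conjI impI)
    assume zero: "limit_mass \<mu> A = 0"
    define K where "K = D.series_const * (\<Sum>i. D.weight (i + 0)) powr \<rho>"
    have "((\<lambda>x. ?P x / tail G x) \<longlongrightarrow> 0) at_top"
    proof (rule tendsto_sandwich[OF _ _ tendsto_const])
      show "((\<lambda>x. K * (?f x / tail G x)) \<longlongrightarrow> 0) at_top"
        using tendsto_mult[OF tendsto_const fg, of K] zero by simp
      show "\<forall>\<^sub>F x in at_top. 0 \<le> ?P x / tail G x" using gpos by (simp add: less_imp_le)
      show "\<forall>\<^sub>F x in at_top. ?P x / tail G x \<le> K * (?f x / tail G x)"
        using ev_upper eventually_ge_at_top[of D]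
      proof eventually_elim
        case (elim x)
        have "prob {\<omega> \<in> space M. \<exists>N. x < (\<Sum>i\<in>{0..<N}. \<Theta> i \<omega> * V i \<omega>)} \<le>
            D.series_const * 1 * ?f x * (\<Sum>i. D.weight (i + 0)) powr \<rho>"
          by (rule D.prob_series_exceeds_le[OF V2 V_nonneg _ _ elim(2)]) (simp_all add: V_tail)
        with elim(1) have "?P x \<le> K * ?f x" by (simp add: K_def atLeast0LessThan mult_ac)
        then show ?case using divide_right_mono[of "?P x" "K * ?f x" "tail G x"] gpos[of x] by simp
      qed
    qed
    then show "?P \<in> o[at_top](tail G)"
      by (rule smalloI_tendsto) (use gpos in \<open>auto simp: less_imp_neq[THEN not_sym]\<close>)
  next
    assume pos: "limit_mass \<mu> A > 0"
    interpret W: regular_claims_model M F1 F2 \<Theta> ?f p1 q p2 \<rho> C D V "tail G" \<alpha> "limit_mass \<mu> A"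
    proof (unfold_locales)
      fix i j :: nat assume "i \<noteq> j"
      with \<open>QAI_on A M X\<close>
      have "((\<lambda>x. prob {\<omega>\<in>space M. reduce A (X i \<omega>) > x \<and> reduce A (X j \<omega>) > x} / (?f x + ?f x)) \<longlongrightarrow> 0) at_top"
        by (simp add: QAI_on_def QAI_def tailR[symmetric])
      \<comment> \<open>Identical distributions make the denominator in the definition of
        \<open>QAI\<close> equal to \<open>2 * ?f x\<close>.\<close>
      from tendsto_mult[OF this tendsto_const[of 2]]
      have "((\<lambda>x. prob {\<omega>\<in>space M. reduce A (X i \<omega>) > x \<and> reduce A (X j \<omega>) > x} / ?f x) \<longlongrightarrow> 0) at_top"
        by simp
      then show "((\<lambda>x. prob {\<omega> \<in> space M. x < V i \<omega> \<and> x < V j \<omega>} / ?f x) \<longlongrightarrow> 0) at_top"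
        by (rule Lim_transform_eventually, intro eventually_mono[OF eventually_gt_at_top[of 0]]) (simp add: V_less)
    qed (use V2 V_tail gpos V_nonneg regularly_varying_ratio[OF G] pos fg in auto)
    \<comment> \<open>Positive limit mass makes \<open>?f\<close> comparable to
      \<open>tail G\<close>, so that a multiple of \<open>?f\<close> bounds the tail of the
      norms.\<close>
    obtain B where B: "B \<ge> 0" "\<And>u. u > 0 \<Longrightarrow> measure F {z. u < norm z} \<le> B * ?f u"
      by (rule MRV_norm_tail_bound[OF MRV f pos fg]) blast
    have sums: "AE \<omega> in M. summable (\<lambda>i. \<Theta> i \<omega> *\<^sub>R X i \<omega>)"
    proof -
      \<comment> \<open>Outcomes with unbounded partial sums of norms. They exceed every level, and
        the probability of exceeding level \<open>n\<close> is at most a multiple of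
        \<open>?f (real n)\<close>, which tends to 0.\<close>
      define E where "E = {\<omega> \<in> space M. \<forall>x::nat. \<exists>N. real x < (\<Sum>i\<in>{0..<N}. \<Theta> i \<omega> * norm (X i \<omega>))}"
      have E: "E \<in> events" unfolding E_def by measurable
      define K where "K = D.series_const * B * (\<Sum>i. D.weight (i + 0)) powr \<rho>"
      have bound: "prob E \<le> K * ?f (real n)" if "real n \<ge> D" for n
      proof -
        have "prob E \<le> prob {\<omega> \<in> space M. \<exists>N. real n < (\<Sum>i\<in>{0..<N}. \<Theta> i \<omega> * norm (X i \<omega>))}"
          by (rule finite_measure_mono) (auto simp: E_def)
        also have "\<dots> \<le> D.series_const * B * ?f (real n) * (\<Sum>i. D.weight (i + 0)) powr \<rho>"
        proof (rule D.prob_series_exceeds_le[OF _ _ B(1) _ that])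
          show "(\<lambda>\<omega>. norm (X i \<omega>)) \<in> borel_measurable F2" for i using X2[of i] by measurable
          show "prob {\<omega> \<in> space M. u < norm (X i \<omega>)} \<le> B * ?f u" if "u > 0" for i u
          proof -
            have "measure F {z. u < norm z} = prob {\<omega> \<in> space M. u < norm (X i \<omega>)}"
              unfolding FX[of i, symmetric] by (subst measure_distr) (auto intro!: arg_cong[where f=prob])
            then show ?thesis using B(2)[OF that] by simp
          qed
        qed simp
        finally show ?thesis by (simp add: K_def mult_ac)
      qed
      have "\<forall>\<^sub>F n in sequentially. prob E \<le> K * ?f (real n)"
        using eventually_ge_at_top[of "nat \<lceil>D\<rceil>"]
      proof eventually_elim
        case (elim n)
        then have "real n \<ge> D" by linarith
        then show ?case by (rule bound)
      qed
      moreover have "(\<lambda>n. K * ?f (real n)) \<longlonglongrightarrow> K * 0"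
        by (intro tendsto_mult tendsto_const filterlim_compose[OF tail_tendsto_0[OF pt] filterlim_real_sequentially])
      ultimately have "prob E \<le> K * 0" by (intro tendsto_lowerbound) auto
      then have "prob E = 0" by (simp add: measure_le_0_iff)
      then have "AE \<omega> in M. \<omega> \<notin> E" using E by (simp add: AE_iff_measurable emeasure_eq_measure prob_eq_0)
      with AE_space show ?thesis
      proof eventually_elim
        case (elim \<omega>)
        then obtain x where x: "(\<Sum>i\<in>{0..<N}. \<Theta> i \<omega> * norm (X i \<omega>)) \<le> real x" for N
          by (auto simp: E_def not_less)
        have "summable (\<lambda>i. norm (\<Theta> i \<omega> *\<^sub>R X i \<omega>))"
          by (rule summableI_nonneg_bounded[of _ "real x"])
             (use x D.\<Theta>_pos[of _ \<omega>] in \<open>auto simp: atLeast0LessThan less_imp_le\<close>)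
        then show ?case by (rule summable_norm_cancel)
      qed
    qed
    have D_meas: "discounted_claims X \<theta> \<xi> \<in> borel_measurable M"
      unfolding dc by measurable
    have lower: "prob {\<omega> \<in> space M. \<exists>i<n. x < W.Z i \<omega>} \<le> ?P x" if x: "x > 0" for n x
    proof (rule finite_measure_mono_AE)
      show "AE \<omega> in M. \<omega> \<in> {\<omega> \<in> space M. \<exists>i<n. x < W.Z i \<omega>} \<longrightarrow>
          \<omega> \<in> {\<omega> \<in> space M. discounted_claims X \<theta> \<xi> \<omega> \<in> scale_set x A}"
        using quad sums
      proof eventually_elim
        case (elim \<omega>)
        show ?case
        proof
          assume "\<omega> \<in> {\<omega> \<in> space M. \<exists>i<n. x < W.Z i \<omega>}"
          then obtain i where i: "\<omega> \<in> space M" "x < W.Z i \<omega>" by auto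
          have "(\<Sum>i. \<Theta> i \<omega> *\<^sub>R X i \<omega>) \<in> scale_set x A"
            by (rule suminf_mem_scale_setI[OF A _ elim(2) x, of i]) (use elim i in \<open>auto simp: red W.Z_def\<close>)
          with i show "\<omega> \<in> {\<omega> \<in> space M. discounted_claims X \<theta> \<xi> \<omega> \<in> scale_set x A}" by (simp add: dc)
        qed
      qed
      have "open (scale_set x A)" using A x by (auto simp: scale_set_def risk_sets_def intro: open_scaling)
      from measurable_sets[OF D_meas borel_open[OF this]]
      show "{\<omega> \<in> space M. discounted_claims X \<theta> \<xi> \<omega> \<in> scale_set x A} \<in> events"
        by (simp add: vimage_def Int_def conj_commute)
    qed
    have lim: "((\<lambda>x. ?P x / tail G x) \<longlongrightarrow> limit_mass \<mu> A * (\<Sum>i. W.e i)) at_top"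
    proof (rule W.single_big_jump)
      show "\<forall>\<^sub>F x in at_top. prob {\<omega> \<in> space M. \<exists>i<n. x < W.Z i \<omega>} \<le> ?P x" for n
        using eventually_gt_at_top[of 0] by eventually_elim (rule lower)
      show "\<forall>\<^sub>F x in at_top. ?P x \<le> prob {\<omega> \<in> space M. \<exists>N. x < (\<Sum>i<N. W.Z i \<omega>)}"
        using ev_upper by (simp add: W.Z_def)
    qed
    have int: "enn2real (renewal_integral M \<theta> \<xi> \<alpha>) = (\<Sum>i. W.e i)"
    proof -
      have "(\<integral>\<^sup>+\<omega>. ennreal (exp (- \<alpha> * \<xi> (arrival \<theta> i \<omega>) \<omega>)) \<partial>M) = ennreal (W.e i)" for i
        using nn_integral_eq_integral[OF W.int_alpha[of i]] by (simp add: W.e_def \<Theta>_powr)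
      then have "renewal_integral M \<theta> \<xi> \<alpha> = ennreal (\<Sum>i. W.e i)"
        using renewal_integral_eq_suminf[OF \<open>prob_space M\<close> R Cd ind, of \<alpha>] W.summable_e W.e_nonneg
        by (simp add: suminf_ennreal2)
      then show ?thesis using W.summable_e W.e_nonneg by (simp add: suminf_nonneg)
    qed
    have e_pos: "(\<Sum>i. W.e i) > 0"
      using suminf_pos[OF W.summable_e W.e_pos] .
    define c where "c = limit_mass \<mu> A * (\<Sum>i. W.e i)"
    have c: "c > 0" using pos e_pos by (simp add: c_def)
    show "?P \<sim>[at_top] (\<lambda>x. limit_mass \<mu> A * tail G x * enn2real (renewal_integral M \<theta> \<xi> \<alpha>))"
    proof (rule asymp_equivI')
      have "((\<lambda>x. ?P x / tail G x / c) \<longlongrightarrow> c / c) at_top"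
        using lim c by (intro tendsto_divide tendsto_const) (auto simp: c_def)
      then show "((\<lambda>x. ?P x / (limit_mass \<mu> A * tail G x * enn2real (renewal_integral M \<theta> \<xi> \<alpha>))) \<longlongrightarrow> 1) at_top"
        using pos e_pos by (simp add: int c_def mult_ac)
    qed
  qed
qed

end
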